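(* The equivalence classes of arrangements of $n$ metric trees are in bijection with the regular matroid subdivisions of the hypersimplex $\Delta(3,n)$. Moreover, the secondary fan structure on the Dressian $\mathrm{Dr}(3,n)$ coincides with the Plücker fan structure.
   Context: Trees have leaves labeled bijectively by a finite set and no degree-2 vertices; a metric tree has non-negative edge lengths, inducing a leaf metric $\delta$. A metric tree arrangement is an $n$-tuple $(T_1,\dots,T_n)$ of metric trees, $T_i$ with leaf set $[n]\setminus\{i\}$ and metric $\delta_i$, such that $\delta_i(j,k)=\delta_j(k,i)=\delta_k(i,j)$ for all pairwise distinct $i,j,k$. Two metric tree arrangements are equivalent if the underlying tuples of (non-metric) labeled trees coincide. $\Delta(3,n)=\mathrm{conv}\{e_X : X\in\binom{[n]}{3}\}$, $e_X=\sum_{i\in X}e_i$. A weight vector $\lambda\in\mathbb{R}^{\binom{[n]}{3}}$ induces the regular subdivision given by lower faces of $\mathrm{conv}\{(e_X,\lambda(X))\}$; a matroid subdivision is one all of whose cells are matroid polytopes (edges parallel to edges of $\Delta(3,n)$). The Dressian $\mathrm{Dr}(3,n)$ is the set of $\lambda$ such that for all pairwise distinct $h,i,j,k,l$ the minimum of $\lambda_{hij}+\lambda_{hkl},\lambda_{hik}+\lambda_{hjl},\lambda_{hil}+\lambda_{hjk}$ is attained at least twice; equivalently, the set of weight vectors inducing matroid subdivisions. Secondary fan structure: $\lambda,\lambda'$ in the same cone iff they induce the same subdivision of $\Delta(3,n)$. Plücker fan structure: $\lambda,\lambda'$ in the same cone iff for every such quintuple the same terms attain the minimum.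
   Formalization: Since edge lengths may be zero, arrangements are called equivalent when their trees coincide after contracting interior edges of length zero; without this the bijection fails (n = 5 with all lengths zero gives 1024 classes against 26 subdivisions). n is at least 3. *)

theory Defs
  imports "HOL-Analysis.Analysis"
begin

text \<open>The label set $[n]$ is a finite type \<open>'n\<close>, so $n$ is \<open>CARD('n)\<close>.\<close>

record ('v, 'a) labeled_graph =
  verts :: "'v set"
  edges :: "'v set set"
  lab :: "'a \<Rightarrow> 'v"

definition simple_path :: "'v set set \<Rightarrow> 'v list \<Rightarrow> bool" where
  "simple_path E p \<longleftrightarrow>
     p \<noteq> [] \<and> distinct p \<and> (\<forall>i. Suc i < length p \<longrightarrow> {p ! i, p ! Suc i} \<in> E)"

definition joins :: "'v set set \<Rightarrow> 'v \<Rightarrow> 'v list \<Rightarrow> 'v \<Rightarrow> bool" where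
  "joins E u p v \<longleftrightarrow> simple_path E p \<and> hd p = u \<and> last p = v"

definition is_tree :: "('v, 'a, 'z) labeled_graph_scheme \<Rightarrow> bool" where
  "is_tree G \<longleftrightarrow>
     finite (verts G) \<and> verts G \<noteq> {} \<and>
     edges G \<subseteq> {{u, v} |u v. u \<in> verts G \<and> v \<in> verts G \<and> u \<noteq> v} \<and>
     (\<forall>u\<in>verts G. \<forall>v\<in>verts G. \<exists>p. joins (edges G) u p v) \<and>
     \<not> (\<exists>p. simple_path (edges G) p \<and> 3 \<le> length p \<and> {last p, hd p} \<in> edges G)"

definition degree :: "('v, 'a, 'z) labeled_graph_scheme \<Rightarrow> 'v \<Rightarrow> nat" where
  "degree G v = card {e \<in> edges G. v \<in> e}"

definition leaves :: "('v, 'a, 'z) labeled_graph_scheme \<Rightarrow> 'v set" where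
  "leaves G = {v \<in> verts G. degree G v = 1}"

definition labeled_tree :: "'a set \<Rightarrow> ('v, 'a, 'z) labeled_graph_scheme \<Rightarrow> bool" where
  "labeled_tree L T \<longleftrightarrow>
     is_tree T \<and> (\<forall>v\<in>verts T. degree T v \<noteq> 2) \<and> bij_betw (lab T) L (leaves T)"

text \<open>Labeled trees are identified along isomorphisms that fix the labels in \<open>L\<close>.\<close>

definition tree_iso ::
  "'a set \<Rightarrow> ('v, 'a, 'y) labeled_graph_scheme \<Rightarrow> ('w, 'a, 'z) labeled_graph_scheme \<Rightarrow> bool" where
  "tree_iso L S T \<longleftrightarrow>
     (\<exists>\<phi>. bij_betw \<phi> (verts S) (verts T) \<and>
          (\<forall>u\<in>verts S. \<forall>v\<in>verts S. {u, v} \<in> edges S \<longleftrightarrow> {\<phi> u, \<phi> v} \<in> edges T) \<and>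
          (\<forall>a\<in>L. \<phi> (lab S a) = lab T a))"

record ('v, 'a) metric_graph = "('v, 'a) labeled_graph" +
  len :: "'v set \<Rightarrow> real"

definition metric_tree :: "'a set \<Rightarrow> ('v, 'a) metric_graph \<Rightarrow> bool" where
  "metric_tree L T \<longleftrightarrow> labeled_tree L T \<and> (\<forall>e\<in>edges T. 0 \<le> len T e)"

definition leaf_metric :: "('v, 'a) metric_graph \<Rightarrow> 'a \<Rightarrow> 'a \<Rightarrow> real" where
  "leaf_metric T a b =
     (let p = (THE p. joins (edges T) (lab T a) p (lab T b))
      in sum_list (map2 (\<lambda>u v. len T {u, v}) p (tl p)))"

text \<open>An interior edge of length zero is invisible to the metric: every tree shape carries the
  zero metric. The non-metric tree underlying a metric tree is therefore the one
  obtained by contracting the interior edges (those not incident to a leaf) of length zero.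
  Leaf edges may have length zero and are never contracted.\<close>

definition collapse :: "('v, 'a) metric_graph \<Rightarrow> ('v \<times> 'v) set" where
  "collapse T =
     Restr ({(u, v). {u, v} \<in> edges T \<and> u \<notin> leaves T \<and> v \<notin> leaves T \<and> len T {u, v} = 0}\<^sup>*)
       (verts T)"

definition underlying_tree :: "('v, 'a) metric_graph \<Rightarrow> ('v set, 'a) labeled_graph" where
  "underlying_tree T =
     \<lparr>verts = verts T // collapse T,
      edges = {{collapse T `` {u}, collapse T `` {v}} |u v.
                 {u, v} \<in> edges T \<and> (u, v) \<notin> collapse T},
      lab = (\<lambda>a. collapse T `` {lab T a})\<rparr>"

text \<open>Every finite tree has a copy with vertices in \<^typ>\<open>nat\<close>.\<close>

definition arrangements :: "('n::finite \<Rightarrow> (nat, 'n) metric_graph) set" where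
  "arrangements =
     {T. (\<forall>i. metric_tree (UNIV - {i}) (T i)) \<and>
         (\<forall>i j k. distinct [i, j, k] \<longrightarrow>
            leaf_metric (T i) j k = leaf_metric (T j) k i \<and>
            leaf_metric (T j) k i = leaf_metric (T k) i j)}"

definition arrangement_equiv ::
  "(('n::finite \<Rightarrow> (nat, 'n) metric_graph) \<times> ('n \<Rightarrow> (nat, 'n) metric_graph)) set" where
  "arrangement_equiv =
     {(S, T). S \<in> arrangements \<and> T \<in> arrangements \<and>
        (\<forall>i. tree_iso (UNIV - {i}) (underlying_tree (S i)) (underlying_tree (T i)))}"

definition triples :: "'n::finite set set" where
  "triples = {X. card X = 3}"

definition weights :: "('n::finite set \<Rightarrow> real) set" where
  "weights = triples \<rightarrow>\<^sub>E UNIV"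

definition e_vec :: "'n::finite set \<Rightarrow> real ^ 'n" where
  "e_vec X = (\<Sum>i\<in>X. axis i 1)"

definition hypersimplex :: "(real ^ 'n::finite) set" where
  "hypersimplex = convex hull (e_vec ` triples)"

definition lifted_polytope :: "('n::finite set \<Rightarrow> real) \<Rightarrow> ((real ^ 'n) \<times> real) set" where
  "lifted_polytope w = convex hull ((\<lambda>X. (e_vec X, w X)) ` triples)"

text \<open>The lower faces are the non-empty faces with an inner normal vector whose last coordinate is
  positive, scaled here to be 1.\<close>

definition lower_face :: "('a::real_inner \<times> real) set \<Rightarrow> ('a \<times> real) set \<Rightarrow> bool" where
  "lower_face F P \<longleftrightarrow>
     F \<noteq> {} \<and> (\<exists>c b. P \<subseteq> {z. (c, 1) \<bullet> z \<ge> b} \<and> F = P \<inter> {z. (c, 1) \<bullet> z = b})"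

definition induced_subdivision :: "('n::finite set \<Rightarrow> real) \<Rightarrow> (real ^ 'n) set set" where
  "induced_subdivision w = {fst ` F |F. lower_face F (lifted_polytope w)}"

definition matroid_polytope :: "(real ^ 'n::finite) set \<Rightarrow> bool" where
  "matroid_polytope P \<longleftrightarrow>
     (\<exists>B. B \<noteq> {} \<and> B \<subseteq> triples \<and> P = convex hull (e_vec ` B)) \<and>
     (\<forall>E. E edge_of P \<longrightarrow>
        (\<exists>E'. E' edge_of (hypersimplex :: (real ^ 'n) set) \<and>
              affine_parallel (affine hull E) (affine hull E')))"

definition regular_matroid_subdivisions :: "(real ^ 'n::finite) set set set" where
  "regular_matroid_subdivisions =
     {induced_subdivision w |w. w \<in> weights \<and> (\<forall>C\<in>induced_subdivision w. matroid_polytope C)}"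

text \<open>The term $\lambda_{hij}+\lambda_{hkl}$ is encoded as the set \<open>{{h, i, j}, {h, k, l}}\<close>.\<close>

definition pluecker_terms :: "'n \<Rightarrow> 'n \<Rightarrow> 'n \<Rightarrow> 'n \<Rightarrow> 'n \<Rightarrow> 'n set set set" where
  "pluecker_terms h i j k l =
     {{{h, i, j}, {h, k, l}}, {{h, i, k}, {h, j, l}}, {{h, i, l}, {h, j, k}}}"

definition minimal_terms ::
  "('n set \<Rightarrow> real) \<Rightarrow> 'n \<Rightarrow> 'n \<Rightarrow> 'n \<Rightarrow> 'n \<Rightarrow> 'n \<Rightarrow> 'n set set set" where
  "minimal_terms w h i j k l =
     {t \<in> pluecker_terms h i j k l. \<forall>s \<in> pluecker_terms h i j k l. sum w t \<le> sum w s}"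

definition dressian :: "('n::finite set \<Rightarrow> real) set" where
  "dressian =
     {w \<in> weights. \<forall>h i j k l. distinct [h, i, j, k, l] \<longrightarrow> 2 \<le> card (minimal_terms w h i j k l)}"

text \<open>A fan structure is given by its decomposition into relatively open cones, that is, by the
  classes of the relation of lying in the same cone.\<close>

definition secondary_fan :: "('n::finite set \<Rightarrow> real) set set" where
  "secondary_fan =
     dressian // {(w, w'). w \<in> dressian \<and> w' \<in> dressian \<and>
                           induced_subdivision w = induced_subdivision w'}"

definition pluecker_fan :: "('n::finite set \<Rightarrow> real) set set" where
  "pluecker_fan =
     dressian // {(w, w'). w \<in> dressian \<and> w' \<in> dressian \<and>
                           (\<forall>h i j k l. distinct [h, i, j, k, l] \<longrightarrow>
                              minimal_terms w h i j k l = minimal_terms w' h i j k l)}"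

end

theory Submission imports Defs begin

text \<open>
Adding a constant and a linear functional turns a cell of the subdivision into the zero set of a
nonnegative weight. For a weight on the Dressian the three-term relations give basis exchange for such zero sets,
so cells are matroid polytopes; conversely, a term that alone attains the minimum yields a cell that is a diagonal of an
octahedron. A term is minimal iff its two triples lie in a common cell, so the subdivision determines the
minimal terms. For the converse join two weights with the same minimal terms by a segment: their difference
is linear on every cell met along the way (check the 4- and 6-cycles of a fundamental graph), so being a cell is an open
and closed condition on the segment.

On the tree side, a term at \<open>h\<close> is nonminimal for the negated leaf metrics iff the corresponding quartet is
displayed by the tree at \<open>h\<close>. A contracted tree is determined by its splits, its vertices being the majority
orientations of the splits, and the splits are determined by the quartets. Every weight in the Dressian is,
up to a constant, a negated arrangement of tree metrics by Buneman's four-point theorem.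
\<close>

section \<open>Cells of regular subdivisions\<close>

text \<open>The two fan structures record different amounts of data: minimal terms see only
  octahedra, while a subdivision records cells of every dimension. Closing this gap is the main
  obstacle. Along the segment, openness comes from linearity of the difference on a cell. Closedness
  is not obvious, since in a limit a cell may survive only as part of a larger cell
  \<open>A\<close>. But \<open>A\<close> itself persists nearby, the old cell is a face of
  \<open>A\<close> there, and whether a set is a face of \<open>A\<close> does not depend on the
  weight that has \<open>A\<close> as a cell.

  Negation is forced: for tree metrics the largest of the three sums is attained twice, in the
  Dressian the smallest. Weights may be negative or violate triangle inequalities, but a constant
  moves all terms equally and can be added freely. Quartets do not see leaf edges or interior edges
  of length zero; this matches the comparison of trees after contraction of the latter.\<close>

lemma inner_e_vec: "e_vec X \<bullet> x = (\<Sum>i\<in>X. x $ i)"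
  by (simp add: e_vec_def inner_sum_left inner_axis')

lemma inner_e_vec_e_vec: "e_vec X \<bullet> e_vec Y = card (X \<inter> Y)"
  for X Y :: "'n::finite set"
proof -
  have "e_vec Y $ i = (if i \<in> Y then 1 else 0)" for i
    by (simp add: e_vec_def axis_def sum_component)
  then show ?thesis
    by (simp add: inner_e_vec sum.If_cases)
qed

lemma card_triple: "X \<in> triples \<Longrightarrow> card X = 3"
  by (simp add: triples_def)

lemma triple_mem: "distinct [i, j, k] \<Longrightarrow> {i, j, k} \<in> triples"
  by (simp add: triples_def)

lemma triples_inter_card:
  fixes X Y :: "'n::finite set"
  assumes "X \<in> triples" "Y \<in> triples" "X \<noteq> Y"
  shows "card (X \<inter> Y) \<le> 2"
proof (rule ccontr)
  assume "\<not> ?thesis"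
  then have "3 \<le> card (X \<inter> Y)" by simp
  then have "X \<inter> Y = X" "X \<inter> Y = Y"
    by (metis Int_lower1 assms(1) card_seteq card_triple finite)
       (metis \<open>3 \<le> card (X \<inter> Y)\<close> Int_lower2 assms(2) card_seteq card_triple finite)
  then show False using assms by auto
qed

text \<open>The functional \<open>e_vec X\<close> is 3 at the vertex \<open>e_vec X\<close> and at
  most 2 at all others, so every vertex is exposed. Hence a cell can be recovered from its polytope,
  and subdivisions can be compared as families of sets of triples.\<close>

lemma e_vec_in_hull_iff:
  fixes X :: "'n::finite set"
  assumes "X \<in> triples" "B \<subseteq> triples"
  shows "e_vec X \<in> convex hull (e_vec ` B) \<longleftrightarrow> X \<in> B"
proof
  assume *: "e_vec X \<in> convex hull (e_vec ` B)"
  show "X \<in> B"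
  proof (rule ccontr)
    assume "X \<notin> B"
    then have "e_vec ` B \<subseteq> {x. e_vec X \<bullet> x \<le> 2}"
      using assms triples_inter_card by (fastforce simp: inner_e_vec_e_vec)
    then have "convex hull (e_vec ` B) \<subseteq> {x. e_vec X \<bullet> x \<le> 2}"
      by (rule hull_minimal) (rule convex_halfspace_le)
    then show False
      using * assms by (auto simp: inner_e_vec_e_vec card_triple)
  qed
qed (simp add: hull_inc)

lemma hull_e_vec_inj:
  "inj_on (\<lambda>B :: 'n::finite set set. convex hull (e_vec ` B)) (Pow triples)"
proof (rule inj_onI)
  fix A B :: "'n set set"
  assume "A \<in> Pow triples" "B \<in> Pow triples"
    and "convex hull (e_vec ` A) = convex hull (e_vec ` B)"
  then show "A = B"
    using e_vec_in_hull_iff by blast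
qed

text \<open>A face of a finitely generated hull is the hull of some of the generators, and these
  must then lie on the hyperplane.\<close>

lemma convex_hull_Int_supporting_hyperplane:
  fixes S :: "'a::euclidean_space set"
  assumes "finite S" "\<And>x. x \<in> S \<Longrightarrow> b \<le> a \<bullet> x"
  shows "convex hull S \<inter> {x. a \<bullet> x = b} = convex hull {x \<in> S. a \<bullet> x = b}" (is "?F = ?R")
proof
  have le: "convex hull S \<subseteq> {x. b \<le> a \<bullet> x}"
    using assms(2) by (intro hull_minimal) (auto simp: convex_halfspace_ge)
  then have "?F face_of convex hull S"
    by (intro face_of_Int_supporting_hyperplane_ge) auto
  then obtain S' where S': "S' \<subseteq> S" "?F = convex hull S'"
    using face_of_convex_hull_subset assms(1) finite_imp_compact by metis
  have "S' \<subseteq> ?F"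
    using S' hull_subset by metis
  then have "S' \<subseteq> {x \<in> S. a \<bullet> x = b}"
    using S' by blast
  then show "?F \<subseteq> ?R"
    using S' hull_mono by metis
  have "convex hull {x \<in> S. a \<bullet> x = b} \<subseteq> {x. a \<bullet> x = b}"
    by (rule hull_minimal) (auto simp: convex_hyperplane)
  moreover have "convex hull {x \<in> S. a \<bullet> x = b} \<subseteq> convex hull S"
    by (rule hull_mono) auto
  ultimately show "?R \<subseteq> ?F" by auto
qed

text \<open>Lower faces given by their vertex sets and normalised to height zero. The height of the
  supporting hyperplane can be absorbed into \<open>c\<close> because all triples have the same
  size.\<close>

definition cells :: "('n::finite set \<Rightarrow> real) \<Rightarrow> 'n set set set" where
  "cells w = {B. B \<noteq> {} \<and> (\<exists>c. (\<forall>X\<in>triples. 0 \<le> w X + sum c X) \<and>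
                                  B = {X \<in> triples. w X + sum c X = 0})}"

lemma cells_subset_triples: "B \<in> cells w \<Longrightarrow> B \<subseteq> triples"
  by (auto simp: cells_def)

lemma cellsE:
  assumes "B \<in> cells w"
  obtains c where "\<And>X. X \<in> triples \<Longrightarrow> 0 \<le> w X + sum c X"
    "\<And>X. X \<in> triples \<Longrightarrow> X \<in> B \<longleftrightarrow> w X + sum c X = 0"
  using assms by (auto simp: cells_def)

lemma cellsI:
  assumes "B \<noteq> {}" "B \<subseteq> triples" "\<And>X. X \<in> B \<Longrightarrow> w X + sum c X = b"
    "\<And>X. X \<in> triples - B \<Longrightarrow> b < w X + sum c X"
  shows "B \<in> cells w"
proof -
  \<comment> \<open>A triple has three elements, so lowering each coordinate by \<open>b / 3\<close>
    lowers every sum by \<open>b\<close>.\<close>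
  define c' where "c' i = c i - b / 3" for i
  have c': "sum c' X = sum c X - b" if "X \<in> triples" for X
    using that by (simp add: c'_def sum_subtractf card_triple)
  have "\<forall>X\<in>triples. 0 \<le> w X + sum c' X"
    using assms(3,4) by (force simp: c')
  moreover have "B = {X \<in> triples. w X + sum c' X = 0}"
    using assms(2-4) by (force simp: c')
  ultimately show ?thesis
    using assms(1) unfolding cells_def by blast
qed

lemma lower_face_lifted_polytope:
  fixes w :: "'n::finite set \<Rightarrow> real" and c :: "real ^ 'n"
  assumes "\<And>X. X \<in> triples \<Longrightarrow> b \<le> w X + (\<Sum>i\<in>X. c $ i)"
  shows "fst ` (lifted_polytope w \<inter> {z. (c, 1) \<bullet> z = b})
    = convex hull (e_vec ` {X \<in> triples. w X + (\<Sum>i\<in>X. c $ i) = b})"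
proof -
  let ?S = "(\<lambda>X. (e_vec X :: real ^ 'n, w X)) ` triples"
  have val: "(c, 1) \<bullet> (e_vec X, w X) = w X + (\<Sum>i\<in>X. c $ i)" for X
    by (simp add: inner_Pair inner_commute[of c] inner_e_vec)
  have "lifted_polytope w \<inter> {z. (c, 1) \<bullet> z = b} = convex hull {z \<in> ?S. (c, 1) \<bullet> z = b}"
    unfolding lifted_polytope_def
    by (rule convex_hull_Int_supporting_hyperplane) (use assms val in \<open>auto simp del: inner_Pair\<close>)
  then have "fst ` (lifted_polytope w \<inter> {z. (c, 1) \<bullet> z = b})
      = convex hull (fst ` {z \<in> ?S. (c, 1) \<bullet> z = b})"
    by (simp add: convex_hull_linear_image linear_fst)
  also have "fst ` {z \<in> ?S. (c, 1) \<bullet> z = b} = e_vec ` {X \<in> triples. w X + (\<Sum>i\<in>X. c $ i) = b}"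
    unfolding val[symmetric] by force
  finally show ?thesis .
qed

lemma induced_subdivision_eq_cells:
  fixes w :: "'n::finite set \<Rightarrow> real"
  shows "induced_subdivision w = (\<lambda>B. convex hull (e_vec ` B)) ` cells w"
proof
  let ?L = "lifted_polytope w"
  have vert: "(e_vec X, w X) \<in> ?L" if "X \<in> triples" for X
    using that by (simp add: lifted_polytope_def hull_inc)
  have val: "(c, 1) \<bullet> (e_vec X, w X) = w X + (\<Sum>i\<in>X. c $ i)" for X and c :: "real ^ 'n"
    by (simp add: inner_Pair inner_commute[of c] inner_e_vec)
  show "induced_subdivision w \<subseteq> (\<lambda>B. convex hull (e_vec ` B)) ` cells w"
  proof
    fix C assume "C \<in> induced_subdivision w"
    then obtain F c b where F: "C = fst ` F" "F \<noteq> {}" "?L \<subseteq> {z. (c, 1) \<bullet> z \<ge> b}"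
      "F = ?L \<inter> {z. (c, 1) \<bullet> z = b}"
      by (auto simp: induced_subdivision_def lower_face_def)
    let ?B = "{X \<in> triples. w X + (\<Sum>i\<in>X. c $ i) = b}"
    have ge: "b \<le> w X + (\<Sum>i\<in>X. c $ i)" if "X \<in> triples" for X
      using F(3) vert[OF that] val[of c X] by auto
    have C: "C = convex hull (e_vec ` ?B)"
      unfolding F(1,4) by (rule lower_face_lifted_polytope) (rule ge)
    have "?B \<noteq> {}"
    proof
      assume "?B = {}"
      then have "fst ` F = {}" using C F(1) by simp
      then show False using F(2) by simp
    qed
    then have "?B \<in> cells w"
      by (rule cellsI[where c = "\<lambda>i. c $ i" and b = b]) (use ge in \<open>force+\<close>)
    then show "C \<in> (\<lambda>B. convex hull (e_vec ` B)) ` cells w" using C by blast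
  qed
  show "(\<lambda>B. convex hull (e_vec ` B)) ` cells w \<subseteq> induced_subdivision w"
  proof clarify
    fix B assume B: "B \<in> cells w"
    then obtain c where c: "\<And>X. X \<in> triples \<Longrightarrow> 0 \<le> w X + sum c X"
      "\<And>X. X \<in> triples \<Longrightarrow> X \<in> B \<longleftrightarrow> w X + sum c X = 0"
      using cellsE by blast
    define v :: "real ^ 'n" where "v = (\<chi> i. c i)"
    let ?F = "?L \<inter> {z. (v, 1) \<bullet> z = 0}"
    have B': "B = {X \<in> triples. w X + (\<Sum>i\<in>X. v $ i) = 0}"
      using c(2) cells_subset_triples[OF B] by (auto simp: v_def)
    have F: "fst ` ?F = convex hull (e_vec ` B)"
      unfolding B' by (rule lower_face_lifted_polytope) (simp add: v_def c(1))
    have "B \<noteq> {}" using B by (simp add: cells_def)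
    then have "?F \<noteq> {}" using F by (metis convex_hull_eq_empty image_is_empty)
    moreover have "?L \<subseteq> {z. 0 \<le> (v, 1) \<bullet> z}"
      unfolding lifted_polytope_def
      by (rule hull_minimal) (auto simp: convex_halfspace_ge val v_def c(1) simp del: inner_Pair)
    ultimately have "lower_face ?F ?L"
      unfolding lower_face_def by blast
    then show "convex hull (e_vec ` B) \<in> induced_subdivision w"
      using F unfolding induced_subdivision_def by blast
  qed
qed

lemma induced_subdivision_eq_iff:
  "induced_subdivision w = induced_subdivision w' \<longleftrightarrow> cells w = cells w'"
  unfolding induced_subdivision_eq_cells
  by (rule inj_on_image_eq_iff[OF hull_e_vec_inj]) (auto dest: cells_subset_triples)

text \<open>The first term is not strictly below both others. As all orderings of the labels occur,
  this amounts to the minimum being attained twice.\<close>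

definition three_term :: "('n set \<Rightarrow> real) \<Rightarrow> bool" where
  "three_term w \<longleftrightarrow> (\<forall>h i j k l. distinct [h, i, j, k, l] \<longrightarrow>
     min (w {h, i, k} + w {h, j, l}) (w {h, i, l} + w {h, j, k}) \<le> w {h, i, j} + w {h, k, l})"

definition term_minimal :: "('n set \<Rightarrow> real) \<Rightarrow> 'n \<Rightarrow> 'n \<Rightarrow> 'n \<Rightarrow> 'n \<Rightarrow> 'n \<Rightarrow> bool" where
  "term_minimal w h i j k l \<longleftrightarrow>
     w {h, i, j} + w {h, k, l} \<le> min (w {h, i, k} + w {h, j, l}) (w {h, i, l} + w {h, j, k})"

lemma sum_term:
  fixes w :: "'n set \<Rightarrow> real"
  assumes "distinct [h, i, j, k, l]"
  shows "sum w {{h, i, j}, {h, k, l}} = w {h, i, j} + w {h, k, l}"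
proof -
  have "{h, i, j} \<noteq> {h, k, l}" using assms by auto
  then show ?thesis by simp
qed

lemma pluecker_terms_swap:
  "pluecker_terms h i k j l = pluecker_terms h i j k l"
  "pluecker_terms h i l j k = pluecker_terms h i j k l"
proof -
  have *: "{b, a, c} = {a, b, c}" "{c, a, b} = {a, b, c}" for a b c :: "'b set set" by blast+
  show "pluecker_terms h i k j l = pluecker_terms h i j k l"
    unfolding pluecker_terms_def insert_commute[of k j] by (rule *(1))
  show "pluecker_terms h i l j k = pluecker_terms h i j k l"
    unfolding pluecker_terms_def insert_commute[of l j] insert_commute[of l k] by (rule *(2))
qed

lemma in_minimal_terms:
  assumes "distinct [h, i, j, k, l]"
  shows "{{h, i, j}, {h, k, l}} \<in> minimal_terms w h i j k l \<longleftrightarrow> term_minimal w h i j k l"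
proof -
  have d: "distinct [h, i, k, j, l]" "distinct [h, i, l, j, k]" using assms by auto
  have min3: "a \<in> {t \<in> {a, b, c}. \<forall>s\<in>{a, b, c}. sum w t \<le> sum w s} \<longleftrightarrow>
    sum w a \<le> min (sum w b) (sum w c)" for a b c
    by auto
  show ?thesis
    unfolding minimal_terms_def pluecker_terms_def term_minimal_def min3
      sum_term[OF assms] sum_term[OF d(1)] sum_term[OF d(2)] by (rule refl)
qed

lemma in_minimal_terms_swap:
  assumes "distinct [h, i, j, k, l]"
  shows "{{h, i, k}, {h, j, l}} \<in> minimal_terms w h i j k l \<longleftrightarrow> term_minimal w h i k j l"
    "{{h, i, l}, {h, j, k}} \<in> minimal_terms w h i j k l \<longleftrightarrow> term_minimal w h i l j k"
proof -
  have d: "distinct [h, i, k, j, l]" "distinct [h, i, l, j, k]" using assms by auto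
  show "{{h, i, k}, {h, j, l}} \<in> minimal_terms w h i j k l \<longleftrightarrow> term_minimal w h i k j l"
    using in_minimal_terms[OF d(1), of w]
    unfolding minimal_terms_def pluecker_terms_swap(1)[of h i k j l] .
  show "{{h, i, l}, {h, j, k}} \<in> minimal_terms w h i j k l \<longleftrightarrow> term_minimal w h i l j k"
    using in_minimal_terms[OF d(2), of w]
    unfolding minimal_terms_def pluecker_terms_swap(2)[of h i l j k] .
qed

lemma minimal_terms_eq_iff:
  "(\<forall>h i j k l. distinct [h, i, j, k, l] \<longrightarrow> minimal_terms w h i j k l = minimal_terms w' h i j k l)
   \<longleftrightarrow> (\<forall>h i j k l. distinct [h, i, j, k, l] \<longrightarrow> term_minimal w h i j k l = term_minimal w' h i j k l)"
  (is "?L \<longleftrightarrow> ?R")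
proof
  assume L: ?L
  show ?R
  proof (intro allI impI)
    fix h i j k l :: 'a assume d: "distinct [h, i, j, k, l]"
    show "term_minimal w h i j k l = term_minimal w' h i j k l"
      unfolding in_minimal_terms[OF d, symmetric] L[rule_format, OF d] by (rule refl)
  qed
next
  assume R: ?R
  show ?L
  proof (intro allI impI set_eqI)
    fix h i j k l :: 'a and t assume d: "distinct [h, i, j, k, l]"
    have d': "distinct [h, i, k, j, l]" "distinct [h, i, l, j, k]" using d by auto
    note eqs = in_minimal_terms[OF d] in_minimal_terms_swap[OF d]
      R[rule_format, OF d] R[rule_format, OF d'(1)] R[rule_format, OF d'(2)]
    consider "t = {{h, i, j}, {h, k, l}}" | "t = {{h, i, k}, {h, j, l}}" | "t = {{h, i, l}, {h, j, k}}"
      | "t \<notin> pluecker_terms h i j k l"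
      unfolding pluecker_terms_def insert_iff empty_iff by argo
    then show "t \<in> minimal_terms w h i j k l \<longleftrightarrow> t \<in> minimal_terms w' h i j k l"
    proof cases
      case 1 show ?thesis unfolding 1 eqs by (rule refl)
    next
      case 2 show ?thesis unfolding 2 eqs by (rule refl)
    next
      case 3 show ?thesis unfolding 3 eqs by (rule refl)
    next
      case 4 then show ?thesis by (simp only: minimal_terms_def mem_Collect_eq simp_thms)
    qed
  qed
qed

lemma card_le_three:
  assumes "a \<noteq> b" "a \<noteq> c" "b \<noteq> c"
  shows "2 \<le> card ((if P then {a} else {}) \<union> (if Q then {b} else {}) \<union> (if R then {c} else {})) \<longleftrightarrow>
    P \<and> Q \<or> P \<and> R \<or> Q \<and> R"
  using assms by (cases P; cases Q; cases R) simp_all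

lemma two_le_card_minimal_terms:
  assumes "distinct [h, i, j, k, l]"
  shows "2 \<le> card (minimal_terms w h i j k l) \<longleftrightarrow>
    \<not> (w {h, i, j} + w {h, k, l} < min (w {h, i, k} + w {h, j, l}) (w {h, i, l} + w {h, j, k})) \<and>
    \<not> (w {h, i, k} + w {h, j, l} < min (w {h, i, j} + w {h, k, l}) (w {h, i, l} + w {h, j, k})) \<and>
    \<not> (w {h, i, l} + w {h, j, k} < min (w {h, i, j} + w {h, k, l}) (w {h, i, k} + w {h, j, l}))"
proof -
  have d: "distinct [h, i, k, j, l]" "distinct [h, i, l, j, k]" using assms by auto
  let ?a = "{{h, i, j}, {h, k, l}}" and ?b = "{{h, i, k}, {h, j, l}}" and ?c = "{{h, i, l}, {h, j, k}}"
  have ne: "?a \<noteq> ?b" "?a \<noteq> ?c" "?b \<noteq> ?c"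
  proof -
    have ne': "{h, i, j} \<noteq> {h, i, k}" "{h, i, j} \<noteq> {h, j, l}" "{h, i, j} \<noteq> {h, i, l}"
      "{h, i, j} \<noteq> {h, j, k}" "{h, i, k} \<noteq> {h, i, l}" "{h, i, k} \<noteq> {h, j, k}"
      using assms by auto
    show "?a \<noteq> ?b" "?a \<noteq> ?c" "?b \<noteq> ?c"
      by (simp_all only: doubleton_eq_iff ne' simp_thms)
  qed
  define A where "A = w {h, i, j} + w {h, k, l}"
  define B where "B = w {h, i, k} + w {h, j, l}"
  define C where "C = w {h, i, l} + w {h, j, k}"
  have s: "sum w ?a = A" "sum w ?b = B" "sum w ?c = C"
    using sum_term[OF assms, of w] sum_term[OF d(1), of w] sum_term[OF d(2), of w]
    by (auto simp: A_def B_def C_def)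
  have eq: "minimal_terms w h i j k l =
      (if A \<le> B \<and> A \<le> C then {?a} else {}) \<union> (if B \<le> A \<and> B \<le> C then {?b} else {}) \<union>
      (if C \<le> A \<and> C \<le> B then {?c} else {})"
  proof -
    have "{t \<in> {a, b, c}. \<forall>s\<in>{a, b, c}. sum w t \<le> sum w s} =
        (if sum w a \<le> sum w b \<and> sum w a \<le> sum w c then {a} else {}) \<union>
        (if sum w b \<le> sum w a \<and> sum w b \<le> sum w c then {b} else {}) \<union>
        (if sum w c \<le> sum w a \<and> sum w c \<le> sum w b then {c} else {})" for a b c
      by auto
    then show ?thesis
      unfolding minimal_terms_def pluecker_terms_def by (simp only: s)
  qed
  show ?thesis
    unfolding eq card_le_three[OF ne] A_def[symmetric] B_def[symmetric] C_def[symmetric]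
    by linarith
qed

lemma dressian_iff: "w \<in> dressian \<longleftrightarrow> w \<in> weights \<and> three_term w"
proof -
  have "(\<forall>h i j k l. distinct [h, i, j, k, l] \<longrightarrow> 2 \<le> card (minimal_terms w h i j k l)) \<longleftrightarrow> three_term w"
    (is "?L \<longleftrightarrow> _")
  proof
    assume L: ?L
    show "three_term w"
      unfolding three_term_def
    proof (intro allI impI)
      fix h i j k l :: 'a assume d: "distinct [h, i, j, k, l]"
      then show "min (w {h, i, k} + w {h, j, l}) (w {h, i, l} + w {h, j, k}) \<le> w {h, i, j} + w {h, k, l}"
        using L two_le_card_minimal_terms[OF d, of w] by (simp add: not_less min_le_iff_disj)
    qed
  next
    assume T: "three_term w"
    show ?L
    proof (intro allI impI)
      fix h i j k l :: 'a assume d: "distinct [h, i, j, k, l]"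
      have d': "distinct [h, i, k, j, l]" "distinct [h, i, l, j, k]" using d by auto
      show "2 \<le> card (minimal_terms w h i j k l)"
        using T[unfolded three_term_def, rule_format, OF d]
          T[unfolded three_term_def, rule_format, OF d'(1)]
          T[unfolded three_term_def, rule_format, OF d'(2)]
        unfolding two_le_card_minimal_terms[OF d] not_less
        by (simp add: insert_commute)
    qed
  qed
  then show ?thesis by (auto simp: dressian_def)
qed

section \<open>Valuated matroids of rank 3\<close>

lemma triple_cases:
  assumes "X \<in> triples"
  obtains p q r where "distinct [p, q, r]" "X = {p, q, r}"
  using assms unfolding triples_def by (auto simp: card_3_iff)

text \<open>The cases are the exchange distances 0 to 3. Later exchange and propagation arguments
  proceed along this distance.\<close>

lemma two_triples_cases:
  fixes X Y :: "'n::finite set"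
  assumes "X \<in> triples" "Y \<in> triples"
  obtains "X = Y"
  | p q i e where "distinct [p, q, i, e]" "X = {p, q, i}" "Y = {p, q, e}"
  | h i j k l where "distinct [h, i, j, k, l]" "X = {h, i, j}" "Y = {h, k, l}"
  | x1 x2 x3 y1 y2 y3 where "distinct [x1, x2, x3, y1, y2, y3]" "X = {x1, x2, x3}" "Y = {y1, y2, y3}"
proof -
  have c: "card X = 3" "card Y = 3" using assms by (auto simp: card_triple)
  have d: "card (X - Y) = 3 - card (X \<inter> Y)" "card (Y - X) = 3 - card (X \<inter> Y)"
    by (simp_all add: card_Diff_subset_Int c Int_commute)
  have "card (X \<inter> Y) \<le> 3" using c card_mono[of X "X \<inter> Y"] by simp
  then consider "card (X \<inter> Y) = 3" | "card (X \<inter> Y) = 2" | "card (X \<inter> Y) = 1" | "card (X \<inter> Y) = 0"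
    by linarith
  then show thesis
  proof cases
    case 1
    then have "X - Y = {}" "Y - X = {}" using d by auto
    then show thesis using that(1) by blast
  next
    case 2
    then obtain p q where pq: "X \<inter> Y = {p, q}" "p \<noteq> q" by (auto simp: card_2_iff)
    obtain i e where ie: "X - Y = {i}" "Y - X = {e}" using d 2 by (auto simp: card_1_singleton_iff)
    have "X = {p, q, i}" "Y = {p, q, e}" "distinct [p, q, i, e]" using pq ie by auto
    then show thesis using that(2) by blast
  next
    case 3
    then obtain h where h: "X \<inter> Y = {h}" by (auto simp: card_1_singleton_iff)
    obtain i j where ij: "X - Y = {i, j}" "i \<noteq> j" using d 3 by (auto simp: card_2_iff)
    obtain k l where kl: "Y - X = {k, l}" "k \<noteq> l" using d 3 by (auto simp: card_2_iff)
    have "X = {h, i, j}" "Y = {h, k, l}" "distinct [h, i, j, k, l]" using h ij kl by auto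
    then show thesis using that(3) by blast
  next
    case 4
    then have "X \<inter> Y = {}" by auto
    moreover obtain x1 x2 x3 where "X = {x1, x2, x3}" "distinct [x1, x2, x3]"
      using assms(1) triple_cases by metis
    moreover obtain y1 y2 y3 where "Y = {y1, y2, y3}" "distinct [y1, y2, y3]"
      using assms(2) triple_cases by metis
    ultimately have "distinct [x1, x2, x3, y1, y2, y3]" by auto
    then show thesis using that(4) \<open>X = _\<close> \<open>Y = _\<close> by blast
  qed
qed

text \<open>The functional supports the octahedron of triples that consist of \<open>h\<close> and
  two of \<open>i\<close>, \<open>j\<close>, \<open>k\<close>, \<open>l\<close>. It is balanced:
  opposite vertices on the other two diagonals get equal values. So an inequality between terms,
  which are sums over diagonals, becomes one at each single vertex.\<close>

lemma minimal_term_cell: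
  fixes w :: "'n::finite set \<Rightarrow> real"
  assumes d: "distinct [h, i, j, k, l]" and m: "term_minimal w h i j k l"
  obtains c where "\<And>X. X \<in> triples \<Longrightarrow> 0 \<le> w X + sum c X"
    "w {h, i, j} + sum c {h, i, j} = 0" "w {h, k, l} + sum c {h, k, l} = 0"
    "\<And>X. X \<in> triples \<Longrightarrow> w X + sum c X = 0 \<Longrightarrow> X \<in> {{h,i,j},{h,k,l},{h,i,k},{h,j,l},{h,i,l},{h,j,k}}"
    "w {h, i, k} + sum c {h, i, k} = w {h, j, l} + sum c {h, j, l}"
    "w {h, i, l} + sum c {h, i, l} = w {h, j, k} + sum c {h, j, k}"
proof -
  \<comment> \<open>The values \<open>p + q\<close> and \<open>p - q\<close> are forced by the two
    balance equations; \<open>a i + a j\<close> and \<open>a k + a l\<close> cancel the weights of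
    the first term for every choice of \<open>p\<close> and \<open>q\<close>.\<close>
  define p where "p = (w {h, j, l} - w {h, i, k} + w {h, j, k} - w {h, i, l}) / 2"
  define q where "q = (w {h, j, l} - w {h, i, k} - w {h, j, k} + w {h, i, l}) / 2"
  define a where "a x = (if x = i then (- w {h, i, j} + p) / 2 else if x = j then (- w {h, i, j} - p) / 2
    else if x = k then (- w {h, k, l} + q) / 2 else if x = l then (- w {h, k, l} - q) / 2 else 0)" for x
  \<comment> \<open>\<open>N\<close> exceeds every tilted weight in absolute value. With
    \<open>N / 3\<close> added per element, \<open>g\<close> contributes 0 on the octahedron and at
    least \<open>N\<close> on every other triple, which makes those strictly positive.\<close>
  define N where "N = 1 + (\<Sum>X\<in>triples. \<bar>w X + sum a X\<bar>)"
  define g where "g x = (if x \<in> {i, j, k, l} then 0 else if x = h then - N else N)" for x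
  define c where "c x = a x + g x + N / 3" for x
  have N: "0 < N" "\<bar>w X + sum a X\<bar> < N" if "X \<in> triples" for X
  proof -
    have "\<bar>w X + sum a X\<bar> \<le> (\<Sum>X\<in>triples. \<bar>w X + sum a X\<bar>)"
      by (rule member_le_sum) (use that in auto)
    then show "\<bar>w X + sum a X\<bar> < N" "0 < N" unfolding N_def by auto
  qed
  have c: "sum c X = sum a X + sum g X + N" if "X \<in> triples" for X
    using that by (simp add: c_def sum.distrib card_triple)
  let ?six = "{{h,i,j},{h,k,l},{h,i,k},{h,j,l},{h,i,l},{h,j,k}}"
  have pos: "0 < w X + sum c X" if X: "X \<in> triples" "X \<notin> ?six" for X
  proof (cases "h \<in> X \<and> X \<subseteq> {h, i, j, k, l}")
    case True
    obtain x y z where "X = {x, y, z}" "distinct [x, y, z]" using triple_cases[OF X(1)] by metis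
    with True obtain y z where yz: "X = {h, y, z}" "distinct [h, y, z]"
      by (metis distinct_length_2_or_more insertE insert_commute singletonD)
    have "y = i \<or> y = j \<or> y = k \<or> y = l" "z = i \<or> z = j \<or> z = k \<or> z = l" "y \<noteq> z"
      using True yz by auto
    moreover have "{h, j, i} = {h, i, j}" "{h, l, k} = {h, k, l}" "{h, k, i} = {h, i, k}"
      "{h, l, j} = {h, j, l}" "{h, l, i} = {h, i, l}" "{h, k, j} = {h, j, k}" by blast+
    ultimately have "X \<in> ?six"
      unfolding yz(1) insert_iff empty_iff by (elim disjE) (simp_all only: simp_thms)
    with X(2) show ?thesis by contradiction
  next
    case False
    have "0 \<le> sum g X"  if "h \<notin> X"
      using that N(1)[OF X(1)] by (intro sum_nonneg) (auto simp: g_def)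
    moreover have "0 \<le> sum g X" if "h \<in> X" 
    proof -
      obtain z where z: "z \<in> X" "z \<notin> {h, i, j, k, l}" using False \<open>h \<in> X\<close> by auto
      have "sum g X = g h + g z + sum g (X - {h, z})"
        using z \<open>h \<in> X\<close> by (simp add: sum.remove[of X h] sum.remove[of "X - {h}" z] Diff_insert2[symmetric] insert_commute)
      moreover have "0 \<le> sum g (X - {h, z})" 
        using N(1)[OF X(1)] by (intro sum_nonneg) (auto simp: g_def)
      moreover have "g h = - N" "g z = N" using z d by (auto simp: g_def)
      ultimately show ?thesis by simp
    qed
    ultimately show ?thesis using N(2)[OF X(1)] c[OF X(1)] by argo
  qed
  have six: "sum g {h, x, y} = - N" if "x \<in> {i, j, k, l}" "y \<in> {i, j, k, l}" "distinct [h, x, y]" for x y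
  proof -
    have "g x = 0" "g y = 0" "g h = - N" using that d by (auto simp: g_def)
    then show ?thesis using that(3) by simp
  qed
  have s6: "sum c {h, x, y} = a x + a y"
    if "x \<in> {i, j, k, l}" "y \<in> {i, j, k, l}" "distinct [h, x, y]" for x y
  proof -
    have "a h = 0" using d by (simp add: a_def)
    then show ?thesis using c[OF triple_mem[OF that(3)]] six[OF that] that(3) by simp
  qed
  have a: "a i = (- w {h, i, j} + p) / 2" "a j = (- w {h, i, j} - p) / 2"
    "a k = (- w {h, k, l} + q) / 2" "a l = (- w {h, k, l} - q) / 2"
    using d by (auto simp: a_def)
  have s: "sum c {h, i, j} = a i + a j" "sum c {h, k, l} = a k + a l" "sum c {h, i, k} = a i + a k"
    "sum c {h, j, l} = a j + a l" "sum c {h, i, l} = a i + a l" "sum c {h, j, k} = a j + a k"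
    by (rule s6; use d in simp)+
  have z: "w {h, i, j} + sum c {h, i, j} = 0" "w {h, k, l} + sum c {h, k, l} = 0"
    unfolding s a by argo+
  have e: "w {h, i, k} + sum c {h, i, k} = w {h, j, l} + sum c {h, j, l}"
    "w {h, i, l} + sum c {h, i, l} = w {h, j, k} + sum c {h, j, k}"
    unfolding s a p_def q_def by argo+
  have n: "0 \<le> w {h, i, k} + sum c {h, i, k}" "0 \<le> w {h, i, l} + sum c {h, i, l}"
    using m unfolding s a p_def q_def term_minimal_def min.bounded_iff by argo+
  have nonneg: "0 \<le> w X + sum c X" if "X \<in> triples" for X
  proof (cases "X \<in> ?six")
    case True
    then consider "X = {h,i,j}" | "X = {h,k,l}" | "X = {h,i,k}" | "X = {h,j,l}" | "X = {h,i,l}" | "X = {h,j,k}"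
      unfolding insert_iff empty_iff by argo
    then show ?thesis using z e n by cases simp_all
  next
    case False
    then show ?thesis using pos[OF that] by simp
  qed
  show thesis
  proof (rule that[of c])
    show "X \<in> ?six" if "X \<in> triples" "w X + sum c X = 0" for X
      using pos[OF that(1)] that(2) by (metis less_irrefl)
  qed (fact nonneg z e)+
qed

text \<open>Each of the three terms uses \<open>h\<close> twice and \<open>i\<close>,
  \<open>j\<close>, \<open>k\<close>, \<open>l\<close> once. Tilting by a linear functional
  therefore moves all terms equally and leaves the three-term relations and the minimal terms
  unchanged.\<close>

lemma sum_triples_eq:
  assumes "distinct [h, i, j, k, l]"
  shows "sum c {h, i, j} + sum c {h, k, l} = sum c {h, i, k} + sum c {h, j, l}"
    "sum c {h, i, j} + sum c {h, k, l} = (sum c {h, i, l} + sum c {h, j, k} :: real)"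
  using assms by auto

lemma term_minimal_iff_common_cell:
  fixes w :: "'n::finite set \<Rightarrow> real"
  assumes d: "distinct [h, i, j, k, l]"
  shows "term_minimal w h i j k l \<longleftrightarrow> (\<exists>B\<in>cells w. {h, i, j} \<in> B \<and> {h, k, l} \<in> B)"
proof
  assume "term_minimal w h i j k l"
  then obtain c where c: "\<And>X. X \<in> triples \<Longrightarrow> 0 \<le> w X + sum c X"
    "w {h, i, j} + sum c {h, i, j} = 0" "w {h, k, l} + sum c {h, k, l} = 0"
    using minimal_term_cell[OF d] by metis
  let ?B = "{X \<in> triples. w X + sum c X = 0}"
  have "{h, i, j} \<in> triples" "{h, k, l} \<in> triples" using d by (simp_all add: triple_mem)
  then have B: "{h, i, j} \<in> ?B" "{h, k, l} \<in> ?B" using c(2,3) by simp_all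
  then have "?B \<in> cells w" unfolding cells_def using c(1) by fast
  with B show "\<exists>B\<in>cells w. {h, i, j} \<in> B \<and> {h, k, l} \<in> B" by (intro bexI[of _ ?B] conjI)
next
  assume "\<exists>B\<in>cells w. {h, i, j} \<in> B \<and> {h, k, l} \<in> B"
  then obtain B where B: "B \<in> cells w" "{h, i, j} \<in> B" "{h, k, l} \<in> B" by blast
  obtain c where c: "\<And>X. X \<in> triples \<Longrightarrow> 0 \<le> w X + sum c X"
    "\<And>X. X \<in> triples \<Longrightarrow> X \<in> B \<longleftrightarrow> w X + sum c X = 0"
    using cellsE[OF B(1)] by blast
  have t: "{h,i,j} \<in> triples" "{h,k,l} \<in> triples" "{h,i,k} \<in> triples" "{h,j,l} \<in> triples"
    "{h,i,l} \<in> triples" "{h,j,k} \<in> triples"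
    by (rule triple_mem, use d in simp)+
  show "term_minimal w h i j k l"
    unfolding term_minimal_def min.bounded_iff
    using c(1)[OF t(3)] c(1)[OF t(4)] c(1)[OF t(5)] c(1)[OF t(6)] c(2)[OF t(1)] c(2)[OF t(2)] B(2,3)
      sum_triples_eq[OF d, of c]
    by linarith
qed

lemma three_term_add_sum: "three_term w \<Longrightarrow> three_term (\<lambda>X. w X + sum c X)"
  for w :: "'a set \<Rightarrow> real"
  unfolding three_term_def
proof (intro allI impI)
  fix h i j k l :: 'a
  assume "\<forall>h i j k l. distinct [h, i, j, k, l] \<longrightarrow>
     min (w {h, i, k} + w {h, j, l}) (w {h, i, l} + w {h, j, k}) \<le> w {h, i, j} + w {h, k, l}"
    and d: "distinct [h, i, j, k, l]"
  then have "min (w {h, i, k} + w {h, j, l}) (w {h, i, l} + w {h, j, k}) \<le> w {h, i, j} + w {h, k, l}"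
    by blast
  then show "min (w {h, i, k} + sum c {h, i, k} + (w {h, j, l} + sum c {h, j, l}))
        (w {h, i, l} + sum c {h, i, l} + (w {h, j, k} + sum c {h, j, k}))
       \<le> w {h, i, j} + sum c {h, i, j} + (w {h, k, l} + sum c {h, k, l})"
    using sum_triples_eq[OF d, of c] by linarith
qed

text \<open>\<open>v\<close> stands for a weight tilted so that a chosen cell is its zero set; the
  zeros are the bases of the matroid of that cell.\<close>

locale valuated =
  fixes v :: "'n::finite set \<Rightarrow> real"
  assumes three_term: "three_term v" and nonneg: "\<And>X. X \<in> triples \<Longrightarrow> 0 \<le> v X"
begin

lemma term_le: "distinct [h, i, j, k, l] \<Longrightarrow>
   v {h, i, k} + v {h, j, l} \<le> v {h, i, j} + v {h, k, l} \<or> v {h, i, l} + v {h, j, k} \<le> v {h, i, j} + v {h, k, l}"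
  using three_term unfolding three_term_def by (metis min_le_iff_disj)

lemma pos: "distinct [i, j, k] \<Longrightarrow> 0 \<le> v {i, j, k}"
  by (rule nonneg) (rule triple_mem)

lemma exchange_two:
  assumes d: "distinct [h, i, j, k, l]" and z: "v {h, i, j} = 0" "v {h, k, l} = 0"
  shows "v {h, i, k} = 0 \<and> v {h, j, l} = 0 \<or> v {h, i, l} = 0 \<and> v {h, j, k} = 0"
proof -
  have "0 \<le> v {h, i, k}" "0 \<le> v {h, j, l}" "0 \<le> v {h, i, l}" "0 \<le> v {h, j, k}"
    by (rule pos, use d in simp)+
  then show ?thesis using term_le[OF d] z by linarith
qed

text \<open>The relations at \<open>x1\<close>, \<open>x2\<close>, \<open>x3\<close> and at
  \<open>y2\<close> are compared on a triangle with \<open>p1\<close>, \<open>p2\<close>,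
  \<open>p3\<close> at the corners and \<open>q12\<close>, \<open>q13\<close>, \<open>q23\<close> on
  the sides. If no exchange existed, each corner would be at least some incident side and each side
  strictly above one of its corners, which fails at the smallest corner.\<close>

lemma exchange_disjoint:
  assumes d: "distinct [x1, x2, x3, y1, y2, y3]" and z: "v {x1, x2, x3} = 0" "v {y1, y2, y3} = 0"
  shows "v {x2, x3, y1} = 0 \<or> v {x1, x3, y1} = 0 \<or> v {x1, x2, y1} = 0"
proof (rule ccontr)
  assume neg: "\<not> ?thesis"
  have "0 \<le> v {x2, x3, y1}" "0 \<le> v {x1, x3, y1}" "0 \<le> v {x1, x2, y1}"
    by (rule pos, use d in simp)+
  with neg have a: "0 < v {x2, x3, y1}" "0 < v {x1, x3, y1}" "0 < v {x1, x2, y1}" by auto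
  \<comment> \<open>The values of the triples \<open>{xj, xk, y1}\<close> act as potentials: added
    to both sides of a three-term relation, they leave one corner value against two side
    values.\<close>
  define p1 where "p1 = v {x1, y1, y2} + v {x2, x3, y1}"
  define p2 where "p2 = v {x2, y1, y2} + v {x1, x3, y1}"
  define p3 where "p3 = v {x3, y1, y2} + v {x1, x2, y1}"
  define q12 where "q12 = v {x1, x2, y2} + v {x2, x3, y1} + v {x1, x3, y1}"
  define q13 where "q13 = v {x1, x3, y2} + v {x2, x3, y1} + v {x1, x2, y1}"
  define q23 where "q23 = v {x2, x3, y2} + v {x1, x3, y1} + v {x1, x2, y1}"
  have n: "0 \<le> v {x1, y2, y3}" "0 \<le> v {x2, y2, y3}" "0 \<le> v {x3, y2, y3}"
    by (rule pos, use d in simp)+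
  have "v {x1, x2, y1} + v {x1, x3, y2} \<le> v {x1, x2, x3} + v {x1, y1, y2} \<or>
    v {x1, x2, y2} + v {x1, x3, y1} \<le> v {x1, x2, x3} + v {x1, y1, y2}"
    by (rule term_le) (use d in simp)
  then have 1: "q13 \<le> p1 \<or> q12 \<le> p1" unfolding p1_def q13_def q12_def using z(1) by linarith
  have "v {x2, x1, y1} + v {x2, x3, y2} \<le> v {x2, x1, x3} + v {x2, y1, y2} \<or>
    v {x2, x1, y2} + v {x2, x3, y1} \<le> v {x2, x1, x3} + v {x2, y1, y2}"
    by (rule term_le) (use d in auto)
  then have 2: "q23 \<le> p2 \<or> q12 \<le> p2"
    unfolding p2_def q23_def q12_def using z(1) by (simp add: insert_commute[of x2 x1]) linarith
  have "v {x3, x1, y1} + v {x3, x2, y2} \<le> v {x3, x1, x2} + v {x3, y1, y2} \<or>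
    v {x3, x1, y2} + v {x3, x2, y1} \<le> v {x3, x1, x2} + v {x3, y1, y2}"
    by (rule term_le) (use d in auto)
  then have 3: "q23 \<le> p3 \<or> q13 \<le> p3"
    unfolding p3_def q23_def q13_def using z(1)
    by (simp add: insert_commute[of x3 x1] insert_commute[of x3 x2]) linarith
  \<comment> \<open>In the relation at \<open>y2\<close> the triple \<open>{y1, y2, y3}\<close>
    contributes zero, and nonnegative summands are dropped. Strictness comes from the potentials,
    since a side carries one positive summand more than a corner.\<close>
  have st: "v {xi, y1, y2} \<le> v {xi, xk, y2} \<or> v {xk, y1, y2} \<le> v {xi, xk, y2}"
    if "distinct [xi, xk, y1, y2, y3]" for xi xk
  proof -
    have "v {y2, xi, y1} + v {y2, xk, y3} \<le> v {y2, xi, xk} + v {y2, y1, y3} \<or>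
      v {y2, xi, y3} + v {y2, xk, y1} \<le> v {y2, xi, xk} + v {y2, y1, y3}"
      by (rule term_le) (use that in auto)
    moreover have "{y2, y1, y3} = {y1, y2, y3}" "{y2, xi, xk} = {xi, xk, y2}"
      "{y2, xi, y1} = {xi, y1, y2}" "{y2, xk, y1} = {xk, y1, y2}" by blast+
    moreover have "0 \<le> v {y2, xk, y3}" "0 \<le> v {y2, xi, y3}"
      by (rule pos, use that in auto)+
    ultimately show ?thesis using z(2) by (simp only:) linarith
  qed
  have 4: "p1 < q12 \<or> p2 < q12"
    using st[of x1 x2] d a unfolding p1_def p2_def q12_def by auto
  have 5: "p1 < q13 \<or> p3 < q13"
    using st[of x1 x3] d a unfolding p1_def p3_def q13_def by auto
  have 6: "p2 < q23 \<or> p3 < q23"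
    using st[of x2 x3] d a unfolding p2_def p3_def q23_def by auto
  show False using 1 2 3 4 5 6 by linarith
qed

lemma exchange:
  assumes "X \<in> triples" "Y \<in> triples" "v X = 0" "v Y = 0" "e \<in> Y" "e \<notin> X"
  obtains k where "k \<in> X" "v (insert e (X - {k})) = 0"
  using assms(1,2)
proof (cases rule: two_triples_cases)
  case 1
  then show ?thesis using assms by auto
next
  case (2 p q i e')
  then have "e = e'" "insert e (X - {i}) = Y" using assms(5,6) by auto
  then show ?thesis using that[of i] 2 assms(4) by auto
next
  case (3 h i j k l)
  have z: "v {h, i, j} = 0" "v {h, k, l} = 0" using assms 3 by auto
  have "insert k (X - {i}) = {h, j, k}" "insert k (X - {j}) = {h, i, k}"
    "insert l (X - {i}) = {h, j, l}" "insert l (X - {j}) = {h, i, l}" using 3 by auto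
  then have "(v (insert k (X - {i})) = 0 \<or> v (insert k (X - {j})) = 0) \<and>
    (v (insert l (X - {i})) = 0 \<or> v (insert l (X - {j})) = 0)"
    using exchange_two[OF 3(1) z] by auto
  moreover have "e = k \<or> e = l" using assms(5,6) 3 by auto
  ultimately show ?thesis using that 3 by auto
next
  case (4 x1 x2 x3 y1 y2 y3)
  obtain z2 z3 where z: "Y = {e, z2, z3}" "distinct [e, z2, z3]"
  proof -
    have "e = y1 \<or> e = y2 \<or> e = y3" using assms(5) 4 by auto
    then show thesis using that[of y2 y3] that[of y1 y3] that[of y1 y2] 4 by auto
  qed
  have "distinct [x1, x2, x3, e, z2, z3]" using 4 z by auto
  moreover have "v {x1, x2, x3} = 0" "v {e, z2, z3} = 0" using assms 4 z by auto
  ultimately have "v {x2, x3, e} = 0 \<or> v {x1, x3, e} = 0 \<or> v {x1, x2, e} = 0"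
    by (rule exchange_disjoint)
  moreover have "insert e (X - {x1}) = {x2, x3, e}" "insert e (X - {x2}) = {x1, x3, e}"
    "insert e (X - {x3}) = {x1, x2, e}" using 4 by auto
  ultimately show ?thesis using that[of x1] that[of x2] that[of x3] 4 by auto
qed

end

section \<open>Functions that are linear on a cell\<close>

context valuated
begin

text \<open>The part of linearity on the zero set of \<open>v\<close> that is visible on squares of
  zeros. The goal is that this part already implies linearity.\<close>

definition flat :: "('n set \<Rightarrow> real) \<Rightarrow> bool" where
  "flat u \<longleftrightarrow> (\<forall>h i j k l. distinct [h, i, j, k, l] \<longrightarrow> v {h, i, j} = 0 \<longrightarrow> v {h, k, l} = 0 \<longrightarrow>
     v {h, i, k} = 0 \<longrightarrow> v {h, j, l} = 0 \<longrightarrow> u {h, i, j} + u {h, k, l} = u {h, i, k} + u {h, j, l})"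

lemma flatD:
  "\<lbrakk>flat u; distinct [h, i, j, k, l]; v {h, i, j} = 0; v {h, k, l} = 0; v {h, i, k} = 0; v {h, j, l} = 0\<rbrakk>
   \<Longrightarrow> u {h, i, j} + u {h, k, l} = u {h, i, k} + u {h, j, l}"
  unfolding flat_def by blast

lemma flat_diff_sum: "flat u \<Longrightarrow> flat (\<lambda>X. u X - sum c X)"
  unfolding flat_def
proof (intro allI impI)
  fix h i j k l
  assume u: "\<forall>h i j k l. distinct [h, i, j, k, l] \<longrightarrow> v {h, i, j} = 0 \<longrightarrow> v {h, k, l} = 0 \<longrightarrow>
     v {h, i, k} = 0 \<longrightarrow> v {h, j, l} = 0 \<longrightarrow> u {h, i, j} + u {h, k, l} = u {h, i, k} + u {h, j, l}"
    and d: "distinct [h, i, j, k, l]"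
    and z: "v {h, i, j} = 0" "v {h, k, l} = 0" "v {h, i, k} = 0" "v {h, j, l} = 0"
  have "u {h, i, j} + u {h, k, l} = u {h, i, k} + u {h, j, l}" using u d z by blast
  then show "u {h, i, j} - sum c {h, i, j} + (u {h, k, l} - sum c {h, k, l}) =
      u {h, i, k} - sum c {h, i, k} + (u {h, j, l} - sum c {h, j, l})"
    using sum_triples_eq(1)[OF d, of c] by linarith
qed

text \<open>Exchange places \<open>{h, i, j}\<close> and \<open>{h, k, l}\<close> as opposite
  corners of a square of zeros, and \<open>u\<close> vanishes at the remaining two corners.\<close>

lemma flat_square:
  assumes f: "flat u" and d: "distinct [h, i, j, k, l]" and z: "v {h, i, j} = 0" "v {h, k, l} = 0"
    and u: "\<And>x y. x \<in> {i, j} \<Longrightarrow> y \<in> {k, l} \<Longrightarrow> v {h, x, y} = 0 \<Longrightarrow> u {h, x, y} = 0"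
  shows "u {h, i, j} + u {h, k, l} = 0"
  using exchange_two[OF d z]
proof
  assume "v {h, i, k} = 0 \<and> v {h, j, l} = 0"
  then show ?thesis using flatD[OF f d z] u by simp
next
  assume *: "v {h, i, l} = 0 \<and> v {h, j, k} = 0"
  have d': "distinct [h, i, j, l, k]" and eq: "{h, l, k} = {h, k, l}" using d by auto
  have "u {h, i, j} + u {h, k, l} = u {h, i, l} + u {h, j, k}"
    using flatD[OF f d', unfolded eq] z * by blast
  then show ?thesis using u * by simp
qed

text \<open>The values of a flat function spread from the neighbours of a basis to the bases at distance two
  and then to those at distance three.\<close>

lemma flat_zero:
  assumes f: "flat u" and X: "X \<in> triples" "v X = 0" "u X = 0"
    and nb: "\<And>i e. i \<in> X \<Longrightarrow> e \<notin> X \<Longrightarrow> v (insert e (X - {i})) = 0 \<Longrightarrow> u (insert e (X - {i})) = 0"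
    and Y: "Y \<in> triples" "v Y = 0"
  shows "u Y = 0"
proof -
  have two: "u {h, k, l} = 0" if "distinct [h, i, j, k, l]" "X = {h, i, j}" "v {h, k, l} = 0" for h i j k l
  proof -
    have "u {h, i, j} + u {h, k, l} = 0"
    proof (rule flat_square[OF f that(1) _ that(3)])
      fix x y assume xy: "x \<in> {i, j}" "y \<in> {k, l}" "v {h, x, y} = 0"
      define z where "z = (if x = i then j else i)"
      have "insert y (X - {z}) = {h, x, y}" "z \<in> X" "y \<notin> X" using that(1,2) xy(1,2) by (auto simp: z_def)
      then show "u {h, x, y} = 0" using nb xy(3) by metis
    qed (use X that in simp)
    then show ?thesis using X that by simp
  qed
  from X(1) Y(1) show ?thesis
  proof (cases rule: two_triples_cases)
    case 1
    then show ?thesis using X by simp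
  next
    case (2 p q i e)
    then have "insert e (X - {i}) = Y" "i \<in> X" "e \<notin> X" by auto
    then show ?thesis using nb Y(2) by metis
  next
    case (3 h i j k l)
    then show ?thesis using two Y(2) by metis
  next
    case (4 x1 x2 x3 y1 y2 y3)
    \<comment> \<open>The exchanged basis is at distance one from \<open>X\<close> and two from
      \<open>Y\<close>. The other corners of the square joining it to \<open>Y\<close> are at
      distance two from \<open>X\<close>, where \<open>two\<close> already applies.\<close>
    obtain k where k: "k \<in> X" "v (insert y1 (X - {k})) = 0"
      by (rule exchange[of X Y y1]) (use X Y 4 in auto)
    have "card (X - {k}) = 2" using k(1) X(1) by (simp add: card_triple)
    then obtain i j where ij: "X - {k} = {i, j}" "i \<noteq> j" by (auto simp: card_2_iff)
    have Xeq: "X = {k, i, j}" "distinct [k, i, j]" using ij k(1) by auto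
    have d: "distinct [y1, i, j, y2, y3]" "distinct [k, i, j, y1, y2, y3]"
      using 4 Xeq by auto
    have "u {y1, i, j} + u {y1, y2, y3} = 0"
    proof (rule flat_square[OF f d(1)])
      show "v {y1, i, j} = 0" using k(2) ij by simp
      show "v {y1, y2, y3} = 0" using Y 4 by simp
      fix x y assume xy: "x \<in> {i, j}" "y \<in> {y2, y3}" "v {y1, x, y} = 0"
      define z where "z = (if x = i then j else i)"
      have "distinct [x, k, z, y1, y]" "X = {x, k, z}" "{y1, x, y} = {x, y1, y}"
        using Xeq d xy(1,2) by (auto simp: z_def)
      then show "u {y1, x, y} = 0" using two xy(3) by metis
    qed
    moreover have "u {y1, i, j} = 0" using nb[of k y1] k ij 4 by auto
    ultimately show ?thesis using 4 by simp
  qed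
qed

text \<open>In the fundamental graph of a basis \<open>X\<close>, elements \<open>i \<in> X\<close> and \<open>e \<notin> X\<close> are adjacent when exchanging
  \<open>i\<close> for \<open>e\<close> gives a basis. The increments of a flat function sum to zero around its 4-cycles and its
  chordless 6-cycles, hence around all cycles.\<close>

lemma flat_four_cycle:
  assumes f: "flat u" and d: "distinct [x1, x2, x3]" "e \<notin> {x1, x2, x3}" "f \<notin> {x1, x2, x3}"
    and z: "v {x2, x3, e} = 0" "v {x1, x3, e} = 0" "v {x2, x3, f} = 0" "v {x1, x3, f} = 0"
  shows "u {x2, x3, e} - u {x1, x3, e} = u {x2, x3, f} - u {x1, x3, f}"
proof (cases "e = f")
  case False
  have eq: "{x3, x2, e} = {x2, x3, e}" "{x3, x1, f} = {x1, x3, f}" "{x3, x2, f} = {x2, x3, f}"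
    "{x3, e, f} = {x3, f, e}" "{x3, e, x1} = {x1, x3, e}" "{x3, f, x1} = {x1, x3, f}" "{x3, f, x2} = {x2, x3, f}" "{x3, x1, e} = {x1, x3, e}"
    by blast+
  \<comment> \<open>All four triples contain \<open>x3\<close>, so the 4-cycle is a single square at
    \<open>x3\<close>.\<close>
  have "u {x3, x2, e} + u {x3, f, x1} = u {x3, x2, f} + u {x3, e, x1}"
    by (rule flatD[OF f]) (use d False z in \<open>auto simp: eq\<close>)
  then show ?thesis unfolding eq by linarith
qed simp

text \<open>Each missing chord rules out one of the two possible exchanges, so four triples at
  distance two from the basis are bases, and squares at \<open>x1\<close> and \<open>x3\<close>
  express \<open>u\<close> on them by its values on neighbours. One further square at
  \<open>e3\<close> links the four equations.\<close>

lemma flat_six_cycle: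
  assumes f: "flat u" and d: "distinct [x1, x2, x3, e1, e2, e3]" and z: "v {x1, x2, x3} = 0"
    and e: "v {x2, x3, e3} = 0" "v {x1, x3, e3} = 0" "v {x1, x2, e3} \<noteq> 0"
    "v {x1, x3, e1} = 0" "v {x1, x2, e1} = 0" "v {x2, x3, e1} \<noteq> 0"
    "v {x1, x2, e2} = 0" "v {x2, x3, e2} = 0" "v {x1, x3, e2} \<noteq> 0"
  shows "u {x2, x3, e3} - u {x1, x3, e3} + (u {x1, x3, e1} - u {x1, x2, e1}) +
    (u {x1, x2, e2} - u {x2, x3, e2}) = 0"
proof -
  have step: "v {h, a, b} = 0 \<and> u {x1, x2, x3} + u {h, a, b} = u {h, i, b} + u {h, j, a}"
    if "distinct [h, i, j, a, b]" "{h, i, j} = {x1, x2, x3}" "v {h, i, a} \<noteq> 0 \<or> v {h, j, b} \<noteq> 0"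
      "v {h, i, b} = 0" "v {h, j, a} = 0" for h i j a b
  proof -
    have d': "distinct [h, i, b, j, a]" "distinct [h, i, j, b, a]" using that by auto
    have zz: "v {h, i, j} = 0" using z that by simp
    have "v {h, i, j} = 0 \<and> v {h, b, a} = 0 \<or> v {h, i, a} = 0 \<and> v {h, b, j} = 0"
      by (rule exchange_two[OF d'(1)]) (use that in auto)
    moreover have "{h, b, j} = {h, j, b}" "{h, b, a} = {h, a, b}" by blast+
    ultimately have ab: "v {h, a, b} = 0" using that(3) by auto
    moreover have "u {h, i, j} + u {h, b, a} = u {h, i, b} + u {h, j, a}"
      by (rule flatD[OF f d'(2)]) (use that ab zz \<open>{h, b, a} = {h, a, b}\<close> in simp_all)
    ultimately show ?thesis using that(2) \<open>{h, b, a} = {h, a, b}\<close> by simp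
  qed
  have c: "{x3, x2, x1} = {x1, x2, x3}" "{x1, x3, x2} = {x1, x2, x3}"
      "{x3, x2, e3} = {x2, x3, e3}" "{x3, x1, e3} = {x1, x3, e3}" "{x3, x2, e1} = {x2, x3, e1}"
      "{x3, x1, e1} = {x1, x3, e1}" "{x3, x1, e2} = {x1, x3, e2}" "{x3, x2, e2} = {x2, x3, e2}"
      "{x3, x1, x2} = {x1, x2, x3}"
    by blast+
  have d1: "distinct [x1, x3, x2, e1, e3]" "distinct [x3, x2, x1, e1, e3]"
      "distinct [x1, x3, x2, e2, e3]" "distinct [x3, x1, x2, e2, e3]"
    using d by auto
  have 1: "v {x1, e1, e3} = 0 \<and> u {x1, x2, x3} + u {x1, e1, e3} = u {x1, x3, e3} + u {x1, x2, e1}"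
    using step[OF d1(1)] e c by simp
  have 2: "v {x3, e1, e3} = 0 \<and> u {x1, x2, x3} + u {x3, e1, e3} = u {x2, x3, e3} + u {x1, x3, e1}"
    using step[OF d1(2)] e c by simp
  have 3: "v {x1, e2, e3} = 0 \<and> u {x1, x2, x3} + u {x1, e2, e3} = u {x1, x3, e3} + u {x1, x2, e2}"
    using step[OF d1(3)] e c by simp
  have 4: "v {x3, e2, e3} = 0 \<and> u {x1, x2, x3} + u {x3, e2, e3} = u {x2, x3, e2} + u {x1, x3, e3}"
    using step[OF d1(4)] e c by simp
  have c3: "{e3, x1, e1} = {x1, e1, e3}" "{e3, x3, e1} = {x3, e1, e3}" "{e3, x1, e2} = {x1, e2, e3}"
    "{e3, x3, e2} = {x3, e2, e3}" "{e3, e1, x1} = {x1, e1, e3}" "{e3, e2, x3} = {x3, e2, e3}"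
    by blast+
  have "u {e3, x1, e1} + u {e3, e2, x3} = u {e3, x1, e2} + u {e3, e1, x3}"
    by (rule flatD[OF f]) (use d 1 2 3 4 c3 in \<open>auto simp: insert_commute\<close>)
  moreover have "{e3, e1, x3} = {x3, e1, e3}" by blast
  ultimately have "u {x1, e1, e3} + u {x3, e2, e3} = u {x1, e2, e3} + u {x3, e1, e3}"
    by (simp only: c3)
  then show ?thesis using 1 2 3 4 by linarith
qed

text \<open>The coefficients on \<open>X\<close> are potentials for the differences between
  exchanges with the same incoming element; the cycle conditions make them exist. A coefficient
  outside \<open>X\<close> is then read off from any neighbouring basis, and agreement on the
  neighbours of \<open>X\<close> spreads by \<open>flat_zero\<close>.\<close>

lemma flat_imp_linear:
  assumes f: "flat u" and X: "X \<in> triples" "v X = 0"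
  obtains c where "\<And>Y. Y \<in> triples \<Longrightarrow> v Y = 0 \<Longrightarrow> u Y = sum c Y"
proof -
  obtain x1 x2 x3 where x: "distinct [x1, x2, x3]" "X = {x1, x2, x3}"
    using triple_cases[OF X(1)] by metis
  \<comment> \<open>\<open>A\<close>, \<open>B\<close>, \<open>C\<close> are the neighbourhoods of
    \<open>x1\<close>, \<open>x2\<close>, \<open>x3\<close> in the fundamental graph:
    \<open>A e\<close> says that \<open>e\<close> can replace \<open>x1\<close>.\<close>
  define A where "A e \<longleftrightarrow> e \<notin> X \<and> v {x2, x3, e} = 0" for e
  define B where "B e \<longleftrightarrow> e \<notin> X \<and> v {x1, x3, e} = 0" for e
  define C where "C e \<longleftrightarrow> e \<notin> X \<and> v {x1, x2, e} = 0" for e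
  have com: "{x3, x2, e} = {x2, x3, e}" "{x2, x1, e} = {x1, x2, e}" "{x3, x1, e} = {x1, x3, e}" for e
    by blast+
  have AB: "u {x2, x3, e} - u {x1, x3, e} = u {x2, x3, f} - u {x1, x3, f}"
    if "A e" "B e" "A f" "B f" for e f
    by (rule flat_four_cycle[OF assms(1)]) (use that x in \<open>auto simp: A_def B_def\<close>)
  have BC: "u {x1, x3, e} - u {x1, x2, e} = u {x1, x3, f} - u {x1, x2, f}"
    if "B e" "C e" "B f" "C f" for e f
    using flat_four_cycle[OF assms(1), of x2 x3 x1 e f] that x by (auto simp: B_def C_def com)
  have CA: "u {x1, x2, e} - u {x2, x3, e} = u {x1, x2, f} - u {x2, x3, f}"
    if "C e" "A e" "C f" "A f" for e f
    using flat_four_cycle[OF assms(1), of x3 x1 x2 e f] that x by (auto simp: A_def C_def com)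
  have cyc: "u {x2, x3, e3} - u {x1, x3, e3} + (u {x1, x3, e1} - u {x1, x2, e1}) +
      (u {x1, x2, e2} - u {x2, x3, e2}) = 0"
    if h: "A e3" "B e3" "B e1" "C e1" "C e2" "A e2" for e1 e2 e3
  proof -
    consider e where "A e" "B e" "C e" | "\<not> C e3" "\<not> A e1" "\<not> B e2"
      using h by blast
    then show ?thesis
    proof cases
      case 1
      show ?thesis using AB[of e3 e] BC[of e1 e] CA[of e2 e] 1 that by linarith
    next
      case 2
      have "e1 \<noteq> e2" "e1 \<noteq> e3" "e2 \<noteq> e3" using that 2 by blast+
      then show ?thesis
        by (intro flat_six_cycle[OF assms(1)])
          (use 2 that x X(2) in \<open>auto simp: A_def B_def C_def\<close>)
    qed
  qed
  have "\<exists>d1 d2 d3. (\<forall>e. A e \<and> B e \<longrightarrow> d2 - d1 = u {x2, x3, e} - u {x1, x3, e}) \<and>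
      (\<forall>e. B e \<and> C e \<longrightarrow> d3 - d2 = u {x1, x3, e} - u {x1, x2, e}) \<and>
      (\<forall>e. C e \<and> A e \<longrightarrow> d1 - d3 = u {x1, x2, e} - u {x2, x3, e})"
  proof -
    obtain p where p: "A e \<and> B e \<longrightarrow> p = u {x2, x3, e} - u {x1, x3, e}" for e
      using AB by metis
    obtain q where q: "B e \<and> C e \<longrightarrow> q = u {x1, x3, e} - u {x1, x2, e}" for e
      using BC by metis
    obtain r where r: "C e \<and> A e \<longrightarrow> r = u {x1, x2, e} - u {x2, x3, e}" for e
      using CA by metis
    \<comment> \<open>The three prescribed differences of potentials can be met if they sum to zero,
      which the cycle condition gives when every pair has a common neighbour. Otherwise one of the
      equations is void and the other two are solved freely.\<close>
    consider "\<nexists>e. A e \<and> B e" | "\<nexists>e. B e \<and> C e" | "\<nexists>e. C e \<and> A e" | "p + q + r = 0"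
      using cyc p q r by metis
    then show ?thesis
    proof cases
      case 1
      show ?thesis
        by (rule exI[of _ "q + r"], rule exI[of _ 0], rule exI[of _ q]) (use 1 q r in \<open>simp; blast\<close>)
    next
      case 2
      show ?thesis
        by (rule exI[of _ 0], rule exI[of _ p], rule exI[of _ "- r"]) (use 2 p r in \<open>simp; blast\<close>)
    next
      case 3
      show ?thesis
        by (rule exI[of _ "- p"], rule exI[of _ 0], rule exI[of _ q]) (use 3 p q in \<open>simp; blast\<close>)
    next
      case 4
      then have *: "p - 0 = p" "p + q - p = q" "0 - (p + q) = r" by linarith+
      show ?thesis
        by (rule exI[of _ 0], rule exI[of _ p], rule exI[of _ "p + q"]) (use p q r in \<open>simp only: *; blast\<close>)
    qed
  qed
  then obtain d1 d2 d3 where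
    dAB: "\<And>e. A e \<Longrightarrow> B e \<Longrightarrow> d2 - d1 = u {x2, x3, e} - u {x1, x3, e}" and
    dBC: "\<And>e. B e \<Longrightarrow> C e \<Longrightarrow> d3 - d2 = u {x1, x3, e} - u {x1, x2, e}" and
    dCA: "\<And>e. C e \<Longrightarrow> A e \<Longrightarrow> d1 - d3 = u {x1, x2, e} - u {x2, x3, e}"
    by metis
  \<comment> \<open>\<open>s\<close> spreads the remaining error at \<open>X\<close> evenly over its
    three elements and keeps their differences. A neighbouring basis retains two of them, whence the
    \<open>2 * s\<close> in \<open>c\<close>.\<close>
  define s where "s = (u X - d1 - d2 - d3) / 3"
  define c where "c e = (if e = x1 then d1 + s else if e = x2 then d2 + s else if e = x3 then d3 + s
    else if A e then u {x2, x3, e} - d2 - d3 - 2 * s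
    else if B e then u {x1, x3, e} - d1 - d3 - 2 * s
    else u {x1, x2, e} - d1 - d2 - 2 * s)" for e
  have cx: "c x1 = d1 + s" "c x2 = d2 + s" "c x3 = d3 + s" using x by (auto simp: c_def)
  have uX: "u X = sum c X"
  proof -
    have "sum c X = d1 + d2 + d3 + 3 * s" using x by (simp add: cx)
    then show ?thesis unfolding s_def by argo
  qed
  have nb: "u (insert e (X - {i})) = sum c (insert e (X - {i}))"
    if ie: "i \<in> X" "e \<notin> X" "v (insert e (X - {i})) = 0" for i e
  proof -
    have ce: "c e = (if A e then u {x2, x3, e} - d2 - d3 - 2 * s
      else if B e then u {x1, x3, e} - d1 - d3 - 2 * s else u {x1, x2, e} - d1 - d2 - 2 * s)"
      using ie(2) x by (auto simp: c_def)
    have sums: "sum c {x2, x3, e} = c x2 + c x3 + c e" "sum c {x1, x3, e} = c x1 + c x3 + c e"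
      "sum c {x1, x2, e} = c x1 + c x2 + c e"
      using x ie(2) by auto
    have ins: "insert e (X - {x1}) = {x2, x3, e}" "insert e (X - {x2}) = {x1, x3, e}"
      "insert e (X - {x3}) = {x1, x2, e}"
      using x by auto
    consider "i = x1" | "i = x2" | "i = x3" using ie(1) x by auto
    then show ?thesis
    proof cases
      case 1
      then have "A e" using ie ins by (simp add: A_def)
      then show ?thesis unfolding 1 ins sums cx ce by simp
    next
      case 2
      then have "B e" using ie ins by (simp add: B_def)
      then show ?thesis unfolding 2 ins sums cx ce using dAB[of e] by auto
    next
      case 3
      then have "C e" using ie ins by (simp add: C_def)
      then show ?thesis unfolding 3 ins sums cx ce using dBC[of e] dCA[of e] by auto
    qed
  qed
  show thesis
  proof (rule that[of c])
    fix Y assume Y: "Y \<in> triples" "v Y = 0"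
    have "u Y - sum c Y = 0"
      by (rule flat_zero[OF flat_diff_sum[OF assms(1)] X _ _ Y]) (use uX nb in auto)
    then show "u Y = sum c Y" by simp
  qed
qed

end

section \<open>Weights with the same minimal terms\<close>

lemma perturb_pos:
  fixes f g :: "'a \<Rightarrow> real"
  assumes "finite T"
  obtains \<epsilon> where "0 < \<epsilon>" "\<And>s X. \<bar>s\<bar> \<le> \<epsilon> \<Longrightarrow> X \<in> T \<Longrightarrow> 0 < f X \<Longrightarrow> 0 < f X + s * g X"
proof -
  \<comment> \<open>The inserted 1 guards against an empty set of positive values; the 1 in
    \<open>M\<close> keeps the later denominator positive.\<close>
  define m where "m = Min (insert 1 (f ` {X \<in> T. 0 < f X}))"
  define M where "M = 1 + (\<Sum>X\<in>T. \<bar>g X\<bar>)"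
  have m: "0 < m" using assms by (auto simp: m_def)
  have M: "0 < M" unfolding M_def by (smt (verit) sum_nonneg abs_ge_zero)
  show thesis
  proof (rule that[of "m / (2 * M)"])
    show "0 < m / (2 * M)" using m M by simp
    fix s X assume s: "\<bar>s\<bar> \<le> m / (2 * M)" and X: "X \<in> T" "0 < f X"
    have "\<bar>g X\<bar> \<le> (\<Sum>X\<in>T. \<bar>g X\<bar>)" by (rule member_le_sum) (use X assms in auto)
    then have "\<bar>g X\<bar> \<le> M" by (simp add: M_def)
    then have "\<bar>s * g X\<bar> \<le> m / (2 * M) * M"
      unfolding abs_mult using s m M by (intro mult_mono) auto
    also have "\<dots> < m" using m M by simp
    also have "m \<le> f X" unfolding m_def using X assms by (intro Min_le) auto
    finally show "0 < f X + s * g X" by linarith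
  qed
qed

text \<open>Since \<open>u\<close> is linear on \<open>B\<close>, the tilt can follow the change of
  weight: the equalities on \<open>B\<close> stay exact, and the finitely many strict inequalities
  outside \<open>B\<close> survive for small \<open>s\<close>.\<close>

lemma cell_persists:
  fixes w :: "'n::finite set \<Rightarrow> real"
  assumes B: "B \<in> cells w" and u: "\<And>X. X \<in> B \<Longrightarrow> u X = sum d X"
  obtains \<epsilon> where "0 < \<epsilon>" "\<And>s. \<bar>s\<bar> \<le> \<epsilon> \<Longrightarrow> B \<in> cells (\<lambda>X. w X + s * u X)"
proof -
  obtain c where c: "\<And>X. X \<in> triples \<Longrightarrow> 0 \<le> w X + sum c X"
    "\<And>X. X \<in> triples \<Longrightarrow> X \<in> B \<longleftrightarrow> w X + sum c X = 0"
    using cellsE[OF B] by blast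
  obtain \<epsilon> where e: "0 < \<epsilon>" "\<And>s X. \<bar>s\<bar> \<le> \<epsilon> \<Longrightarrow> X \<in> triples \<Longrightarrow> 0 < w X + sum c X \<Longrightarrow>
      0 < w X + sum c X + s * (u X - sum d X)"
    using perturb_pos[of triples "\<lambda>X. w X + sum c X" "\<lambda>X. u X - sum d X"] by auto
  have Bt: "B \<noteq> {}" "B \<subseteq> triples" using B by (auto simp: cells_def)
  have eq: "w X + s * u X + sum (\<lambda>i. c i - s * d i) X = w X + sum c X + s * (u X - sum d X)" for X s
    by (simp add: sum_subtractf sum_distrib_left[symmetric] algebra_simps)
  have "B \<in> cells (\<lambda>X. w X + s * u X)" if "\<bar>s\<bar> \<le> \<epsilon>" for s
  proof (rule cellsI[OF Bt, where c = "\<lambda>i. c i - s * d i" and b = 0])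
    show "w X + s * u X + sum (\<lambda>i. c i - s * d i) X = 0" if "X \<in> B" for X
      unfolding eq using that u c(2) Bt by auto
    show "0 < w X + s * u X + sum (\<lambda>i. c i - s * d i) X" if "X \<in> triples - B" for X
      unfolding eq using that e(2)[OF \<open>\<bar>s\<bar> \<le> \<epsilon>\<close>, of X] c[of X] by auto
  qed
  with e(1) show thesis by (rule that)
qed

text \<open>The difference of the tilts for \<open>A\<close> and \<open>B\<close> under
  \<open>w1\<close> vanishes on \<open>A\<close> and is positive on \<open>B - A\<close>, so it
  exposes \<open>A\<close> as a face of \<open>B\<close>. A small multiple of it, added to the tilt
  for \<open>B\<close> under \<open>w2\<close>, cuts out \<open>A\<close> there too.\<close>

lemma cell_of_face:
  fixes w1 w2 :: "'n::finite set \<Rightarrow> real"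
  assumes "A \<in> cells w1" "B \<in> cells w1" "A \<subseteq> B" "B \<in> cells w2"
  shows "A \<in> cells w2"
proof -
  obtain a where a: "\<And>X. X \<in> triples \<Longrightarrow> 0 \<le> w1 X + sum a X"
    "\<And>X. X \<in> triples \<Longrightarrow> X \<in> A \<longleftrightarrow> w1 X + sum a X = 0"
    using cellsE[OF assms(1)] by blast
  obtain b where "\<And>X. X \<in> triples \<Longrightarrow> 0 \<le> w1 X + sum b X"
    and b: "\<And>X. X \<in> triples \<Longrightarrow> X \<in> B \<longleftrightarrow> w1 X + sum b X = 0"
    using cellsE[OF assms(2)] by blast
  obtain c where c: "\<And>X. X \<in> triples \<Longrightarrow> 0 \<le> w2 X + sum c X"
    "\<And>X. X \<in> triples \<Longrightarrow> X \<in> B \<longleftrightarrow> w2 X + sum c X = 0"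
    using cellsE[OF assms(4)] by blast
  obtain \<epsilon> where e: "0 < \<epsilon>" "\<And>s X. \<bar>s\<bar> \<le> \<epsilon> \<Longrightarrow> X \<in> triples \<Longrightarrow> 0 < w2 X + sum c X \<Longrightarrow>
      0 < w2 X + sum c X + s * (sum a X - sum b X)"
    using perturb_pos[of triples "\<lambda>X. w2 X + sum c X" "\<lambda>X. sum a X - sum b X"] by auto
  have At: "A \<noteq> {}" "A \<subseteq> triples" using assms(1) by (auto simp: cells_def)
  have eq: "w2 X + sum (\<lambda>i. c i + \<epsilon> * (a i - b i)) X = w2 X + sum c X + \<epsilon> * (sum a X - sum b X)" for X
    by (simp add: sum.distrib sum_subtractf sum_distrib_left[symmetric])
  show ?thesis
  proof (rule cellsI[OF At, where c = "\<lambda>i. c i + \<epsilon> * (a i - b i)" and b = 0])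
    fix X assume X: "X \<in> A"
    then have "X \<in> triples" "X \<in> B" using At assms(3) by auto
    then show "w2 X + sum (\<lambda>i. c i + \<epsilon> * (a i - b i)) X = 0"
      unfolding eq using a(2)[of X] b[of X] c(2)[of X] X by auto
  next
    fix X assume X: "X \<in> triples - A"
    show "0 < w2 X + sum (\<lambda>i. c i + \<epsilon> * (a i - b i)) X"
    proof (cases "X \<in> B")
      case True
      then have "0 < sum a X - sum b X" "w2 X + sum c X = 0"
        using a[of X] b[of X] c(2)[of X] X by auto
      then show ?thesis unfolding eq using e(1) by simp
    next
      case False
      then show ?thesis unfolding eq using e(1) e(2)[of \<epsilon> X] c[of X] X by auto
    qed
  qed
qed

section \<open>The cone of weights having a given set of triples in a common cell\<close>

lemma convex_cone_hull_sum:
  "finite I \<Longrightarrow> (\<And>i. i \<in> I \<Longrightarrow> f i \<in> convex_cone hull S) \<Longrightarrow> sum f I \<in> convex_cone hull S"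
  by (induction I rule: finite_induct) (auto simp: convex_cone_hull_contains_0 intro: convex_cone_hull_add)

text \<open>The weights for which all triples of \<open>B\<close> lie in a common cell form a finitely generated cone,
  hence a closed set.\<close>

lemma closed_weights_with_cell_containing:
  fixes B :: "'n::finite set set"
  shows "closed {y :: real ^ ('n set). \<exists>c. \<forall>X\<in>triples. 0 \<le> y $ X + sum c X \<and> (X \<in> B \<longrightarrow> y $ X + sum c X = 0)}"
    (is "closed ?K")
proof -
  define e :: "'n \<Rightarrow> real ^ ('n set)" where "e i = (\<chi> X. if i \<in> X then 1 else 0)" for i
  \<comment> \<open>Generators: nonnegative slack at each triple outside \<open>B\<close>, both
    signs at coordinates that are not triples and hence unconstrained, and the linear functionals
    \<open>e i\<close> with both signs.\<close>
  define G where "G = (\<lambda>X. axis X (1::real)) ` (- (B \<inter> triples)) \<union> (\<lambda>X. axis X (-1)) ` (- triples)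
    \<union> range e \<union> range (\<lambda>i. - e i)"
  have ax: "axis Y 1 $ X = (if X = Y then 1 else 0 :: real)" "axis Y (-1) $ X = (if X = Y then -1 else 0 :: real)" for X Y :: "'n set"
    by (auto simp: axis_def)
  have K: "convex_cone ?K"
    unfolding convex_cone_iff
  proof (intro conjI ballI allI impI)
    show "0 \<in> ?K" by (auto intro!: exI[of _ "\<lambda>_. 0"])
    fix x assume "x \<in> ?K"
    then obtain c where c: "\<forall>X\<in>triples. 0 \<le> x $ X + sum c X \<and> (X \<in> B \<longrightarrow> x $ X + sum c X = 0)" by blast
    show "x + y \<in> ?K" if y: "y \<in> ?K" for y
    proof -
      obtain d where d: "\<forall>X\<in>triples. 0 \<le> y $ X + sum d X \<and> (X \<in> B \<longrightarrow> y $ X + sum d X = 0)"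
        using y by blast
      have eq: "(x + y) $ X + sum (\<lambda>i. c i + d i) X = (x $ X + sum c X) + (y $ X + sum d X)" for X
        by (simp add: sum.distrib)
      have "\<forall>X\<in>triples. 0 \<le> (x + y) $ X + sum (\<lambda>i. c i + d i) X \<and>
          (X \<in> B \<longrightarrow> (x + y) $ X + sum (\<lambda>i. c i + d i) X = 0)"
        unfolding eq using c d by simp
      then show ?thesis by blast
    qed
    show "a *\<^sub>R x \<in> ?K" if "0 \<le> a" for a
    proof -
      have eq: "(a *\<^sub>R x) $ X + sum (\<lambda>i. a * c i) X = a * (x $ X + sum c X)" for X
        by (simp add: sum_distrib_left[symmetric] distrib_left)
      have "\<forall>X\<in>triples. 0 \<le> (a *\<^sub>R x) $ X + sum (\<lambda>i. a * c i) X \<and>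
          (X \<in> B \<longrightarrow> (a *\<^sub>R x) $ X + sum (\<lambda>i. a * c i) X = 0)"
        unfolding eq using c that by simp
      then show ?thesis by blast
    qed
  qed
  have "G \<subseteq> ?K"
  proof
    fix g assume "g \<in> G"
    then consider X where "g = axis X 1" "X \<notin> B \<inter> triples" | X where "g = axis X (-1)" "X \<notin> triples"
      | i where "g = e i" | i where "g = - e i"
      by (auto simp: G_def)
    then show "g \<in> ?K"
    proof cases
      case 1
      then show ?thesis by (auto simp: ax intro!: exI[of _ "\<lambda>_. 0"])
    next
      case 2
      then show ?thesis by (auto simp: ax intro!: exI[of _ "\<lambda>_. 0"])
    next
      case (3 i)
      have "e i $ X + sum (\<lambda>j. if j = i then -1 else 0) X = 0" for X
        by (simp add: e_def)
      then show ?thesis unfolding 3 by (auto intro!: exI[of _ "\<lambda>j. if j = i then -1 else 0"])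
    next
      case (4 i)
      have "(- e i) $ X + sum (\<lambda>j. if j = i then 1 else 0) X = 0" for X
        by (simp add: e_def)
      then show ?thesis unfolding 4 by (auto intro!: exI[of _ "\<lambda>j. if j = i then 1 else 0"])
    qed
  qed
  then have 1: "convex_cone hull G \<subseteq> ?K"
    by (rule hull_minimal) (rule K)
  have 2: "?K \<subseteq> convex_cone hull G"
  proof
    fix y assume "y \<in> ?K"
    then obtain c where c: "\<forall>X\<in>triples. 0 \<le> y $ X + sum c X \<and> (X \<in> B \<longrightarrow> y $ X + sum c X = 0)" by blast
    \<comment> \<open>A weight is its slack minus the functional by which it was tilted.\<close>
    have y: "y = (\<Sum>X\<in>UNIV. (y $ X + sum c X) *\<^sub>R axis X 1) + (\<Sum>i\<in>UNIV. (- c i) *\<^sub>R e i)"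
    proof (subst vec_eq_iff, intro allI)
      fix X
      have "(\<Sum>Y\<in>UNIV. (y $ Y + sum c Y) *\<^sub>R axis Y 1) $ X = y $ X + sum c X"
        by (simp add: sum_component ax if_distrib[of "(*) _"] cong: if_cong)
      moreover have "(\<Sum>i\<in>UNIV. (- c i) *\<^sub>R e i) $ X = - sum c X"
        by (simp add: sum_component e_def sum_negf if_distrib sum.If_cases cong: if_cong)
      ultimately show "y $ X = ((\<Sum>X\<in>UNIV. (y $ X + sum c X) *\<^sub>R axis X 1) + (\<Sum>i\<in>UNIV. (- c i) *\<^sub>R e i)) $ X"
        by simp
    qed
    have G: "a *\<^sub>R g \<in> convex_cone hull G" if "0 \<le> a" "g \<in> G" for a g
      using that by (simp add: convex_cone_hull_mul hull_inc)
    show "y \<in> convex_cone hull G"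
    proof (subst y, intro convex_cone_hull_add convex_cone_hull_sum)
      fix i
      show "(- c i) *\<^sub>R e i \<in> convex_cone hull G"
        using G[of "c i" "- e i"] G[of "- c i" "e i"] by (cases "0 \<le> c i") (auto simp: G_def)
    next
      fix X
      consider "y $ X + sum c X = 0" | "X \<notin> triples" | "X \<in> triples" "X \<notin> B" "0 \<le> y $ X + sum c X"
        using c by blast
      then show "(y $ X + sum c X) *\<^sub>R axis X 1 \<in> convex_cone hull G"
      proof cases
        case 1
        then show ?thesis by (simp add: convex_cone_hull_contains_0)
      next
        case 2
        have "(y $ X + sum c X) *\<^sub>R axis X 1 = (- (y $ X + sum c X)) *\<^sub>R (axis X (-1) :: real ^ ('n set))"
          by (simp add: vec_eq_iff ax)
        then show ?thesis
          using G[of "y $ X + sum c X" "axis X 1"] G[of "- (y $ X + sum c X)" "axis X (-1)"] 2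
          by (cases "0 \<le> y $ X + sum c X") (auto simp: G_def)
      next
        case 3
        then show ?thesis using G[of "y $ X + sum c X" "axis X 1"] by (auto simp: G_def)
      qed
    qed auto
  qed
  have "finite G" by (simp add: G_def)
  then have "closed (convex_cone hull G)" by (rule closed_convex_cone_hull)
  moreover have "?K = convex_cone hull G" using 2 1 by (rule subset_antisym)
  ultimately show ?thesis by (simp only:)
qed

lemma openin_interval_Int_ball:
  "openin (top_of_set {0..1::real}) ({0..1} \<inter> ball a r)"
  by (simp add: openin_open_Int)

section \<open>Segments between weights with the same minimal terms\<close>

definition same_minimal :: "('n set \<Rightarrow> real) \<Rightarrow> ('n set \<Rightarrow> real) \<Rightarrow> bool" where
  "same_minimal w w' \<longleftrightarrow> (\<forall>h i j k l. distinct [h, i, j, k, l] \<longrightarrow>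
     term_minimal w h i j k l = term_minimal w' h i j k l)"

lemma same_minimalD:
  "same_minimal w w' \<Longrightarrow> distinct [h, i, j, k, l] \<Longrightarrow> term_minimal w h i j k l = term_minimal w' h i j k l"
  unfolding same_minimal_def by blast

lemma same_minimal_sym: "same_minimal w w' \<Longrightarrow> same_minimal w' w"
  unfolding same_minimal_def by blast

lemma term_minimal_perm:
  assumes "term_minimal w h i k j l"
  shows "w {h, i, k} + w {h, j, l} \<le> w {h, i, j} + w {h, k, l}"
    "w {h, i, k} + w {h, j, l} \<le> w {h, i, l} + w {h, j, k}"
proof -
  have "{h, k, j} = {h, j, k}" by blast
  then show "w {h, i, k} + w {h, j, l} \<le> w {h, i, j} + w {h, k, l}"
    "w {h, i, k} + w {h, j, l} \<le> w {h, i, l} + w {h, j, k}"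
    using assms by (auto simp: term_minimal_def)
qed

text \<open>The Pluecker relations provide a second term that is minimal for both weights, so all weights on the
  segment between them have the same minimal terms.\<close>

lemma common_minimal_term:
  assumes "three_term w" "distinct [h, i, j, k, l]"
    and "same_minimal w w'"
  obtains "term_minimal w h i k j l" "term_minimal w' h i k j l"
  | "term_minimal w h i l j k" "term_minimal w' h i l j k"
proof -
  have d: "distinct [h, i, k, j, l]" "distinct [h, i, l, j, k]" using assms(2) by auto
  have c: "{h, k, j} = {h, j, k}" "{h, l, j} = {h, j, l}" "{h, l, k} = {h, k, l}" by blast+
  have "min (w {h, i, k} + w {h, j, l}) (w {h, i, l} + w {h, j, k}) \<le> w {h, i, j} + w {h, k, l}"
    using assms(1,2) unfolding three_term_def by blast
  then have "term_minimal w h i k j l \<or> term_minimal w h i l j k"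
    unfolding term_minimal_def c by linarith
  then show thesis using same_minimalD[OF assms(3) d(1)] same_minimalD[OF assms(3) d(2)] that by blast
qed

lemma three_term_segment:
  fixes w w' :: "'n set \<Rightarrow> real"
  assumes w: "three_term w"
    and same: "same_minimal w w'"
    and t: "0 \<le> t" "t \<le> 1"
  shows "three_term (\<lambda>X. w X + t * (w' X - w X))"
  unfolding three_term_def
proof (intro allI impI)
  fix h i j k l :: 'n
  assume d: "distinct [h, i, j, k, l]"
  have mono: "w A + t * (w' A - w A) + (w B + t * (w' B - w B)) \<le> w C + t * (w' C - w C) + (w D + t * (w' D - w D))"
    if "w A + w B \<le> w C + w D" "w' A + w' B \<le> w' C + w' D" for A B C D
  proof -
    have "(1 - t) * (w A + w B) + t * (w' A + w' B) \<le> (1 - t) * (w C + w D) + t * (w' C + w' D)"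
      using add_mono[OF mult_left_mono[OF that(1), of "1 - t"] mult_left_mono[OF that(2), of t]] t by simp
    then show ?thesis by (simp add: algebra_simps)
  qed
  show "min (w {h, i, k} + t * (w' {h, i, k} - w {h, i, k}) + (w {h, j, l} + t * (w' {h, j, l} - w {h, j, l})))
        (w {h, i, l} + t * (w' {h, i, l} - w {h, i, l}) + (w {h, j, k} + t * (w' {h, j, k} - w {h, j, k})))
       \<le> w {h, i, j} + t * (w' {h, i, j} - w {h, i, j}) + (w {h, k, l} + t * (w' {h, k, l} - w {h, k, l}))"
  proof (cases rule: common_minimal_term[OF w d same])
    case 1
    have "w {h, i, k} + w {h, j, l} \<le> w {h, i, j} + w {h, k, l}"
      "w' {h, i, k} + w' {h, j, l} \<le> w' {h, i, j} + w' {h, k, l}"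
      using 1 by (auto dest: term_minimal_perm)
    then show ?thesis by (intro min.coboundedI1 mono)
  next
    case 2
    have "{h, l, k} = {h, k, l}" by blast
    then have "w {h, i, l} + w {h, j, k} \<le> w {h, i, j} + w {h, k, l}"
      "w' {h, i, l} + w' {h, j, k} \<le> w' {h, i, j} + w' {h, k, l}"
      using 2 by (auto simp: term_minimal_def)
    then show ?thesis by (intro min.coboundedI2 mono)
  qed
qed

text \<open>Compare the term with one that is minimal for both weights. The two slacks
  \<open>x\<close> and \<open>y\<close> are nonnegative and their convex combination is at most
  zero, so one of them vanishes; the term is minimal for that weight and hence for the other as
  well.\<close>

lemma segment_minimal_terms_flat:
  fixes w w' :: "'n set \<Rightarrow> real"
  assumes w: "three_term w"
    and same: "same_minimal w w'"
    and t: "0 \<le> t" "t \<le> 1" and d: "distinct [h, i, j, k, l]"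
    and m: "term_minimal (\<lambda>X. w X + t * (w' X - w X)) h i j k l"
  shows "term_minimal w h i j k l \<and> term_minimal w' h i j k l"
proof -
  have c: "{h, k, j} = {h, j, k}" "{h, l, j} = {h, j, l}" "{h, l, k} = {h, k, l}" by blast+
  obtain A B where AB: "w A + w B \<le> w {h, i, j} + w {h, k, l}" "w' A + w' B \<le> w' {h, i, j} + w' {h, k, l}"
    "w A + t * (w' A - w A) + (w B + t * (w' B - w B)) \<ge>
      w {h, i, j} + t * (w' {h, i, j} - w {h, i, j}) + (w {h, k, l} + t * (w' {h, k, l} - w {h, k, l}))"
    "w A + w B = w {h, i, j} + w {h, k, l} \<Longrightarrow> term_minimal w h i j k l"
    "w' A + w' B = w' {h, i, j} + w' {h, k, l} \<Longrightarrow> term_minimal w' h i j k l"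
  proof (cases rule: common_minimal_term[OF w d same])
    case 1
    show thesis
      by (rule that[of "{h, i, k}" "{h, j, l}"]) (use 1 m in \<open>auto simp: term_minimal_def c\<close>)
  next
    case 2
    show thesis
      by (rule that[of "{h, i, l}" "{h, j, k}"]) (use 2 m in \<open>auto simp: term_minimal_def c\<close>)
  qed
  define x where "x = w {h, i, j} + w {h, k, l} - (w A + w B)"
  define y where "y = w' {h, i, j} + w' {h, k, l} - (w' A + w' B)"
  have "0 \<le> x" "0 \<le> y" using AB(1,2) by (auto simp: x_def y_def)
  moreover have "(1 - t) * x + t * y \<le> 0"
    using AB(3) unfolding x_def y_def by (simp add: algebra_simps)
  moreover have "0 \<le> (1 - t) * x" "0 \<le> t * y" using t \<open>0 \<le> x\<close> \<open>0 \<le> y\<close> by auto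
  ultimately have "(1 - t) * x = 0" "t * y = 0" by linarith+
  then have "x = 0 \<or> y = 0" by auto
  then have "term_minimal w h i j k l \<or> term_minimal w' h i j k l"
    using AB(4,5) by (auto simp: x_def y_def)
  then show ?thesis using same_minimalD[OF same d] by blast
qed

lemma term_minimal_of_zero:
  assumes "valuated (\<lambda>X. w X + sum c X)" and d: "distinct [h, i, j, k, l]"
    and "w {h, i, j} + sum c {h, i, j} = 0" "w {h, k, l} + sum c {h, k, l} = 0"
  shows "term_minimal w h i j k l"
proof -
  interpret valuated "\<lambda>X. w X + sum c X" by fact
  have "0 \<le> w {h, i, k} + sum c {h, i, k}" "0 \<le> w {h, j, l} + sum c {h, j, l}"
    "0 \<le> w {h, i, l} + sum c {h, i, l}" "0 \<le> w {h, j, k} + sum c {h, j, k}"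
    by (rule pos, use d in simp)+
  then show ?thesis
    using assms(3,4) sum_triples_eq[OF d, of c] unfolding term_minimal_def by linarith
qed

text \<open>On a square of zeros of the tilted intermediate weight both terms are minimal there,
  hence minimal for \<open>w\<close> and for \<open>w'\<close>. So both weights give the two terms
  equal sums, and their difference is flat on the cell.\<close>

lemma same_minimal_terms_linear:
  fixes w w' :: "'n::finite set \<Rightarrow> real"
  assumes w: "three_term w"
    and same: "same_minimal w w'"
    and t: "0 \<le> t" "t \<le> 1" and B: "B \<in> cells (\<lambda>X. w X + t * (w' X - w X))"
  obtains d where "\<And>X. X \<in> B \<Longrightarrow> w' X - w X = sum d X"
proof -
  let ?w = "\<lambda>X. w X + t * (w' X - w X)"
  obtain c where c: "\<And>X. X \<in> triples \<Longrightarrow> 0 \<le> ?w X + sum c X"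
    "\<And>X. X \<in> triples \<Longrightarrow> X \<in> B \<longleftrightarrow> ?w X + sum c X = 0"
    using cellsE[OF B] by blast
  have V: "valuated (\<lambda>X. ?w X + sum c X)"
    by standard (intro three_term_add_sum three_term_segment w same t, simp, rule c)
  interpret valuated "\<lambda>X. ?w X + sum c X" by (rule V)
  have "flat (\<lambda>X. w' X - w X)"
    unfolding flat_def
  proof (intro allI impI)
    fix h i j k l assume d: "distinct [h, i, j, k, l]"
      and z: "?w {h, i, j} + sum c {h, i, j} = 0" "?w {h, k, l} + sum c {h, k, l} = 0"
        "?w {h, i, k} + sum c {h, i, k} = 0" "?w {h, j, l} + sum c {h, j, l} = 0"
    have d': "distinct [h, i, k, j, l]" using d by auto
    have 1: "term_minimal w h i j k l \<and> term_minimal w' h i j k l"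
      by (rule segment_minimal_terms_flat[OF w same t d term_minimal_of_zero[OF V d z(1,2)]])
    have 2: "term_minimal w h i k j l \<and> term_minimal w' h i k j l"
      by (rule segment_minimal_terms_flat[OF w same t d' term_minimal_of_zero[OF V d' z(3,4)]])
    have "w {h, i, j} + w {h, k, l} = w {h, i, k} + w {h, j, l}"
      "w' {h, i, j} + w' {h, k, l} = w' {h, i, k} + w' {h, j, l}"
      using 1 2 term_minimal_perm(1)[of _ h i k j l] by (force simp: term_minimal_def)+
    then show "w' {h, i, j} - w {h, i, j} + (w' {h, k, l} - w {h, k, l}) =
        w' {h, i, k} - w {h, i, k} + (w' {h, j, l} - w {h, j, l})" by linarith
  qed
  moreover obtain X where X: "X \<in> B" "X \<in> triples" using B by (auto simp: cells_def)
  ultimately obtain d where "\<And>Y. Y \<in> triples \<Longrightarrow> ?w Y + sum c Y = 0 \<Longrightarrow> w' Y - w Y = sum d Y"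
    using flat_imp_linear[of "\<lambda>X. w' X - w X" X] c(2) by blast
  then show thesis using that c(2) cells_subset_triples[OF B] by blast
qed

lemma closed_parameters_with_cell_containing:
  fixes w u :: "'n::finite set \<Rightarrow> real"
  shows "closed {t. \<exists>c. \<forall>X\<in>triples. 0 \<le> w X + t * u X + sum c X \<and> (X \<in> B \<longrightarrow> w X + t * u X + sum c X = 0)}"
proof -
  let ?f = "\<lambda>t::real. (\<chi> X. w X + t * u X)"
  have "continuous_on UNIV ?f" by (intro continuous_intros)
  then have "closed (?f -` {y. \<exists>c. \<forall>X\<in>triples. 0 \<le> y $ X + sum c X \<and> (X \<in> B \<longrightarrow> y $ X + sum c X = 0)})"
    by (rule closed_vimage[OF closed_weights_with_cell_containing])
  then show ?thesis by simp
qed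

text \<open>Along the segment from \<open>w\<close> to \<open>w'\<close> the parameters for which \<open>B\<close> is a cell form an open and closed set.\<close>

lemma same_minimal_terms_cells_subset:
  fixes w w' :: "'n::finite set \<Rightarrow> real"
  assumes w: "three_term w"
    and same: "same_minimal w w'"
  shows "cells w \<subseteq> cells w'"
proof
  fix B assume B: "B \<in> cells w"
  define W where "W t X = w X + t * (w' X - w X)" for t X
  \<comment> \<open>\<open>Q\<close> asks only that \<open>B\<close> be contained in a cell, which
    is the property that passes to limits.\<close>
  define Q where "Q = {t. \<exists>c. \<forall>X\<in>triples. 0 \<le> W t X + sum c X \<and> (X \<in> B \<longrightarrow> W t X + sum c X = 0)}"
  have "closed Q" unfolding Q_def W_def by (rule closed_parameters_with_cell_containing)
  have PQ: "t \<in> Q" if "B \<in> cells (W t)" for t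
    using that unfolding Q_def cells_def by blast
  have near: "\<exists>\<epsilon>>0. \<forall>s\<in>ball t \<epsilon>. A \<in> cells (W s)" if t: "t \<in> {0..1}" and A: "A \<in> cells (W t)" for A t
  proof -
    obtain d where d: "\<And>X. X \<in> A \<Longrightarrow> w' X - w X = sum d X"
      using same_minimal_terms_linear[OF w same, of t A] t A unfolding W_def by auto
    obtain \<epsilon> where \<epsilon>: "0 < \<epsilon>" "\<And>s. \<bar>s\<bar> \<le> \<epsilon> \<Longrightarrow> A \<in> cells (\<lambda>X. W t X + s * (w' X - w X))"
      using cell_persists[OF A d] by blast
    have eq: "(\<lambda>X. W t X + (s - t) * (w' X - w X)) = W s" for s
      by (simp add: W_def fun_eq_iff algebra_simps)
    have "A \<in> cells (W s)" if "s \<in> ball t \<epsilon>" for s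
      using \<epsilon>(2)[of "s - t"] that unfolding eq by (simp add: dist_real_def abs_minus_commute)
    then show ?thesis using \<epsilon>(1) by blast
  qed
  have "B \<in> cells (W 1)"
  proof (rule connected_induction_simple[of "{0..1::real}" 0 1 "\<lambda>t. B \<in> cells (W t)"])
    show "B \<in> cells (W 0)" using B by (simp add: W_def[abs_def])
    fix t :: real assume t: "t \<in> {0..1}"
    \<comment> \<open>A cell persists nearby. If \<open>B\<close> is only part of a cell
      \<open>A\<close>, then \<open>A\<close> persists, and \<open>B\<close> cannot be a cell
      nearby, since as a face of \<open>A\<close> it would also be one at \<open>t\<close>. If
      \<open>B\<close> lies in no cell, this remains so because \<open>Q\<close> is closed.\<close>
    consider "B \<in> cells (W t)" | "B \<notin> cells (W t)" "t \<in> Q" | "t \<notin> Q" by blast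
    then obtain U where "openin (top_of_set {0..1}) U" "t \<in> U"
      "(\<forall>s\<in>U. B \<in> cells (W s)) \<or> (\<forall>s\<in>U. B \<notin> cells (W s))"
    proof cases
      case 1
      then obtain \<epsilon> where "0 < \<epsilon>" "\<forall>s\<in>ball t \<epsilon>. B \<in> cells (W s)" using near t by blast
      then show thesis
        using that[OF openin_interval_Int_ball[of t \<epsilon>]] t by auto
    next
      case 2
      then obtain c where c: "\<forall>X\<in>triples. 0 \<le> W t X + sum c X \<and> (X \<in> B \<longrightarrow> W t X + sum c X = 0)"
        by (auto simp: Q_def)
      define A where "A = {X \<in> triples. W t X + sum c X = 0}"
      have BA: "B \<subseteq> A" using c cells_subset_triples[OF B] by (auto simp: A_def)
      moreover have "B \<noteq> {}" using B by (simp add: cells_def)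
      ultimately have A: "A \<in> cells (W t)" using c unfolding cells_def A_def by blast
      then obtain \<epsilon> where \<epsilon>: "0 < \<epsilon>" "\<forall>s\<in>ball t \<epsilon>. A \<in> cells (W s)" using near t by blast
      have "\<forall>s\<in>ball t \<epsilon>. B \<notin> cells (W s)"
        using cell_of_face[OF _ _ BA A] \<epsilon>(2) 2(1) by blast
      then show thesis
        using that[OF openin_interval_Int_ball[of t \<epsilon>]] t \<epsilon>(1) by auto
    next
      case 3
      have "openin (top_of_set {0..1}) ({0..1} \<inter> - Q)"
        using \<open>closed Q\<close> by (intro openin_open_Int) (rule open_Compl)
      then show thesis using that[of "{0..1} \<inter> - Q"] 3 t PQ by blast
    qed
    then show "\<exists>U. openin (top_of_set {0..1}) U \<and> t \<in> U \<and>
        (\<forall>x\<in>U. \<forall>y\<in>U. B \<in> cells (W x) \<longrightarrow> B \<in> cells (W y))" by blast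
  qed auto
  then show "B \<in> cells w'" by (simp add: W_def[abs_def])
qed

lemma induced_subdivision_eq_iff_minimal_terms:
  fixes w w' :: "'n::finite set \<Rightarrow> real"
  assumes "three_term w" "three_term w'"
  shows "induced_subdivision w = induced_subdivision w' \<longleftrightarrow>
    same_minimal w w'"
proof -
  have "cells w = cells w'" if "same_minimal w w'"
    using same_minimal_terms_cells_subset[OF assms(1) that]
      same_minimal_terms_cells_subset[OF assms(2) same_minimal_sym[OF that]]
    by (rule subset_antisym)
  moreover have "same_minimal w w'" if "cells w = cells w'"
    unfolding same_minimal_def using term_minimal_iff_common_cell[of _ _ _ _ _ w]
      term_minimal_iff_common_cell[of _ _ _ _ _ w'] that by simp
  ultimately show ?thesis unfolding induced_subdivision_eq_iff by blast
qed

section \<open>Matroid subdivisions\<close>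

lemma e_vec_nth: "e_vec X $ i = (if i \<in> X then 1 else 0)"
  by (simp add: e_vec_def axis_def sum_component)

lemma e_vec_inject: "e_vec X = e_vec Y \<longleftrightarrow> X = Y"
  by (auto simp: vec_eq_iff e_vec_nth split: if_splits)

lemma aff_dim_hull_e_vec:
  assumes "X \<noteq> Y"
  shows "aff_dim (convex hull {e_vec X, e_vec Y}) = 1"
  using assms aff_dim_2[of "e_vec X" "e_vec Y"] by (simp add: aff_dim_convex_hull e_vec_inject)

lemma convex_hull_Int_supporting_hyperplane_le:
  fixes S :: "'a::euclidean_space set"
  assumes "finite S" "\<And>x. x \<in> S \<Longrightarrow> a \<bullet> x \<le> b"
  shows "convex hull S \<inter> {x. a \<bullet> x = b} = convex hull {x \<in> S. a \<bullet> x = b}"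
  using convex_hull_Int_supporting_hyperplane[of S "- b" "- a"] assms by simp

text \<open>The sum of the two vertices, used as a functional, is 3 + 2 = 5 at each of them. Any
  other triple meets each of the two in at most two elements and reaches at most 4.\<close>

lemma exchange_edge:
  fixes X :: "'n::finite set"
  assumes X: "X \<in> triples" and k: "k \<in> X" and e: "e \<notin> X"
  shows "convex hull {e_vec X, e_vec (insert e (X - {k}))} edge_of (hypersimplex :: (real ^ 'n) set)"
proof -
  let ?Y = "insert e (X - {k})"
  have cX: "card X = 3" using X by (rule card_triple)
  have Y: "?Y \<in> triples" using cX k e by (simp add: triples_def card_Diff_singleton)
  have XY: "X \<noteq> ?Y" using e by auto
  have "X \<inter> ?Y = X - {k}" "?Y \<inter> X = X - {k}" using e by auto
  then have cXY: "card (X \<inter> ?Y) = 2" "card (?Y \<inter> X) = 2" using cX k by simp_all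
  have val: "(e_vec X + e_vec ?Y) \<bullet> e_vec Z = card (X \<inter> Z) + card (?Y \<inter> Z)" for Z
    by (simp add: inner_add_left inner_e_vec_e_vec)
  have le: "(e_vec X + e_vec ?Y) \<bullet> e_vec Z \<le> 5 \<and>
      ((e_vec X + e_vec ?Y) \<bullet> e_vec Z = 5 \<longleftrightarrow> Z = X \<or> Z = ?Y)" if "Z \<in> triples" for Z
  proof -
    consider "Z = X" | "Z = ?Y" | "Z \<noteq> X" "Z \<noteq> ?Y" by blast
    then show ?thesis
    proof cases
      case 1
      then show ?thesis unfolding val using cX cXY by simp
    next
      case 2
      have "(e_vec X + e_vec ?Y) \<bullet> e_vec Z = 5"
        unfolding val 2 using card_triple[OF Y] cXY by simp
      then show ?thesis using 2 by simp
    next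
      case 3
      have "card (X \<inter> Z) \<le> 2" "card (?Y \<inter> Z) \<le> 2"
        using triples_inter_card X Y that 3 by metis+
      then show ?thesis unfolding val using 3 by simp
    qed
  qed
  let ?a = "e_vec X + e_vec ?Y :: real ^ 'n"
  have "hypersimplex \<inter> {x. ?a \<bullet> x = 5} = convex hull {x \<in> e_vec ` triples. ?a \<bullet> x = 5}"
    unfolding hypersimplex_def
    by (rule convex_hull_Int_supporting_hyperplane_le) (use le in auto)
  also have "{x \<in> e_vec ` triples. ?a \<bullet> x = 5} = e_vec ` {Z \<in> triples. Z = X \<or> Z = ?Y}"
    using le by blast
  also have "\<dots> = {e_vec X, e_vec ?Y}" using X Y by auto
  finally have eq: "hypersimplex \<inter> {x. ?a \<bullet> x = 5} = convex hull {e_vec X, e_vec ?Y}" .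
  have "hypersimplex \<subseteq> {x. ?a \<bullet> x \<le> 5}"
    unfolding hypersimplex_def
    by (rule hull_minimal) (use le in \<open>auto simp: convex_halfspace_le\<close>)
  then have "hypersimplex \<inter> {x. ?a \<bullet> x = 5} face_of hypersimplex"
    by (intro face_of_Int_supporting_hyperplane_le) (auto simp: hypersimplex_def)
  then show ?thesis
    unfolding eq edge_of_def using aff_dim_hull_e_vec[OF XY] by blast
qed

text \<open>The tilt of the cell is perturbed by a small multiple of a functional exposing the face:
  values outside the cell stay larger, and inside it the face is selected. The offset
  \<open>b\<close> of the face is handled by the free height in \<open>cellsI\<close>.\<close>

lemma face_of_cell:
  fixes w :: "'n::finite set \<Rightarrow> real"
  assumes B: "B \<in> cells w" and E: "E face_of convex hull (e_vec ` B)" "E \<noteq> {}"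
  obtains A where "A \<in> cells w" "E = convex hull (e_vec ` A)"
proof -
  have "polyhedron (convex hull (e_vec ` B))"
    by (rule polytope_imp_polyhedron) (auto simp: polytope_def intro: exI[of _ "e_vec ` B"])
  then obtain a b where ab: "convex hull (e_vec ` B) \<subseteq> {x. a \<bullet> x \<le> b}" "E = convex hull (e_vec ` B) \<inter> {x. a \<bullet> x = b}"
    using exposed_face_of_polyhedron E(1) unfolding exposed_face_of_def by metis
  define A where "A = {X \<in> B. a \<bullet> e_vec X = b}"
  have le: "a \<bullet> e_vec X \<le> b" if "X \<in> B" for X
    using ab(1) that hull_inc[of "e_vec X" "e_vec ` B" convex] by blast
  have "E = convex hull {x \<in> e_vec ` B. a \<bullet> x = b}"
    unfolding ab(2) by (rule convex_hull_Int_supporting_hyperplane_le) (use le in auto)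
  also have "{x \<in> e_vec ` B. a \<bullet> x = b} = e_vec ` A" by (auto simp: A_def)
  finally have EA: "E = convex hull (e_vec ` A)" .
  obtain c where c: "\<And>X. X \<in> triples \<Longrightarrow> 0 \<le> w X + sum c X"
    "\<And>X. X \<in> triples \<Longrightarrow> X \<in> B \<longleftrightarrow> w X + sum c X = 0"
    using cellsE[OF B] by blast
  obtain \<epsilon> where e: "0 < \<epsilon>" "\<And>s X. \<bar>s\<bar> \<le> \<epsilon> \<Longrightarrow> X \<in> triples \<Longrightarrow> 0 < w X + sum c X \<Longrightarrow>
      0 < w X + sum c X + s * (b - a \<bullet> e_vec X)"
    using perturb_pos[of triples "\<lambda>X. w X + sum c X" "\<lambda>X. b - a \<bullet> e_vec X"] by auto
  have eq: "w X + sum (\<lambda>i. c i - \<epsilon> * a $ i) X = w X + sum c X + \<epsilon> * (b - a \<bullet> e_vec X) - \<epsilon> * b" for X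
    by (simp add: sum_subtractf sum_distrib_left[symmetric] inner_commute[of a] inner_e_vec algebra_simps)
  have "A \<in> cells w"
  proof (rule cellsI[where c = "\<lambda>i. c i - \<epsilon> * a $ i" and b = "- \<epsilon> * b"])
    show "A \<noteq> {}" using E(2) EA by auto
    show "A \<subseteq> triples" using cells_subset_triples[OF B] by (auto simp: A_def)
    fix X
    show "w X + sum (\<lambda>i. c i - \<epsilon> * a $ i) X = - \<epsilon> * b" if "X \<in> A"
      using that c(2)[of X] cells_subset_triples[OF B] unfolding eq by (auto simp: A_def)
    show "- \<epsilon> * b < w X + sum (\<lambda>i. c i - \<epsilon> * a $ i) X" if X: "X \<in> triples - A"
    proof (cases "X \<in> B")
      case True
      then have "0 < \<epsilon> * (b - a \<bullet> e_vec X)" using X le[OF True] e(1) by (simp add: A_def)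
      then show ?thesis unfolding eq using c(2)[of X] True X by simp
    next
      case False
      then have "0 < w X + sum c X" using c[of X] X by force
      then show ?thesis unfolding eq using e(1) e(2)[of \<epsilon> X] X by simp
    qed
  qed
  then show thesis using EA that by blast
qed

text \<open>An edge of a cell is itself a cell, so exchange works inside the edge. It yields two
  vertices of the edge that differ by one exchange, and these span its line.\<close>

lemma matroid_polytope_cell:
  fixes w :: "'n::finite set \<Rightarrow> real"
  assumes w: "three_term w" and B: "B \<in> cells w"
  shows "matroid_polytope (convex hull (e_vec ` B) :: (real ^ 'n) set)"
  unfolding matroid_polytope_def
proof (intro conjI allI impI)
  show "\<exists>B'. B' \<noteq> {} \<and> B' \<subseteq> triples \<and> convex hull (e_vec ` B) = convex hull (e_vec ` B' :: (real ^ 'n) set)"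
    using B cells_subset_triples[OF B] by (intro exI[of _ B]) (simp add: cells_def)
  fix E :: "(real ^ 'n) set" assume E: "E edge_of convex hull (e_vec ` B)"
  then have E': "E face_of convex hull (e_vec ` B)" "aff_dim E = 1" by (auto simp: edge_of_def)
  then have "E \<noteq> {}" by auto
  then obtain A where A: "A \<in> cells w" "E = convex hull (e_vec ` A)"
    using face_of_cell[OF B E'(1)] by blast
  obtain X where X: "X \<in> A" using A(1) by (auto simp: cells_def)
  have "A \<noteq> {X}"
  proof
    assume "A = {X}"
    then have "E = {e_vec X}" using A(2) by simp
    then show False using E'(2) by simp
  qed
  then obtain Y where Y: "Y \<in> A" "Y \<noteq> X" using X by blast
  have tr: "X \<in> triples" "Y \<in> triples" using X Y cells_subset_triples[OF A(1)] by auto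
  then have "\<not> Y \<subseteq> X" using Y(2) card_subset_eq[of X Y] by (auto simp: card_triple)
  then obtain e where e: "e \<in> Y" "e \<notin> X" by blast
  obtain c where c: "\<And>X. X \<in> triples \<Longrightarrow> 0 \<le> w X + sum c X"
    "\<And>X. X \<in> triples \<Longrightarrow> X \<in> A \<longleftrightarrow> w X + sum c X = 0"
    using cellsE[OF A(1)] by blast
  interpret valuated "\<lambda>X. w X + sum c X"
    by standard (intro three_term_add_sum w, rule c)
  obtain k where k: "k \<in> X" "w (insert e (X - {k})) + sum c (insert e (X - {k})) = 0"
    using exchange[OF tr _ _ e] c(2) tr X Y by blast
  let ?X' = "insert e (X - {k})"
  have "?X' \<in> triples" using card_triple[OF tr(1)] k(1) e by (simp add: triples_def)
  then have X': "?X' \<in> A" using c(2) k(2) by blast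
  let ?E' = "convex hull {e_vec X, e_vec ?X'}"
  have "?E' \<subseteq> E" unfolding A(2) using X X' by (intro hull_mono) auto
  moreover have "aff_dim ?E' = 1" by (rule aff_dim_hull_e_vec) (use e in auto)
  ultimately have "affine hull ?E' = affine hull E"
    using E'(2) by (intro affine_dim_equal) (auto intro: hull_mono[THEN subsetD])
  then show "\<exists>E'. E' edge_of (hypersimplex :: (real ^ 'n) set) \<and>
        affine_parallel (affine hull E) (affine hull E')"
    using exchange_edge[OF tr(1) k(1) e(2)] affine_parallel_reflex by metis
qed

lemma diff_mem_affine_hull_parallel:
  fixes a b :: "real ^ 'n"
  assumes "affine_parallel (affine hull (convex hull {a, b})) (affine hull E)" "x \<in> E" "y \<in> E"
  obtains t where "y - x = t *\<^sub>R (b - a)"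
proof -
  obtain v where v: "affine hull E = (+) v ` (affine hull {a, b})"
    using assms(1) by (auto simp: affine_parallel_def affine_hull_convex_hull)
  have "x \<in> affine hull E" "y \<in> affine hull E" using assms(2,3) by (auto intro: hull_inc)
  then obtain p q where pq: "p \<in> affine hull {a, b}" "q \<in> affine hull {a, b}" "x = v + p" "y = v + q"
    using v by auto
  obtain s s' where ss: "p = a + s *\<^sub>R (b - a)" "q = a + s' *\<^sub>R (b - a)"
    using pq(1,2) unfolding affine_hull_2_alt by blast
  have "y - x = (s' - s) *\<^sub>R (b - a)" unfolding pq(3,4) ss by (simp add: algebra_simps)
  then show thesis by (rule that)
qed

text \<open>An edge in this direction would join vertices \<open>{g, i, j}\<close> and
  \<open>{g, k, l}\<close>. Their midpoint is also that of \<open>{g, i, k}\<close> and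
  \<open>{g, j, l}\<close>, so the face would contain \<open>{g, i, k}\<close>, which lies off the
  line.\<close>

lemma octahedron_diagonal_not_parallel:
  fixes h i j k l :: "'n::finite"
  assumes d: "distinct [h, i, j, k, l]" and E: "E edge_of (hypersimplex :: (real ^ 'n) set)"
  shows "\<not> affine_parallel (affine hull (convex hull {e_vec {h, i, j}, e_vec {h, k, l}})) (affine hull E)"
proof
  assume par: "affine_parallel (affine hull (convex hull {e_vec {h, i, j}, e_vec {h, k, l}})) (affine hull E)"
  define v :: "real ^ 'n" where "v = e_vec {h, k, l} - e_vec {h, i, j}"
  have vn: "v $ x = (if x = k \<or> x = l then 1 else if x = i \<or> x = j then -1 else 0)" for x
    using d by (auto simp: v_def e_vec_nth)
  have dir: "\<exists>t. y - x = t *\<^sub>R v" if "x \<in> E" "y \<in> E" for x y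
    using diff_mem_affine_hull_parallel[OF par that] unfolding v_def by blast
  have face: "E face_of hypersimplex" "aff_dim E = 1" using E by (auto simp: edge_of_def)
  obtain S where S: "S \<subseteq> e_vec ` triples" "E = convex hull S"
    using face_of_convex_hull_subset[OF finite_imp_compact] face(1)
    unfolding hypersimplex_def by (metis finite finite_imageI)
  have "S \<noteq> {}" using S(2) face(2) by auto
  then obtain x where "x \<in> S" by blast
  then have "S \<noteq> {x}" using S(2) face(2) by auto
  then obtain y where "y \<in> S" "y \<noteq> x" using \<open>x \<in> S\<close> by blast
  obtain X Y where XY: "X \<in> triples" "Y \<in> triples" "x = e_vec X" "y = e_vec Y"
    using S(1) \<open>x \<in> S\<close> \<open>y \<in> S\<close> by blast
  have "x \<in> E" "y \<in> E" using S(2) \<open>x \<in> S\<close> \<open>y \<in> S\<close> hull_inc by metis+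
  have *: False if A: "A \<in> triples" "B \<in> triples" "e_vec A \<in> E" "e_vec B \<in> E"
      and t: "e_vec B - e_vec A = t *\<^sub>R v" "0 < t" for A B t
  proof -
    have comp: "e_vec B $ z - e_vec A $ z = t * v $ z" for z
      using t(1) by (metis vector_minus_component vector_scaleR_component real_scaleR_def)
    have kl: "z \<in> B \<and> z \<notin> A" if "z = k \<or> z = l" for z
      using comp[of z] that t(2) by (auto simp: vn e_vec_nth split: if_splits)
    have "i \<notin> {k, l}" "j \<notin> {k, l}" using d by auto
    then have ij: "z \<in> A \<and> z \<notin> B" if "z = i \<or> z = j" for z
      using comp[of z] that t(2) by (auto simp: vn e_vec_nth split: if_splits)
    have "{i, j} \<subseteq> A" "card {i, j} = 2" using ij d by auto
    then have "card (A - {i, j}) = 1" using card_triple[OF A(1)] by (simp add: card_Diff_subset)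
    then obtain g where g: "A - {i, j} = {g}" by (auto simp: card_1_singleton_iff)
    have A': "A = {g, i, j}" "g \<noteq> i" "g \<noteq> j" using g \<open>{i, j} \<subseteq> A\<close> by auto
    have g': "g \<noteq> k" "g \<noteq> l" using kl A' by auto
    have gB: "g \<in> B" using comp[of g] A' g' by (auto simp: vn e_vec_nth split: if_splits)
    have B': "B = {g, k, l}"
    proof (rule sym, rule card_subset_eq)
      show "{g, k, l} \<subseteq> B" using gB kl by auto
      show "card {g, k, l} = card B" using card_triple[OF A(2)] g' d by auto
    qed simp
    have tr: "{g, i, k} \<in> triples" "{g, j, l} \<in> triples" using A' g' d by (auto intro!: triple_mem)
    let ?m = "midpoint (e_vec {g, i, k}) (e_vec {g, j, l}) :: real ^ 'n"
    have "e_vec {g, i, k} + e_vec {g, j, l} = (e_vec {g, i, j} + e_vec {g, k, l} :: real ^ 'n)"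
      using A' g' d by (auto simp: vec_eq_iff e_vec_nth)
    then have "?m = midpoint (e_vec A) (e_vec B)" by (simp add: midpoint_def A' B')
    moreover have "midpoint (e_vec A) (e_vec B) \<in> E"
      using A(3,4) face_of_imp_convex[OF face(1)] midpoints_in_convex_hull[of "e_vec A" E "e_vec B"]
      by (metis convex_hull_eq hull_inc)
    ultimately have m: "?m \<in> E" by simp
    have "{g, i, k} \<noteq> {g, j, l}" using g' A' d by auto
    then have "?m \<in> open_segment (e_vec {g, i, k}) (e_vec {g, j, l})"
      by (simp add: e_vec_inject)
    moreover have "e_vec {g, i, k} \<in> hypersimplex" "e_vec {g, j, l} \<in> hypersimplex"
      using tr unfolding hypersimplex_def by (simp_all add: hull_inc)
    ultimately have "e_vec {g, i, k} \<in> E"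
      using face_ofD[OF face(1) _ _ _ m] by blast
    then obtain r where "e_vec {g, i, k} - e_vec A = r *\<^sub>R v" using dir[OF A(3)] by blast
    then have comp: "e_vec {g, i, k} $ z - e_vec A $ z = r * v $ z" for z
      by (metis vector_minus_component vector_scaleR_component real_scaleR_def)
    have "r = 0" using comp[of l] g' d A' by (auto simp: vn e_vec_nth split: if_splits)
    then show False using comp[of k] g' d A' by (auto simp: vn e_vec_nth split: if_splits)
  qed
  obtain t where t: "y - x = t *\<^sub>R v" using dir[OF \<open>x \<in> E\<close> \<open>y \<in> E\<close>] by blast
  then have "t \<noteq> 0" using \<open>y \<noteq> x\<close> by auto
  then consider "0 < t" | "0 < - t" by linarith
  then show False
  proof cases
    case 1
    then show ?thesis using *[OF XY(1,2)] t XY \<open>x \<in> E\<close> \<open>y \<in> E\<close> by auto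
  next
    case 2
    have "x - y = (- t) *\<^sub>R v" using t by (simp add: algebra_simps)
    then show ?thesis using *[OF XY(2,1) _ _ _ 2] XY \<open>x \<in> E\<close> \<open>y \<in> E\<close> by blast
  qed
qed

text \<open>If a term is strictly smallest, the balanced functional of
  \<open>minimal_term_cell\<close> is positive at the four other vertices of the octahedron. The
  resulting cell is only a diagonal, whose direction is not that of any edge of the
  hypersimplex.\<close>

lemma three_term_of_matroid_cells:
  fixes w :: "'n::finite set \<Rightarrow> real"
  assumes "\<And>B. B \<in> cells w \<Longrightarrow> matroid_polytope (convex hull (e_vec ` B) :: (real ^ 'n) set)"
  shows "three_term w"
  unfolding three_term_def
proof (intro allI impI, rule ccontr)
  fix h i j k l :: 'n assume d: "distinct [h, i, j, k, l]"
    and "\<not> min (w {h, i, k} + w {h, j, l}) (w {h, i, l} + w {h, j, k}) \<le> w {h, i, j} + w {h, k, l}"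
  then have lt: "w {h, i, j} + w {h, k, l} < w {h, i, k} + w {h, j, l}"
    "w {h, i, j} + w {h, k, l} < w {h, i, l} + w {h, j, k}" by auto
  then have "term_minimal w h i j k l" by (simp add: term_minimal_def)
  then obtain c where c: "\<And>X. X \<in> triples \<Longrightarrow> 0 \<le> w X + sum c X"
    "w {h, i, j} + sum c {h, i, j} = 0" "w {h, k, l} + sum c {h, k, l} = 0"
    "\<And>X. X \<in> triples \<Longrightarrow> w X + sum c X = 0 \<Longrightarrow> X \<in> {{h,i,j},{h,k,l},{h,i,k},{h,j,l},{h,i,l},{h,j,k}}"
    "w {h, i, k} + sum c {h, i, k} = w {h, j, l} + sum c {h, j, l}"
    "w {h, i, l} + sum c {h, i, l} = w {h, j, k} + sum c {h, j, k}"
    by (rule minimal_term_cell[OF d]) blast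
  have nz: "w {h, i, k} + sum c {h, i, k} \<noteq> 0" "w {h, j, l} + sum c {h, j, l} \<noteq> 0"
    "w {h, i, l} + sum c {h, i, l} \<noteq> 0" "w {h, j, k} + sum c {h, j, k} \<noteq> 0"
    using lt c(2,3,5,6) sum_triples_eq[OF d, of c] by linarith+
  have t: "{h, i, j} \<in> triples" "{h, k, l} \<in> triples" using d by (simp_all add: triple_mem)
  let ?B = "{{h, i, j}, {h, k, l}}"
  have "?B \<in> cells w"
  proof (rule cellsI[where c = c and b = 0])
    show "w X + sum c X = 0" if "X \<in> ?B" for X
      using that c(2,3) by (elim insertE) (simp_all only: empty_iff)
    show "0 < w X + sum c X" if X: "X \<in> triples - ?B" for X
    proof (rule ccontr)
      assume "\<not> 0 < w X + sum c X"
      then have "w X + sum c X = 0" using c(1)[of X] X by simp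
      moreover from this have "X \<in> {{h,i,j},{h,k,l},{h,i,k},{h,j,l},{h,i,l},{h,j,k}}"
        by (rule c(4)[rotated]) (use X in simp)
      ultimately show False using X nz
        unfolding insert_iff empty_iff Diff_iff by (elim conjE disjE) (simp_all only: simp_thms)
    qed
  qed (use t in simp_all)
  then have "matroid_polytope (convex hull {e_vec {h, i, j}, e_vec {h, k, l}} :: (real ^ 'n) set)"
    using assms[of ?B] by simp
  moreover have "{h, i, j} \<noteq> {h, k, l}" using d by auto
  then have "convex hull {e_vec {h, i, j}, e_vec {h, k, l}} edge_of
      (convex hull {e_vec {h, i, j}, e_vec {h, k, l}} :: (real ^ 'n) set)"
    by (simp add: edge_of_def aff_dim_hull_e_vec face_of_refl)
  ultimately show False
    unfolding matroid_polytope_def using octahedron_diagonal_not_parallel[OF d] by blast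
qed

lemma regular_matroid_subdivisions_eq:
  "(regular_matroid_subdivisions :: (real ^ 'n::finite) set set set) = induced_subdivision ` dressian"
proof -
  have "(\<forall>C\<in>induced_subdivision w. matroid_polytope C) \<longleftrightarrow> three_term w" for w :: "'n set \<Rightarrow> real"
    using matroid_polytope_cell three_term_of_matroid_cells unfolding induced_subdivision_eq_cells by blast
  then show ?thesis
    unfolding regular_matroid_subdivisions_def by (auto simp: dressian_iff)
qed

section \<open>Trees, splits and quartets\<close>

definition conn :: "'v set set \<Rightarrow> 'v \<Rightarrow> 'v \<Rightarrow> bool" where
  "conn E u v \<longleftrightarrow> (u, v) \<in> {(x, y). {x, y} \<in> E}\<^sup>*"

lemma conn_refl [simp]: "conn E u u"
  by (simp add: conn_def)

lemma conn_trans: "conn E u v \<Longrightarrow> conn E v w \<Longrightarrow> conn E u w"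
  unfolding conn_def by (rule rtrancl_trans)

lemma conn_edge: "{u, v} \<in> E \<Longrightarrow> conn E u v"
  unfolding conn_def by blast

lemma conn_sym: "conn E u v \<Longrightarrow> conn E v u"
proof -
  have "sym {(x, y). {x, y} \<in> E}" by (rule symI) (simp add: insert_commute)
  then show "conn E u v \<Longrightarrow> conn E v u" unfolding conn_def by (meson sym_rtrancl symD)
qed

lemma conn_commute: "conn E u v \<longleftrightarrow> conn E v u"
  using conn_sym by metis

lemma conn_mono: "conn E u v \<Longrightarrow> E \<subseteq> E' \<Longrightarrow> conn E' u v"
  unfolding conn_def by (erule rtrancl_mono[THEN subsetD, rotated]) auto

lemma conn_induct [consumes 1, case_names refl step]:
  assumes "conn E u v" "P u" "\<And>x y. conn E u x \<Longrightarrow> {x, y} \<in> E \<Longrightarrow> P x \<Longrightarrow> P y"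
  shows "P v"
  using assms(1) unfolding conn_def
  by (induction rule: rtrancl_induct) (use assms(2,3) in \<open>auto simp: conn_def\<close>)

lemma simple_path_singleton [simp]: "simple_path E [u]"
  by (simp add: simple_path_def)

lemma simple_path_Cons:
  "simple_path E (u # x # p) \<longleftrightarrow> u \<notin> set (x # p) \<and> {u, x} \<in> E \<and> simple_path E (x # p)"
proof -
  have "(\<forall>i. Suc i < length (u # x # p) \<longrightarrow> {(u # x # p) ! i, (u # x # p) ! Suc i} \<in> E) \<longleftrightarrow>
      {u, x} \<in> E \<and> (\<forall>i. Suc i < length (x # p) \<longrightarrow> {(x # p) ! i, (x # p) ! Suc i} \<in> E)"
    by (simp add: All_less_Suc2)
  then show ?thesis unfolding simple_path_def by auto
qed

lemma simple_path_suffix: "simple_path E (p @ q) \<Longrightarrow> q \<noteq> [] \<Longrightarrow> simple_path E q"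
proof (induction p)
  case (Cons u p)
  then show ?case
    by (cases "p @ q") (auto simp: simple_path_Cons)
qed simp

lemma simple_path_imp_conn: "simple_path E p \<Longrightarrow> conn E (hd p) (last p)"
proof (induction p rule: induct_list012)
  case (3 u x p)
  then show ?case by (auto simp: simple_path_Cons intro: conn_trans[OF conn_edge])
qed (auto simp: simple_path_def)

lemma simple_path_mono: "simple_path E p \<Longrightarrow> E \<subseteq> E' \<Longrightarrow> simple_path E' p"
  unfolding simple_path_def by blast

lemma conn_imp_joins: "conn E u v \<Longrightarrow> \<exists>p. joins E u p v"
proof -
  assume "conn E u v"
  then have "conn E v u" by (rule conn_sym)
  then show ?thesis
  proof (induction rule: conn_induct)
    case refl
    then show ?case by (intro exI[of _ "[v]"]) (simp add: joins_def)
  next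
    case (step x y)
    then obtain p where p: "joins E x p v" by blast
    show ?case
    proof (cases "y \<in> set p")
      case True
      then obtain q r where "p = q @ y # r" by (meson split_list)
      then have "joins E y (y # r) v"
        using p simple_path_suffix[of E q "y # r"] by (auto simp: joins_def)
      then show ?thesis by blast
    next
      case False
      obtain r where "p = x # r" using p by (cases p) (auto simp: joins_def simple_path_def)
      then have "joins E y (y # p) v"
        using p False step(2) by (auto simp: joins_def simple_path_Cons insert_commute)
      then show ?thesis by blast
    qed
  qed
qed

lemma joins_imp_conn: "joins E u p v \<Longrightarrow> conn E u v"
  using simple_path_imp_conn by (metis joins_def)

text \<open>Acyclicity is stated as every edge being a bridge, the form that arguments about splits
  use; both directions of the passage to \<open>is_tree\<close> are proved below.
  \<open>con e\<close> means lying on the same side of \<open>e\<close>.\<close>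

locale bridge_tree =
  fixes V :: "'v set" and E :: "'v set set"
  assumes fin: "finite V" and nonempty: "V \<noteq> {}"
    and edge_pairs: "E \<subseteq> {{u, v} |u v. u \<in> V \<and> v \<in> V \<and> u \<noteq> v}"
    and connected: "u \<in> V \<Longrightarrow> v \<in> V \<Longrightarrow> conn E u v"
    and bridge: "{p, q} \<in> E \<Longrightarrow> \<not> conn (E - {{p, q}}) p q"
begin

abbreviation con :: "'v set \<Rightarrow> 'v \<Rightarrow> 'v \<Rightarrow> bool" where
  "con e \<equiv> conn (E - {e})"

lemma edgeE:
  assumes "e \<in> E"
  obtains u v where "e = {u, v}" "u \<in> V" "v \<in> V" "u \<noteq> v"
  using assms edge_pairs by auto

lemma edgeD: "{u, v} \<in> E \<Longrightarrow> u \<in> V \<and> v \<in> V \<and> u \<noteq> v"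
  by (erule edgeE) (auto simp: doubleton_eq_iff)

lemma finite_edges: "finite E"
proof (rule finite_subset)
  show "E \<subseteq> Pow V" using edge_pairs by auto
qed (simp add: fin)

lemma other_edge: "{p, q} \<in> E \<Longrightarrow> {p, q} \<noteq> e \<Longrightarrow> con e p q"
  by (rule conn_edge) simp

lemma two_sides:
  assumes "{p, q} \<in> E" "v \<in> V"
  shows "con {p, q} v p \<or> con {p, q} v q"
proof -
  have "conn E p v" using assms edgeD connected by blast
  then show ?thesis
  proof (induction rule: conn_induct)
    case (step x y)
    then show ?case
    proof (cases "{x, y} = {p, q}")
      case True
      then show ?thesis by (auto simp: doubleton_eq_iff)
    next
      case False
      then have "con {p, q} y x" using step(2) other_edge[of y x] by (simp add: insert_commute)
      then show ?thesis using step(3) conn_trans by metis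
    qed
  qed simp
qed

lemma sides:
  assumes "e \<in> E" "u \<in> V" "v \<in> V" "w \<in> V" "\<not> con e u v" "\<not> con e u w"
  shows "con e v w"
proof -
  obtain p q where e: "e = {p, q}" using assms(1) edgeE by metis
  have E: "{p, q} \<in> E" using assms(1) e by simp
  have tr: "con e a c" if "con e a b" "con e c b" for a b c
    using conn_trans[OF that(1) conn_sym[OF that(2)]] .
  have "con e u p \<or> con e u q" "con e v p \<or> con e v q" "con e w p \<or> con e w q"
    using two_sides[OF E] assms(2-4) unfolding e by blast+
  then show ?thesis using assms(5,6) tr by blast
qed

lemma same_side_iff:
  assumes "e \<in> E" "u \<in> V" "v \<in> V" "w \<in> V"
  shows "con e v w \<longleftrightarrow> (con e u v \<longleftrightarrow> con e u w)"
  using sides[OF assms] conn_trans[of "E - {e}" u v w] conn_trans[of "E - {e}" u w v]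
    conn_trans[OF conn_sym, of "E - {e}" u v w] conn_commute[of "E - {e}" v w] by blast

text \<open>A walk from \<open>u\<close> to \<open>v\<close> avoiding \<open>e\<close> never reaches
  the end \<open>x\<close> of \<open>f\<close>, hence never uses \<open>f\<close>. This is the
  compatibility of the splits of two edges.\<close>

lemma compat:
  assumes "e \<in> E" "f \<in> E" "e \<noteq> f" "x \<in> f" "u \<in> V" "v \<in> V" "\<not> con e u x" "\<not> con e v x"
  shows "con f u v"
proof -
  have "x \<in> V" using assms(2,4) edge_pairs by blast
  then have "con e u v"
    using sides[of e x u v] assms conn_commute by metis
  then show ?thesis
  proof (induction rule: conn_induct)
    case (step a b)
    have "{a, b} \<noteq> f"
    proof
      assume f: "{a, b} = f"
      then have "con e a x"
        using assms(2-4) other_edge[of a b e] by auto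
      then show False using step(1) assms(7) conn_trans by metis
    qed
    then have "con f a b" using step(2) by (intro conn_edge) auto
    then show ?case using step(3) conn_trans by metis
  qed simp
qed

lemma beyond:
  assumes "{v, r} \<in> E" "{v, s} \<in> E" "r \<noteq> s" "x \<in> V" "\<not> con {v, s} v x"
  shows "con {v, r} v x"
proof -
  have ne: "{v, s} \<noteq> {v, r}" using assms(3) by (auto simp: doubleton_eq_iff)
  have V: "v \<in> V" "s \<in> V" using assms(2) edgeD by auto
  have "con {v, r} x s"
    by (rule compat[of "{v, s}" "{v, r}" v])
      (use assms V ne bridge[of v s] conn_commute in \<open>auto simp: conn_commute[of _ _ v]\<close>)
  moreover have "con {v, r} v s" using assms(2) ne by (intro other_edge) auto
  ultimately show ?thesis using conn_sym conn_trans by metis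
qed

text \<open>The branches behind two edges at \<open>v\<close> are disjoint, so no edge can cut
  \<open>v\<close> off from a vertex in each. Applied to three branches, it makes \<open>v\<close>
  the median of one vertex from each.\<close>

lemma median_step:
  assumes e: "{v, r} \<in> E" "{v, s} \<in> E" "r \<noteq> s" and x: "x \<in> V" "y \<in> V"
    and b: "\<not> con {v, r} v x" "\<not> con {v, s} v y" and f: "f \<in> E"
  shows "con f v x \<or> con f v y"
proof (rule ccontr)
  assume neg: "\<not> ?thesis"
  have y: "con {v, r} v y" by (rule beyond[OF e x(2) b(2)])
  have "{v, r} \<noteq> f" using neg y by auto
  then have "con {v, r} x y"
    by (intro compat[of f "{v, r}" v]) (use neg e f x in \<open>auto simp: conn_commute[of _ _ v]\<close>)
  then show False using y b(1) conn_sym conn_trans by metis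
qed

definition majority :: "'v \<Rightarrow> 'v \<Rightarrow> 'v \<Rightarrow> 'v set \<Rightarrow> 'v \<Rightarrow> bool" where
  "majority x y z e v \<longleftrightarrow> con e v x \<and> con e v y \<or> con e v x \<and> con e v z \<or> con e v y \<and> con e v z"

lemma majority_cong: "con e u v \<Longrightarrow> majority x y z e u \<longleftrightarrow> majority x y z e v"
  unfolding majority_def by (metis conn_sym conn_trans)

lemma majority_flip:
  assumes "e \<in> E" "u \<in> V" "v \<in> V" "x \<in> V" "y \<in> V" "z \<in> V" "\<not> con e u v" "\<not> majority x y z e u"
  shows "majority x y z e v"
proof -
  have "con e v w \<or> con e u w" if "w \<in> V" for w
    using sides[of e u v w] assms that by blast
  then show ?thesis using assms(4-6,8) unfolding majority_def by blast
qed

text \<open>The median of three vertices minimises the number of edges that cut it off from two of them.\<close>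

lemma ex_median:
  assumes V: "x \<in> V" "y \<in> V" "z \<in> V"
  shows "\<exists>v\<in>V. \<forall>e\<in>E. majority x y z e v"
proof -
  define bad where "bad v = {e \<in> E. \<not> majority x y z e v}" for v
  obtain v where v: "v \<in> V" "\<And>w. w \<in> V \<Longrightarrow> card (bad v) \<le> card (bad w)"
    using ex_has_least_nat[of "\<lambda>v. v \<in> V" x "\<lambda>v. card (bad v)"] V by blast
  have "bad v = {}"
  proof (rule ccontr)
    assume "bad v \<noteq> {}"
    then obtain e where e: "e \<in> E" "\<not> majority x y z e v" by (auto simp: bad_def)
    obtain a b where ab: "e = {a, b}" using edgeE[OF e(1)] by metis
    then obtain p q where pq: "e = {p, q}" "con e v p"
      using two_sides[of a b v] e v(1) by (metis insert_commute)
    have V': "p \<in> V" "q \<in> V" using edgeD e(1) pq by auto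
    have npq: "\<not> con e p q" using bridge pq e by blast
    then have nq: "\<not> con e v q" using pq(2) conn_sym conn_trans by metis
    \<comment> \<open>Crossing \<open>e\<close> repairs \<open>e\<close>, since at least two of the
      three vertices lie beyond it. An edge \<open>f\<close> spoiled by the move would lie on the
      side of \<open>v\<close>; then those two vertices and \<open>q\<close> are together with
      respect to \<open>f\<close>, so \<open>f\<close> is not bad at \<open>q\<close>.\<close>
    have "bad q \<subset> bad v"
    proof (rule psubsetI)
      show "bad q \<subseteq> bad v"
      proof
        fix f assume "f \<in> bad q"
        then have f: "f \<in> E" "\<not> majority x y z f q" by (auto simp: bad_def)
        have "f \<noteq> e" using majority_flip[OF e(1) v(1) V'(2) V nq e(2)] f by auto
        have fpq: "con f p q" using pq e \<open>f \<noteq> e\<close> other_edge by metis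
        have "\<not> majority x y z f v"
        proof
          assume m: "majority x y z f v"
          then have nvq: "\<not> con f v q" using f(2) majority_cong by metis
          obtain a b where fab: "f = {a, b}" "a \<in> V" using edgeE[OF f(1)] by metis
          have va: "con e v a"
          proof (rule ccontr)
            assume na: "\<not> con e v a"
            then have "\<not> con e p a" using pq(2) conn_trans by metis
            then have "con f v p"
              using compat[of e f a v p] e(1) f(1) \<open>f \<noteq> e\<close> fab na v(1) V'(1) by blast
            then show False using fpq nvq conn_trans by metis
          qed
          have "con f q w" if w: "w \<in> V" "\<not> con e v w" for w
          proof (rule compat[of e f a q w])
            show "\<not> con e q a" using va nq conn_sym conn_trans by metis
            show "\<not> con e w a" using va w(2) conn_sym conn_trans by metis
          qed (use e(1) f(1) \<open>f \<noteq> e\<close> fab V' w in auto)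
          then have "majority x y z f q"
            using e(2) V unfolding majority_def by blast
          then show False using f(2) by blast
        qed
        then show "f \<in> bad v" using f(1) by (simp add: bad_def)
      qed
      show "bad q \<noteq> bad v"
        using majority_flip[OF e(1) v(1) V'(2) V nq e(2)] e by (auto simp: bad_def)
    qed
    then have "card (bad q) < card (bad v)"
      by (intro psubset_card_mono) (auto simp: bad_def finite_edges)
    then show False using v(2)[OF V'(2)] by simp
  qed
  then show ?thesis using v(1) by (auto simp: bad_def)
qed

definition deg :: "'v \<Rightarrow> nat" where
  "deg v = card {e \<in> E. v \<in> e}"

text \<open>Walk away from \<open>v\<close>: if \<open>r\<close> is not a leaf, another edge leads
  on from it, and the part beyond that edge is strictly smaller.\<close>

lemma leaf_beyond:
  assumes "{v, r} \<in> E"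
  shows "\<exists>x\<in>V. deg x = 1 \<and> \<not> con {v, r} v x"
  using assms
proof (induction "card {z \<in> V. \<not> con {v, r} v z}" arbitrary: v r rule: less_induct)
  case less
  have V: "v \<in> V" "r \<in> V" "v \<noteq> r" using edgeD less.prems by auto
  have nvr: "\<not> con {v, r} v r" using bridge less.prems by blast
  show ?case
  proof (cases "deg r = 1")
    case True
    then show ?thesis using V nvr by blast
  next
    case False
    have "{e \<in> E. r \<in> e} \<noteq> {{v, r}}"
    proof
      assume "{e \<in> E. r \<in> e} = {{v, r}}"
      then show False using False unfolding deg_def by simp
    qed
    moreover have "{v, r} \<in> {e \<in> E. r \<in> e}" using less.prems by simp
    ultimately obtain f where f: "f \<in> E" "r \<in> f" "f \<noteq> {v, r}" by blast
    obtain a b where "f = {a, b}" using edgeE[OF f(1)] by metis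
    then have "f = {r, a} \<or> f = {r, b}" using f(2) by auto
    then obtain s where s: "f = {r, s}" by blast
    have sub: "\<not> con {v, r} v z" if z: "z \<in> V" "\<not> con f r z" for z
    proof
      assume vz: "con {v, r} v z"
      have "\<not> con {v, r} z r" using vz nvr conn_sym conn_trans by metis
      then have "con f v z"
        using compat[of "{v, r}" f r v z] less.prems f V z nvr by blast
      moreover have "con f v r" using less.prems f(3) other_edge by metis
      ultimately show False using z(2) conn_sym conn_trans by metis
    qed
    have "{z \<in> V. \<not> con {r, s} r z} \<subset> {z \<in> V. \<not> con {v, r} v z}"
    proof (rule psubsetI)
      have "r \<in> {z \<in> V. \<not> con {v, r} v z}" "r \<notin> {z \<in> V. \<not> con {r, s} r z}"
        using V nvr by simp_all
      then show "{z \<in> V. \<not> con {r, s} r z} \<noteq> {z \<in> V. \<not> con {v, r} v z}" by blast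
    qed (use sub s in auto)
    then have "card {z \<in> V. \<not> con {r, s} r z} < card {z \<in> V. \<not> con {v, r} v z}"
      by (intro psubset_card_mono) (auto simp: fin)
    then obtain x where "x \<in> V" "deg x = 1" "\<not> con {r, s} r x"
      using less.hyps[of r s] f s by blast
    then show ?thesis using sub s by blast
  qed
qed

lemma isolated:
  assumes "\<And>f. f \<in> E \<Longrightarrow> x \<in> f \<Longrightarrow> f = e" "con e x v"
  shows "v = x"
  using assms(2)
proof (induction rule: conn_induct)
  case (step a b)
  then show ?case using assms(1) by (metis Diff_iff insertI1 singletonI)
qed simp

lemma leaf_edge:
  assumes "deg x = 1"
  obtains e where "e \<in> E" "x \<in> e" "\<And>f. f \<in> E \<Longrightarrow> x \<in> f \<Longrightarrow> f = e"
    "\<And>v. con e x v \<Longrightarrow> v = x"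
proof -
  obtain e where e: "{e \<in> E. x \<in> e} = {e}"
    using assms unfolding deg_def by (auto simp: card_1_singleton_iff)
  have 1: "\<And>f. f \<in> E \<Longrightarrow> x \<in> f \<Longrightarrow> f = e" using e by blast
  show thesis
    by (rule that[of e]) (use e 1 isolated in blast)+
qed

lemma simple_path_avoids:
  assumes "simple_path E (u # x # p)"
  shows "con {u, x} x (last (x # p))" "\<not> con {u, x} u (last (x # p))"
proof -
  have p: "u \<notin> set (x # p)" "{u, x} \<in> E" "simple_path E (x # p)"
    using assms by (auto simp: simple_path_Cons)
  have "simple_path (E - {{u, x}}) (x # p)"
    unfolding simple_path_def
  proof (intro conjI allI impI)
    fix i assume i: "Suc i < length (x # p)"
    then have "(x # p) ! i \<in> set (x # p)" "(x # p) ! Suc i \<in> set (x # p)"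
      by (intro nth_mem; simp)+
    then have "{(x # p) ! i, (x # p) ! Suc i} \<noteq> {u, x}" using p(1) by (metis insertE insertI1 singletonD)
    then show "{(x # p) ! i, (x # p) ! Suc i} \<in> E - {{u, x}}"
      using i p(3) unfolding simple_path_def by blast
  qed (use p(3) in \<open>simp_all add: simple_path_def\<close>)
  then show *: "con {u, x} x (last (x # p))" using simple_path_imp_conn by fastforce
  then show "\<not> con {u, x} u (last (x # p))" using bridge[OF p(2)] conn_sym conn_trans by metis
qed

lemma simple_path_in_V: "simple_path E p \<Longrightarrow> hd p \<in> V \<Longrightarrow> set p \<subseteq> V"
proof (induction p rule: induct_list012)
  case (3 u x p)
  then show ?case using edgeD by (auto simp: simple_path_Cons)
qed (auto simp: simple_path_def)

text \<open>The first edge of a simple path separates its ends, and by \<open>beyond\<close> only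
  one edge at the start does so. The first steps agree and the rest follows by induction.\<close>

lemma joins_unique: "joins E u p v \<Longrightarrow> joins E u p' v \<Longrightarrow> u \<in> V \<Longrightarrow> p = p'"
proof (induction p arbitrary: u p' rule: induct_list012)
  case 1
  then show ?case by (simp add: joins_def simple_path_def)
next
  case (2 w)
  then have "w = u" "v = u" by (auto simp: joins_def)
  then show ?case using 2 by (cases p') (auto simp: joins_def simple_path_def split: if_splits)
next
  case (3 w x p)
  then have w: "w = u" "last (x # p) = v" "simple_path E (u # x # p)" by (auto simp: joins_def)
  have "v \<noteq> u" using w(2,3) last_in_set[of "x # p"] by (auto simp: simple_path_Cons)
  then obtain x' r where p': "p' = u # x' # r"
    using 3(4) by (cases p' rule: remdups_adj.cases) (auto simp: joins_def simple_path_def)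
  then have w': "last (x' # r) = v" "simple_path E (u # x' # r)" using 3(4) by (auto simp: joins_def)
  have e: "{u, x} \<in> E" "{u, x'} \<in> E" using w(3) w'(2) by (auto simp: simple_path_Cons)
  have "set (u # x # p) \<subseteq> V" using simple_path_in_V[OF w(3)] 3(5) by simp
  moreover have "last (x # p) \<in> set (u # x # p)" using last_in_set[of "x # p"] by simp
  ultimately have "v \<in> V" using w(2) by blast
  have "x = x'"
  proof (rule ccontr)
    assume "x \<noteq> x'"
    then have "con {u, x} u v"
      using beyond[OF e \<open>x \<noteq> x'\<close> \<open>v \<in> V\<close>] simple_path_avoids(2)[OF w'(2)] w'(1) by simp
    then show False using simple_path_avoids(2)[OF w(3)] w(2) by simp
  qed
  moreover have "joins E x (x # p) v" "joins E x (x # r) v"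
    using w w' \<open>x = x'\<close> by (auto simp: joins_def simple_path_Cons)
  then have "x # p = x # r" using 3(2) e(1) edgeD by blast
  ultimately show ?case using p' w(1) by simp
qed

text \<open>The edges of a simple path are exactly those separating its ends. Distances become sums
  over all edges, so metric identities can be checked one edge at a time.\<close>

lemma path_length:
  fixes l :: "'v set \<Rightarrow> real"
  shows "joins E u p v \<Longrightarrow> u \<in> V \<Longrightarrow>
    sum_list (map2 (\<lambda>u v. l {u, v}) p (tl p)) = (\<Sum>e\<in>E. if con e u v then 0 else l e)"
proof (induction p arbitrary: u rule: induct_list012)
  case 1
  then show ?case by (simp add: joins_def simple_path_def)
next
  case (2 w)
  then have "v = u" by (auto simp: joins_def)
  then show ?case by simp
next
  case (3 w x p)
  then have w: "w = u" "last (x # p) = v" "simple_path E (u # x # p)" by (auto simp: joins_def)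
  have e: "{u, x} \<in> E" using w(3) by (auto simp: simple_path_Cons)
  have "joins E x (x # p) v" using w by (auto simp: joins_def simple_path_Cons)
  then have IH: "sum_list (map2 (\<lambda>u v. l {u, v}) (x # p) (tl (x # p))) = (\<Sum>e\<in>E. if con e x v then 0 else l e)"
    using 3(2) e edgeD by blast
  have same: "con f u v \<longleftrightarrow> con f x v" if "f \<in> E - {{u, x}}" for f
  proof -
    have "con f u x" using other_edge[OF e, of f] that by blast
    then show ?thesis using conn_sym conn_trans by metis
  qed
  have "(\<Sum>e\<in>E. if con e u v then 0 else l e)
      = l {u, x} + (\<Sum>f\<in>E - {{u, x}}. if con f u v then 0 else l f)"
    using simple_path_avoids(2)[OF w(3)] w(2) by (simp add: sum.remove[OF finite_edges e])
  also have "(\<Sum>f\<in>E - {{u, x}}. if con f u v then 0 else l f) = (\<Sum>f\<in>E - {{u, x}}. if con f x v then 0 else l f)"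
    using same by (intro sum.cong) auto
  also have "\<dots> = (\<Sum>f\<in>E. if con f x v then 0 else l f)"
    using simple_path_avoids(1)[OF w(3)] w(2) by (simp add: sum.remove[OF finite_edges e])
  finally show ?case using IH w(1) by simp
qed

lemma conn_separating_edges:
  assumes "u \<in> V" "v \<in> V"
  shows "conn {e \<in> E. \<not> con e u v} u v"
proof -
  have "conn {e \<in> E. \<not> con e u v} u v" if "joins E u p v" "u \<in> V" for p u
    using that
  proof (induction p arbitrary: u rule: induct_list012)
    case 1
    then show ?case by (simp add: joins_def simple_path_def)
  next
    case (2 w)
    then have "v = u" by (auto simp: joins_def)
    then show ?case by simp
  next
    case (3 w x p)
    then have w: "w = u" "last (x # p) = v" "simple_path E (u # x # p)" by (auto simp: joins_def)
    have e: "{u, x} \<in> E" using w(3) by (auto simp: simple_path_Cons)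
    have "joins E x (x # p) v" using w by (auto simp: joins_def simple_path_Cons)
    then have IH: "conn {e \<in> E. \<not> con e x v} x v" using 3(2) e edgeD by blast
    have "{e \<in> E. \<not> con e x v} \<subseteq> {e \<in> E. \<not> con e u v}"
    proof clarify
      fix f assume f: "f \<in> E" "\<not> con f x v" "con f u v"
      then have "f \<noteq> {u, x}" using simple_path_avoids(1)[OF w(3)] w(2) by auto
      then have "con f x u" using other_edge[OF e, of f] conn_sym by metis
      then show False using f conn_trans by metis
    qed
    moreover have "{u, x} \<in> {e \<in> E. \<not> con e u v}"
      using e simple_path_avoids(2)[OF w(3)] w(2) by simp
    ultimately have "conn {e \<in> E. \<not> con e u v} u v"
      by (intro conn_trans[OF conn_edge conn_mono[OF IH]])
    then show ?case unfolding w(1) .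
  qed
  moreover obtain p where "joins E u p v" using conn_imp_joins connected assms by metis
  ultimately show ?thesis using assms by blast
qed

end

lemma is_tree_imp_bridge_tree:
  assumes "is_tree G"
  shows "bridge_tree (verts G) (edges G)"
proof
  show "finite (verts G)" "verts G \<noteq> {}"
    "edges G \<subseteq> {{u, v} |u v. u \<in> verts G \<and> v \<in> verts G \<and> u \<noteq> v}"
    using assms by (auto simp: is_tree_def)
  show "conn (edges G) u v" if "u \<in> verts G" "v \<in> verts G" for u v
    using assms that joins_imp_conn unfolding is_tree_def by metis
  fix p q assume e: "{p, q} \<in> edges G"
  show "\<not> conn (edges G - {{p, q}}) p q"
  proof
    assume "conn (edges G - {{p, q}}) p q"
    then obtain r where r: "joins (edges G - {{p, q}}) p r q" using conn_imp_joins by metis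
    have "p \<noteq> q" using assms e by (auto simp: is_tree_def doubleton_eq_iff)
    have "3 \<le> length r"
    proof (rule ccontr)
      assume "\<not> 3 \<le> length r"
      then consider "r = []" | a where "r = [a]" | a b where "r = [a, b]"
        by (cases r rule: remdups_adj.cases) (auto simp: not_less_eq_eq)
      then show False
        by cases (use r \<open>p \<noteq> q\<close> in \<open>auto simp: joins_def simple_path_Cons simple_path_def\<close>)
    qed
    moreover have "simple_path (edges G) r" using r by (auto simp: joins_def intro: simple_path_mono)
    moreover have "{last r, hd r} \<in> edges G" using r e by (simp add: joins_def insert_commute)
    ultimately show False using assms unfolding is_tree_def by blast
  qed
qed

lemma bridge_tree_imp_is_tree:
  assumes "bridge_tree (verts G) (edges G)"
  shows "is_tree G"
proof -
  interpret bridge_tree "verts G" "edges G" by fact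
  have "\<not> (simple_path (edges G) p \<and> 3 \<le> length p \<and> {last p, hd p} \<in> edges G)" for p
  proof
    assume p: "simple_path (edges G) p \<and> 3 \<le> length p \<and> {last p, hd p} \<in> edges G"
    then have ne: "p \<noteq> []" "distinct p" by (auto simp: simple_path_def)
    have "{p ! i, p ! Suc i} \<noteq> {last p, hd p}" if "Suc i < length p" for i
      using that p ne by (auto simp: doubleton_eq_iff last_conv_nth hd_conv_nth nth_eq_iff_index_eq)
    then have "simple_path (edges G - {{last p, hd p}}) p"
      using p unfolding simple_path_def by blast
    then have "con {last p, hd p} (hd p) (last p)" by (rule simple_path_imp_conn)
    then show False using bridge[of "last p" "hd p"] p conn_sym by metis
  qed
  then show ?thesis
    using fin nonempty edge_pairs connected conn_imp_joins unfolding is_tree_def by metis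
qed

text \<open>Buneman's vertices: \<open>S\<close> holds both sides of each split, and the sides with
  a majority of \<open>a\<close>, \<open>b\<close>, \<open>c\<close>, counted with repetition, are
  selected. This orients the splits towards the median.\<close>

definition split_maj :: "'a set set \<Rightarrow> 'a \<Rightarrow> 'a \<Rightarrow> 'a \<Rightarrow> 'a set set" where
  "split_maj S a b c = {A \<in> S. a \<in> A \<and> b \<in> A \<or> a \<in> A \<and> c \<in> A \<or> b \<in> A \<and> c \<in> A}"

text \<open>A split is represented by its two sides, hence closure under complement. Compatibility
  says that one of the four intersections of sides is empty.\<close>

locale split_system =
  fixes L :: "'a set" and S :: "'a set set"
  assumes finL: "finite L" and sub: "A \<in> S \<Longrightarrow> A \<subseteq> L" and ne: "A \<in> S \<Longrightarrow> A \<noteq> {}"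
    and compl: "A \<in> S \<Longrightarrow> L - A \<in> S" and single: "a \<in> L \<Longrightarrow> {a} \<in> S"
    and compatible: "A \<in> S \<Longrightarrow> B \<in> S \<Longrightarrow> A \<inter> B = {} \<or> A \<subseteq> B \<or> B \<subseteq> A \<or> A \<union> B = L"
begin

text \<open>Grow a split side inside \<open>A\<close> as far as possible; if it misses \<open>a'\<close>, then the smallest side
  containing it together with \<open>a'\<close> but not all of the complement of \<open>A\<close> lies inside \<open>A\<close> as well.\<close>

lemma split_of_quartets:
  assumes A: "A \<subseteq> L" "A \<noteq> {}" "A \<noteq> L"
    and q: "\<And>a a' b b'. a \<in> A \<Longrightarrow> a' \<in> A \<Longrightarrow> b \<in> L - A \<Longrightarrow> b' \<in> L - A \<Longrightarrow> a \<noteq> a' \<Longrightarrow> b \<noteq> b' \<Longrightarrow>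
      \<exists>K\<in>S. a \<in> K \<and> a' \<in> K \<and> b \<notin> K \<and> b' \<notin> K"
  shows "A \<in> S"
proof (cases "\<exists>b. L - A = {b}")
  case True
  then obtain b where b: "L - A = {b}" by blast
  then have "L - {b} \<in> S" by (intro compl single) auto
  moreover have "L - {b} = A" using A b by auto
  ultimately show ?thesis by simp
next
  case False
  have fin: "finite A" using A(1) finL finite_subset by metis
  obtain a0 where "a0 \<in> A" using A(2) by blast
  then have "{a0} \<in> S \<and> {a0} \<subseteq> A" using single A(1) by blast
  then obtain M where M: "M \<in> S" "M \<subseteq> A" "\<And>K. K \<in> S \<Longrightarrow> K \<subseteq> A \<Longrightarrow> card K \<le> card M"
    using ex_has_greatest_nat[of "\<lambda>K. K \<in> S \<and> K \<subseteq> A" "{a0}" card "card A + 1"] card_mono[OF fin]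
    by (metis less_Suc_eq_le Suc_eq_plus1)
  show ?thesis
  proof (rule ccontr)
    assume "A \<notin> S"
    then have "A \<noteq> M" using M(1) by metis
    then obtain a' where a': "a' \<in> A" "a' \<notin> M" using M(2) by blast
    obtain a where a: "a \<in> M" using ne M(1) by blast
    have aa: "a \<in> A" "a \<noteq> a'" using a a' M(2) by auto
    have grow: "M \<subseteq> K" if K: "K \<in> S" "a \<in> K" "a' \<in> K" "b \<in> L - A" "b \<notin> K" for K b
    proof -
      have "M \<inter> K \<noteq> {}" "\<not> K \<subseteq> M" "M \<union> K \<noteq> L" using a a' K M(2) by auto
      then show ?thesis using compatible[OF M(1) K(1)] by blast
    qed
    define P where "P K \<longleftrightarrow> K \<in> S \<and> a \<in> K \<and> a' \<in> K \<and> (\<exists>b\<in>L - A. b \<notin> K)" for K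
    obtain b where b: "b \<in> L - A" using A by blast
    then obtain b' where "b' \<in> L - A" "b' \<noteq> b" using False by blast
    then obtain K0 where "K0 \<in> S" "a \<in> K0" "a' \<in> K0" "b \<notin> K0"
      using q[of a a' b b'] aa a' b by blast
    then have "P K0" using b unfolding P_def by blast
    then obtain K where K: "P K" "\<And>K'. P K' \<Longrightarrow> card K \<le> card K'"
      using ex_has_least_nat[of P K0 card] by blast
    obtain b2 where b2: "b2 \<in> L - A" "b2 \<notin> K" using K(1) unfolding P_def by blast
    have Kf: "finite K" "M \<subseteq> K" "K \<in> S" "a \<in> K" "a' \<in> K"
      using K(1) grow[of K b2] b2 sub finite_subset[OF _ finL] unfolding P_def by auto
    show False
    proof (cases "K \<subseteq> A")
      case True
      have "card M < card K" using Kf a'(2) by (intro psubset_card_mono) auto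
      then show False using M(3)[OF Kf(3) True] by simp
    next
      case False
      then obtain b1 where b1: "b1 \<in> K" "b1 \<in> L - A" using sub[OF Kf(3)] by blast
      then have "b1 \<noteq> b2" using b2 by auto
      then obtain K' where K': "K' \<in> S" "a \<in> K'" "a' \<in> K'" "b1 \<notin> K'" "b2 \<notin> K'"
        using q[of a a' b1 b2] aa a' b1 b2 by blast
      have "K \<inter> K' \<noteq> {}" "\<not> K \<subseteq> K'" "K \<union> K' \<noteq> L" using K' Kf b1 b2 by auto
      then have "K' \<subset> K" using compatible[OF Kf(3) K'(1)] by blast
      then have "card K' < card K" using Kf(1) by (intro psubset_card_mono)
      moreover have "P K'" using K' b1 unfolding P_def by blast
      ultimately show False using K(2)[of K'] by simp
    qed
  qed
qed

end

text \<open>The edges in \<open>Z\<close> are those that are contracted; \<open>good\<close> edges survive.\<close>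

locale leaf_labeled_tree = bridge_tree V E
  for V :: "'v set" and E :: "'v set set" +
  fixes L :: "'a set" and lb :: "'a \<Rightarrow> 'v" and Z :: "'v set set"
  assumes lab: "bij_betw lb L {v \<in> V. deg v = 1}"
    and deg2: "v \<in> V \<Longrightarrow> deg v \<noteq> 2"
    and card_L: "2 \<le> card L"
    and Z_edges: "Z \<subseteq> E"
    and Z_interior: "e \<in> Z \<Longrightarrow> v \<in> e \<Longrightarrow> deg v \<noteq> 1"
begin

lemma finite_L: "finite L"
  using card_L by (metis card.infinite not_numeral_le_zero)

lemma lb: "a \<in> L \<Longrightarrow> lb a \<in> V" "a \<in> L \<Longrightarrow> deg (lb a) = 1"
  using bij_betwE[OF lab] by auto

lemma lb_inj: "a \<in> L \<Longrightarrow> b \<in> L \<Longrightarrow> lb a = lb b \<longleftrightarrow> a = b"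
  using lab by (auto simp: bij_betw_def inj_on_eq_iff)

lemma leafE:
  assumes "v \<in> V" "deg v = 1"
  obtains a where "a \<in> L" "v = lb a"
  using lab assms by (auto simp: bij_betw_def)

definition good :: "'v set set" where
  "good = E - Z"

lemma goodD: "e \<in> good \<Longrightarrow> e \<in> E"
  by (simp add: good_def)

lemma conn_Z_imp_con: "conn Z u v \<Longrightarrow> e \<in> good \<Longrightarrow> con e u v"
  by (erule conn_mono) (use Z_edges in \<open>auto simp: good_def\<close>)

lemma good_separates:
  assumes "u \<in> V" "v \<in> V" "\<And>e. e \<in> good \<Longrightarrow> con e u v"
  shows "conn Z u v"
  by (rule conn_mono[OF conn_separating_edges[OF assms(1,2)]]) (use assms(3) in \<open>auto simp: good_def\<close>)

lemma deg_pos: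
  assumes "v \<in> V"
  shows "deg v \<noteq> 0"
proof
  assume "deg v = 0"
  then have no: "f \<notin> E" if "v \<in> f" for f
    using that finite_edges by (auto simp: deg_def)
  obtain a b where "a \<in> L" "b \<in> L" "a \<noteq> b"
    using card_L card_le_Suc0_iff_eq[OF finite_L] by fastforce
  then obtain w where w: "w \<in> V" "w \<noteq> v" using lb lb_inj by metis
  have "{} \<notin> E" using edge_pairs by auto
  then have "con {} v w" using connected[OF assms w(1)] by simp
  then have "w = v" by (rule isolated[rotated]) (use no in auto)
  then show False using w by simp
qed

lemma leaf_label_beyond:
  assumes "{v, r} \<in> E"
  shows "\<exists>a\<in>L. \<not> con {v, r} v (lb a)"
  using leaf_beyond[OF assms] leafE by metis

lemma edge_at:
  assumes "e \<in> E" "v \<in> e"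
  obtains r where "e = {v, r}"
proof -
  obtain a b where "e = {a, b}" using edgeE[OF assms(1)] by metis
  then have "e = {v, a} \<or> e = {v, b}" using assms(2) by auto
  then show thesis using that by blast
qed

text \<open>This is where the absence of degree 2 enters: an interior vertex has three branches, and
  one leaf from each gives the required triple. A leaf is the median of itself taken three
  times.\<close>

lemma vertex_is_median:
  assumes v: "v \<in> V"
  shows "\<exists>a\<in>L. \<exists>b\<in>L. \<exists>c\<in>L. \<forall>e\<in>E. majority (lb a) (lb b) (lb c) e v"
proof (cases "deg v = 1")
  case True
  then obtain a where "a \<in> L" "v = lb a" using leafE v by metis
  then show ?thesis by (intro bexI[of _ a]) (simp_all add: majority_def)
next
  case False
  then have "3 \<le> deg v" using deg2[OF v] deg_pos[OF v] by linarith
  then obtain T where T: "T \<subseteq> {e \<in> E. v \<in> e}" "card T = 3"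
    unfolding deg_def by (meson obtain_subset_with_card_n)
  then obtain e1 e2 e3 where e: "T = {e1, e2, e3}" "e1 \<noteq> e2" "e2 \<noteq> e3" "e1 \<noteq> e3"
    by (auto simp: card_3_iff)
  have mem: "e1 \<in> E \<and> v \<in> e1" "e2 \<in> E \<and> v \<in> e2" "e3 \<in> E \<and> v \<in> e3" using T e by auto
  obtain r1 where r1: "e1 = {v, r1}" using edge_at mem(1) by metis
  obtain r2 where r2: "e2 = {v, r2}" using edge_at mem(2) by metis
  obtain r3 where r3: "e3 = {v, r3}" using edge_at mem(3) by metis
  note r = r1 r2 r3
  have E: "{v, r1} \<in> E" "{v, r2} \<in> E" "{v, r3} \<in> E" using T e r by auto
  have n: "r1 \<noteq> r2" "r2 \<noteq> r3" "r1 \<noteq> r3" using e r by auto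
  obtain a b c where abc: "a \<in> L" "\<not> con {v, r1} v (lb a)" "b \<in> L" "\<not> con {v, r2} v (lb b)"
    "c \<in> L" "\<not> con {v, r3} v (lb c)"
    using leaf_label_beyond E by metis
  have "majority (lb a) (lb b) (lb c) f v" if "f \<in> E" for f
  proof -
    have "con f v (lb a) \<or> con f v (lb b)"
      by (rule median_step[OF E(1,2) n(1)]) (use abc lb that in auto)
    moreover have "con f v (lb b) \<or> con f v (lb c)"
      by (rule median_step[OF E(2,3) n(2)]) (use abc lb that in auto)
    moreover have "con f v (lb a) \<or> con f v (lb c)"
      by (rule median_step[OF E(1,3) n(3)]) (use abc lb that in auto)
    ultimately show ?thesis unfolding majority_def by blast
  qed
  then show ?thesis using abc by blast
qed

definition side :: "'v set \<Rightarrow> 'v \<Rightarrow> 'a set" where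
  "side e v = {a \<in> L. con e v (lb a)}"

lemma side_subset: "side e v \<subseteq> L"
  by (auto simp: side_def)

lemma side_cong: "con e u v \<Longrightarrow> side e u = side e v"
  unfolding side_def using conn_trans conn_sym by (metis (no_types, lifting))

text \<open>Write \<open>v\<close> as a median of three leaves. Each of the two sides contains at
  least two of the three labels, so they share one.\<close>

lemma side_inter:
  assumes "e \<in> E" "f \<in> E" "v \<in> V"
  shows "side e v \<inter> side f v \<noteq> {}"
proof -
  obtain a b c where "a \<in> L" "b \<in> L" "c \<in> L" "\<forall>e\<in>E. majority (lb a) (lb b) (lb c) e v"
    using vertex_is_median[OF assms(3)] by blast
  then have "a \<in> side e v \<inter> side f v \<or> b \<in> side e v \<inter> side f v \<or> c \<in> side e v \<inter> side f v"
    using assms(1,2) unfolding side_def majority_def by blast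
  then show ?thesis by blast
qed

lemma side_flip:
  assumes "e \<in> E" "u \<in> V" "v \<in> V" "\<not> con e u v"
  shows "side e v = L - side e u"
proof -
  have "con e v w \<longleftrightarrow> \<not> con e u w" if "w \<in> V" for w
    using sides[OF assms(1,2,3) that assms(4)] assms(4) conn_sym conn_trans by metis
  then show ?thesis using lb(1) by (auto simp: side_def)
qed

lemma side_cases:
  assumes "e \<in> E" "u \<in> V" "v \<in> V"
  shows "side e v = side e u \<or> side e v = L - side e u"
  using side_flip[OF assms] side_cong[of e u v] by blast

text \<open>Let \<open>p\<close> be the end of \<open>e\<close> away from \<open>f\<close> and
  \<open>p'\<close> the end of \<open>f\<close> away from \<open>e\<close>. The sides at
  \<open>p\<close> and \<open>p'\<close> are disjoint and nonempty, and their complements meet, both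
  being sides at \<open>q\<close>. So the two splits cannot agree, even up to complement.\<close>

lemma side_inj:
  assumes "e \<in> E" "f \<in> E" "e \<noteq> f" "v \<in> V"
  shows "side e v \<noteq> side f v"
proof
  assume eq: "side e v = side f v"
  obtain x where x: "x \<in> f" "x \<in> V" using edgeE[OF assms(2)] by (metis insertI1)
  obtain p q where pq: "e = {p, q}" "con e x q"
  proof -
    obtain a b where ab: "e = {a, b}" using edgeE[OF assms(1)] by metis
    then show thesis using that[of a b] that[of b a] two_sides[of a b x] x(2) assms(1)
      by (auto simp: insert_commute)
  qed
  have V: "p \<in> V" "q \<in> V" using edgeD assms(1) pq(1) by auto
  obtain p' q' where pq': "f = {p', q'}" "con f q q'"
  proof -
    obtain a b where ab: "f = {a, b}" using edgeE[OF assms(2)] by metis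
    then show thesis using that[of a b] that[of b a] two_sides[of a b q] V(2) assms(2)
      by (auto simp: insert_commute)
  qed
  have V': "p' \<in> V" "q' \<in> V" using edgeD assms(2) pq'(1) by auto
  have ef: "con f p q" "con e p' q'"
    using other_edge[of p q f] other_edge[of p' q' e] assms(1-3) pq(1) pq'(1) by auto
  have nb: "\<not> con e p q" "\<not> con f p' q'" using bridge pq(1) pq'(1) assms(1,2) by blast+
  have "con e q p'"
  proof -
    have "x = p' \<or> x = q'" using x(1) pq'(1) by auto
    then show ?thesis using pq(2) ef(2) conn_sym conn_trans by metis
  qed
  then have npp': "\<not> con e p p'" using nb(1) conn_sym conn_trans by metis
  have disj: "side e p \<inter> side f p' = {}"
  proof (rule ccontr)
    assume "side e p \<inter> side f p' \<noteq> {}"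
    then obtain a where a: "a \<in> L" "con e p (lb a)" "con f p' (lb a)" by (auto simp: side_def)
    have "\<not> con e (lb a) p'" using a(2) npp' conn_trans by metis
    then have "con f p (lb a)"
      using compat[of e f p' p "lb a"] assms(1-3) pq'(1) V(1) lb(1)[OF a(1)] npp' by blast
    then have "con f p p'" using a(3) conn_sym conn_trans by metis
    then have "con f q' p'" using ef(1) pq'(2) conn_sym conn_trans by metis
    then show False using nb(2) conn_sym by metis
  qed
  have fe: "side e q = L - side e p" "side f q = L - side f p'"
    using side_flip[of e p q] side_flip[of f p' q'] side_cong[OF pq'(2)] assms(1,2) V V' nb by auto
  have ne: "side e p \<noteq> {}" "side f p' \<noteq> {}"
    using side_inter[of e e p] side_inter[of f f p'] assms V V' by auto
  have i: "side e q \<inter> side f q \<noteq> {}" using side_inter assms(1,2) V by blast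
  have "side e v = side e p \<or> side e v = L - side e p" "side f v = side f p' \<or> side f v = L - side f p'"
    using side_cases assms V V' by blast+
  then consider "side e p = side f p'" | "side e p = L - side f p'" | "L - side e p = side f p'"
    | "L - side e p = L - side f p'"
    using eq by metis
  then show False
  proof cases
    case 1
    then show ?thesis using disj ne by simp
  next
    case 2
    then show ?thesis using i unfolding fe by blast
  next
    case 3
    then show ?thesis using i unfolding fe by blast
  next
    case 4
    have "side e p = L - (L - side e p)" using side_subset[of e p] by blast
    also have "\<dots> = side f p'" unfolding 4 using side_subset[of f p'] by blast
    finally show ?thesis using disj ne by simp
  qed
qed

text \<open>The splits of the surviving edges, each directed towards \<open>v\<close>. It depends
  only on the contraction class of \<open>v\<close> and identifies that class.\<close>

definition orient :: "'v \<Rightarrow> 'a set set" where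
  "orient v = (\<lambda>e. side e v) ` good"

definition splits :: "'a set set" where
  "splits = \<Union> (orient ` V)"

lemma splitsE:
  assumes "A \<in> splits"
  obtains e v where "e \<in> good" "v \<in> V" "A = side e v"
  using assms by (auto simp: splits_def orient_def)

lemma splitsI: "e \<in> good \<Longrightarrow> v \<in> V \<Longrightarrow> side e v \<in> splits"
  by (auto simp: splits_def orient_def)

lemma orient_cong: "conn Z u v \<Longrightarrow> orient u = orient v"
  unfolding orient_def by (rule image_cong[OF refl]) (rule side_cong, rule conn_Z_imp_con)

lemma side_notin_orient:
  assumes "e \<in> E" "u \<in> V" "v \<in> V" "\<not> con e u v"
  shows "side e u \<notin> orient v"
proof
  assume "side e u \<in> orient v"
  then obtain f where f: "f \<in> E" "side e u = side f v" by (auto simp: orient_def good_def)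
  then show False using side_flip[OF assms] side_inter[OF assms(1) f(1) assms(3)] by auto
qed

lemma orient_diff:
  assumes "u \<in> V" "v \<in> V"
  shows "orient u - orient v = (\<lambda>e. side e u) ` {e \<in> good. \<not> con e u v}"
proof
  show "orient u - orient v \<subseteq> (\<lambda>e. side e u) ` {e \<in> good. \<not> con e u v}"
    using side_cong by (fastforce simp: orient_def)
  show "(\<lambda>e. side e u) ` {e \<in> good. \<not> con e u v} \<subseteq> orient u - orient v"
    using side_notin_orient[OF _ assms] goodD by (auto simp: orient_def)
qed

lemma orient_eq_iff:
  assumes "u \<in> V" "v \<in> V"
  shows "orient u = orient v \<longleftrightarrow> conn Z u v"
proof
  assume "orient u = orient v"
  then have "{e \<in> good. \<not> con e u v} = {}" using orient_diff[OF assms] by auto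
  then show "conn Z u v" using good_separates[OF assms] by blast
qed (rule orient_cong)

text \<open>Distinct surviving edges have distinct sides, so a one-element difference means that
  just one surviving edge separates \<open>u\<close> from \<open>v\<close>. By compatibility no
  surviving edge separates \<open>u\<close> from its near end or \<open>v\<close> from its far end,
  so these ends lie in the classes of \<open>u\<close> and \<open>v\<close>.\<close>

lemma orient_adjacent_iff:
  assumes u: "u \<in> V" and v: "v \<in> V"
  shows "(\<exists>p q. {p, q} \<in> good \<and> conn Z u p \<and> conn Z v q) \<longleftrightarrow> (\<exists>A. orient u - orient v = {A})"
    (is "?L \<longleftrightarrow> ?R")
proof
  assume ?L
  then obtain p q where pq: "{p, q} \<in> good" "conn Z u p" "conn Z v q" by blast
  let ?e = "{p, q}"
  have "con f u v" if "f \<in> good" "f \<noteq> ?e" for f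
    using other_edge[of p q f] conn_Z_imp_con[OF pq(2) that(1)] conn_Z_imp_con[OF pq(3) that(1)]
      goodD[OF pq(1)] that(2) conn_sym conn_trans by metis
  moreover have "\<not> con ?e u v"
    using bridge[OF goodD[OF pq(1)]] conn_Z_imp_con[OF pq(2,1)] conn_Z_imp_con[OF pq(3,1)]
      conn_sym conn_trans by metis
  ultimately have "{e \<in> good. \<not> con e u v} = {?e}" using pq(1) by blast
  then show ?R using orient_diff[OF u v] by auto
next
  assume ?R
  then obtain A where A: "(\<lambda>e. side e u) ` {e \<in> good. \<not> con e u v} = {A}"
    using orient_diff[OF u v] by auto
  then obtain e where e: "e \<in> good" "\<not> con e u v" by auto
  have only: "con f u v" if "f \<in> good" "f \<noteq> e" for f
  proof (rule ccontr)
    assume "\<not> con f u v"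
    then have "side f u \<in> {A}" "side e u \<in> {A}" using A e that(1) by auto
    then show False using side_inj[of e f u] goodD e(1) that u by auto
  qed
  have eE: "e \<in> E" using e(1) by (rule goodD)
  obtain p q where pq: "e = {p, q}" "con e u p"
  proof -
    obtain a b where ab: "e = {a, b}" using edgeE[OF eE] by metis
    then show thesis using that[of a b] that[of b a] two_sides[of a b u] u eE
      by (auto simp: insert_commute)
  qed
  have V: "p \<in> V" "q \<in> V" using edgeD eE pq(1) by auto
  have "\<not> con e u q" using bridge eE pq conn_sym conn_trans by metis
  then have vq: "con e v q" using sides[OF eE u v V(2) e(2)] by blast
  have fup: "con f u p" "con f v q" if f: "f \<in> good" "f \<noteq> e" for f
  proof -
    obtain x where x: "x \<in> f" "x \<in> V" using edgeE[OF goodD[OF f(1)]] by (metis insertI1)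
    have fpq: "con f p q" using other_edge[of p q f] eE pq(1) f(2) by blast
    have fuv: "con f u v" using only f by blast
    have "con f u p"
    proof (cases "con e u x")
      case True
      then have "\<not> con e q x" "\<not> con e v x"
        using \<open>\<not> con e u q\<close> e(2) conn_sym conn_trans by metis+
      then have "con f q v"
        using compat[OF eE goodD[OF f(1)] f(2)[symmetric] x(1) V(2) v] by blast
      then show ?thesis using fpq fuv conn_sym conn_trans by metis
    next
      case False
      moreover from this have "\<not> con e p x" using pq(2) conn_trans by metis
      ultimately show ?thesis
        using compat[OF eE goodD[OF f(1)] f(2)[symmetric] x(1) u V(1)] by blast
    qed
    then show "con f u p" "con f v q" using fpq fuv conn_sym conn_trans by metis+
  qed
  have "conn Z u p" "conn Z v q"
    using good_separates[OF u V(1)] good_separates[OF v V(2)] fup pq(2) vq by blast+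
  then show ?L using e(1) pq(1) by blast
qed

lemma orient_median:
  assumes "v \<in> V" "a \<in> L" "b \<in> L" "c \<in> L" "\<And>e. e \<in> good \<Longrightarrow> majority (lb a) (lb b) (lb c) e v"
  shows "orient v = split_maj splits a b c"
proof
  show "orient v \<subseteq> split_maj splits a b c"
    using assms splitsI by (fastforce simp: orient_def split_maj_def side_def majority_def)
  show "split_maj splits a b c \<subseteq> orient v"
  proof
    fix A assume A: "A \<in> split_maj splits a b c"
    then obtain e u where e: "e \<in> good" "u \<in> V" "A = side e u"
      by (auto simp: split_maj_def elim: splitsE)
    have "majority (lb a) (lb b) (lb c) e v" by (rule assms(5)[OF e(1)])
    moreover have "majority (lb a) (lb b) (lb c) e u"
      using A e(3) by (auto simp: split_maj_def side_def majority_def)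
    ultimately have "con e u v" unfolding majority_def by (meson conn_sym conn_trans)
    then have "A = side e v" using side_cong e(3) by blast
    then show "A \<in> orient v" using e(1) by (auto simp: orient_def)
  qed
qed

text \<open>The right-hand side mentions the tree only through its splits, so trees with equal
  splits have the same orientations. The inclusions say that each vertex is a median of leaves and
  that medians exist.\<close>

lemma range_orient: "orient ` V = {split_maj splits a b c |a b c. a \<in> L \<and> b \<in> L \<and> c \<in> L}"
proof
  show "orient ` V \<subseteq> {split_maj splits a b c |a b c. a \<in> L \<and> b \<in> L \<and> c \<in> L}"
  proof clarify
    fix v assume v: "v \<in> V"
    then obtain a b c where abc: "a \<in> L" "b \<in> L" "c \<in> L" "\<forall>e\<in>E. majority (lb a) (lb b) (lb c) e v"
      using vertex_is_median by blast
    then have "orient v = split_maj splits a b c"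
      using orient_median[OF v] goodD by blast
    then show "\<exists>a b c. orient v = split_maj splits a b c \<and> a \<in> L \<and> b \<in> L \<and> c \<in> L"
      using abc by blast
  qed
  show "{split_maj splits a b c |a b c. a \<in> L \<and> b \<in> L \<and> c \<in> L} \<subseteq> orient ` V"
  proof clarify
    fix a b c assume abc: "a \<in> L" "b \<in> L" "c \<in> L"
    then obtain v where "v \<in> V" "\<forall>e\<in>E. majority (lb a) (lb b) (lb c) e v"
      using ex_median[of "lb a" "lb b" "lb c"] lb(1) by blast
    then show "split_maj splits a b c \<in> orient ` V"
      using orient_median[of v a b c] abc goodD by (metis imageI)
  qed
qed

lemma orient_leaf: "a \<in> L \<Longrightarrow> orient (lb a) = split_maj splits a a a"
  by (rule orient_median) (auto simp: lb majority_def)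

lemma split_system_splits: "split_system L splits"
proof
  show "finite L" by (rule finite_L)
  show "A \<subseteq> L" if "A \<in> splits" for A using that side_subset by (auto elim: splitsE)
  show "A \<noteq> {}" if A: "A \<in> splits" for A
  proof -
    obtain e v where "e \<in> good" "v \<in> V" "A = side e v" using A by (rule splitsE)
    then show ?thesis using side_inter[of e e v] goodD by simp
  qed
  show "L - A \<in> splits" if A: "A \<in> splits" for A
  proof -
    obtain e v where e: "e \<in> good" "v \<in> V" "A = side e v" using A by (rule splitsE)
    obtain p q where pq: "e = {p, q}" "p \<in> V" "q \<in> V" using edgeE[OF goodD[OF e(1)]] by metis
    have "\<not> con e p q" using bridge pq goodD[OF e(1)] by blast
    then obtain w where "w \<in> V" "\<not> con e v w" using pq conn_sym conn_trans by metis
    then show ?thesis using side_flip[OF goodD[OF e(1)] e(2)] splitsI[OF e(1)] e(3) by metis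
  qed
  show "{a} \<in> splits" if a: "a \<in> L" for a
  proof -
    obtain e where e: "e \<in> E" "lb a \<in> e" "\<And>f. f \<in> E \<Longrightarrow> lb a \<in> f \<Longrightarrow> f = e"
      "\<And>v. con e (lb a) v \<Longrightarrow> v = lb a"
      by (rule leaf_edge[OF lb(2)[OF a]]) (rule that)
    \<comment> \<open>Leaf edges are never contracted, so the trivial splits always survive.\<close>
    have "e \<notin> Z" using Z_interior[of e "lb a"] e(2) lb(2)[OF a] by blast
    then have "e \<in> good" using e(1) by (simp add: good_def)
    moreover have "b = a" if "b \<in> L" "con e (lb a) (lb b)" for b
      using e(4)[OF that(2)] lb_inj[OF that(1) a] by blast
    then have "side e (lb a) = {a}" using a unfolding side_def by auto
    ultimately show ?thesis using splitsI lb(1)[OF a] by metis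
  qed
  show "A \<inter> B = {} \<or> A \<subseteq> B \<or> B \<subseteq> A \<or> A \<union> B = L" if AB: "A \<in> splits" "B \<in> splits" for A B
  proof -
    obtain e u where e: "e \<in> good" "u \<in> V" "A = side e u" using AB(1) by (rule splitsE)
    obtain f v where f: "f \<in> good" "v \<in> V" "B = side f v" using AB(2) by (rule splitsE)
    have EF: "e \<in> E" "f \<in> E" using e f goodD by auto
    obtain x where x: "x \<in> f" "x \<in> V" using edgeE[OF EF(2)] by (metis insertI1)
    show ?thesis
    proof (cases "e = f")
      case True
      then show ?thesis using side_cases[of e u v] e f EF side_subset by blast
    next
      case False
      have far: "con f (lb a) (lb b)" if "a \<in> L" "b \<in> L" "\<not> con e (lb a) x" "\<not> con e (lb b) x" for a b
        using compat[OF EF False x(1)] that lb(1) by blast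
      show ?thesis
      proof (cases "con e u x")
        case True
        then have "\<not> con e (lb a) x" if "a \<in> L - A" for a
          using that conn_trans[of "E - {e}" u x "lb a"] conn_sym[of "E - {e}" "lb a" x]
          by (auto simp: e(3) side_def)
        then have *: "con f (lb a) (lb b)" if "a \<in> L - A" "b \<in> L - A" for a b
          using far that by blast
        have "L - A \<subseteq> B \<or> (L - A) \<inter> B = {}"
        proof (rule ccontr)
          assume "\<not> ?thesis"
          then obtain a b where ab: "a \<in> L - A" "a \<notin> B" "b \<in> L - A" "b \<in> B" by blast
          then have "con f v (lb b)" by (simp add: f(3) side_def)
          then have "con f v (lb a)" by (rule conn_trans[OF _ *[OF ab(3,1)]])
          then show False using ab by (simp add: f(3) side_def)
        qed
        then show ?thesis using e f side_subset by blast
      next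
        case False
        then have "\<not> con e (lb a) x" if "a \<in> A" for a
          using that conn_trans[of "E - {e}" u "lb a" x] by (auto simp: e(3) side_def)
        then have *: "con f (lb a) (lb b)" if "a \<in> A" "b \<in> A" for a b
          using far that e(3) side_subset by blast
        have "A \<subseteq> B \<or> A \<inter> B = {}"
        proof (rule ccontr)
          assume "\<not> ?thesis"
          then obtain a b where ab: "a \<in> A" "a \<notin> B" "b \<in> A" "b \<in> B" by blast
          then have "con f v (lb b)" by (simp add: f(3) side_def)
          then have "con f v (lb a)" by (rule conn_trans[OF _ *[OF ab(3,1)]])
          then show False using ab e(3) by (simp add: f(3) side_def)
        qed
        then show ?thesis by blast
      qed
    qed
  qed
qed

definition quartet :: "'a \<Rightarrow> 'a \<Rightarrow> 'a \<Rightarrow> 'a \<Rightarrow> bool" where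
  "quartet a b c d \<longleftrightarrow>
     (\<exists>e\<in>good. con e (lb a) (lb b) \<and> con e (lb c) (lb d) \<and> \<not> con e (lb a) (lb c))"

lemma quartet_iff_split:
  assumes "a \<in> L" "b \<in> L" "c \<in> L" "d \<in> L"
  shows "quartet a b c d \<longleftrightarrow> (\<exists>A\<in>splits. a \<in> A \<and> b \<in> A \<and> c \<notin> A \<and> d \<notin> A)"
proof
  assume "quartet a b c d"
  then obtain e where e: "e \<in> good" "con e (lb a) (lb b)" "con e (lb c) (lb d)" "\<not> con e (lb a) (lb c)"
    by (auto simp: quartet_def)
  have "\<not> con e (lb a) (lb d)" using e(3,4) conn_sym conn_trans by metis
  then show "\<exists>A\<in>splits. a \<in> A \<and> b \<in> A \<and> c \<notin> A \<and> d \<notin> A"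
    using e assms lb(1) by (intro bexI[of _ "side e (lb a)"] splitsI) (auto simp: side_def)
next
  assume "\<exists>A\<in>splits. a \<in> A \<and> b \<in> A \<and> c \<notin> A \<and> d \<notin> A"
  then obtain e v where e: "e \<in> good" "v \<in> V" "a \<in> side e v" "b \<in> side e v" "c \<notin> side e v" "d \<notin> side e v"
    by (metis splitsE)
  then have c: "con e v (lb a)" "con e v (lb b)" "\<not> con e v (lb c)" "\<not> con e v (lb d)"
    using assms by (auto simp: side_def)
  then have "con e (lb c) (lb d)" using sides[OF goodD[OF e(1)] e(2)] assms lb(1) by blast
  moreover have "con e (lb a) (lb b)" "\<not> con e (lb a) (lb c)"
    using c conn_sym conn_trans by metis+
  ultimately show "quartet a b c d" using e(1) unfolding quartet_def by blast
qed

end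

lemma splits_eq_of_quartets:
  assumes S: "leaf_labeled_tree V E L lb Z" and T: "leaf_labeled_tree V' E' L lb' Z'"
    and q: "\<And>a b c d. {a, b, c, d} \<subseteq> L \<Longrightarrow> distinct [a, b, c, d] \<Longrightarrow>
      leaf_labeled_tree.quartet E lb Z a b c d \<Longrightarrow> leaf_labeled_tree.quartet E' lb' Z' a b c d"
  shows "leaf_labeled_tree.splits V E L lb Z \<subseteq> leaf_labeled_tree.splits V' E' L lb' Z'"
proof
  interpret S: leaf_labeled_tree V E L lb Z by fact
  interpret T: leaf_labeled_tree V' E' L lb' Z' by fact
  interpret SS: split_system L S.splits by (rule S.split_system_splits)
  interpret ST: split_system L T.splits by (rule T.split_system_splits)
  fix A assume A: "A \<in> S.splits"
  show "A \<in> T.splits"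
  proof (rule ST.split_of_quartets)
    show "A \<subseteq> L" "A \<noteq> {}" using A SS.sub SS.ne by auto
    show "A \<noteq> L" using SS.ne[OF SS.compl[OF A]] by auto
    fix a a' b b' assume *: "a \<in> A" "a' \<in> A" "b \<in> L - A" "b' \<in> L - A" "a \<noteq> a'" "b \<noteq> b'"
    have L: "a \<in> L" "a' \<in> L" "b \<in> L" "b' \<in> L" using * A SS.sub by auto
    then have "S.quartet a a' b b'" using S.quartet_iff_split A * by blast
    then have "T.quartet a a' b b'" by (intro q) (use L * in auto)
    then show "\<exists>K\<in>T.splits. a \<in> K \<and> a' \<in> K \<and> b \<notin> K \<and> b' \<notin> K"
      using T.quartet_iff_split L by blast
  qed
qed

section \<open>Vertices, edges and quartets of the contracted tree\<close>

context leaf_labeled_tree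
begin

definition cls :: "'v \<Rightarrow> 'v set" where
  "cls u = {v \<in> V. conn Z u v}"

definition cls_edges :: "'v set set set" where
  "cls_edges = {{cls u, cls v} |u v. {u, v} \<in> good}"

lemma cls_eq_iff:
  assumes "u \<in> V" "v \<in> V"
  shows "cls u = cls v \<longleftrightarrow> conn Z u v"
proof
  assume "cls u = cls v"
  moreover have "v \<in> cls v" using assms by (simp add: cls_def)
  ultimately have "v \<in> cls u" by metis
  then show "conn Z u v" by (simp add: cls_def)
next
  assume uv: "conn Z u v"
  have "conn Z u w \<longleftrightarrow> conn Z v w" for w
    using conn_trans[OF uv] conn_trans[OF conn_sym[OF uv]] by blast
  then show "cls u = cls v" by (simp add: cls_def)
qed

lemma conn_Z_edge_iff:
  assumes "{u, v} \<in> E"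
  shows "conn Z u v \<longleftrightarrow> {u, v} \<notin> good"
  using bridge[OF assms] conn_Z_imp_con[of u v "{u, v}"] conn_edge[of u v Z] assms
  by (auto simp: good_def)

lemma cls_edges_iff:
  assumes "u \<in> V" "v \<in> V"
  shows "{cls u, cls v} \<in> cls_edges \<longleftrightarrow> (\<exists>A. orient u - orient v = {A})"
proof -
  have "{cls u, cls v} \<in> cls_edges \<longleftrightarrow> (\<exists>p q. {p, q} \<in> good \<and> cls u = cls p \<and> cls v = cls q)"
  proof
    assume "{cls u, cls v} \<in> cls_edges"
    then obtain p q where pq: "{p, q} \<in> good" "{cls u, cls v} = {cls p, cls q}"
      by (auto simp: cls_edges_def)
    moreover have "{q, p} \<in> good" using pq(1) by (simp add: insert_commute)
    ultimately show "\<exists>p q. {p, q} \<in> good \<and> cls u = cls p \<and> cls v = cls q"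
      unfolding doubleton_eq_iff by blast
  next
    assume "\<exists>p q. {p, q} \<in> good \<and> cls u = cls p \<and> cls v = cls q"
    then obtain p q where "{p, q} \<in> good" "{cls u, cls v} = {cls p, cls q}" by metis
    then show "{cls u, cls v} \<in> cls_edges" unfolding cls_edges_def mem_Collect_eq by metis
  qed
  also have "\<dots> \<longleftrightarrow> (\<exists>p q. {p, q} \<in> good \<and> conn Z u p \<and> conn Z v q)"
  proof -
    have "cls u = cls p \<and> cls v = cls q \<longleftrightarrow> conn Z u p \<and> conn Z v q" if "{p, q} \<in> good" for p q
      using cls_eq_iff[OF assms(1), of p] cls_eq_iff[OF assms(2), of q] edgeD[OF goodD[OF that]] by blast
    then show ?thesis by meson
  qed
  finally show ?thesis unfolding orient_adjacent_iff[OF assms] .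
qed

text \<open>A contraction class lies entirely on one side of each surviving edge. Walks can
  therefore be projected to the contracted graph and lifted back without crossing the removed
  edge.\<close>

lemma conn_cls_edges_iff:
  assumes e: "{u, v} \<in> good" and V: "x \<in> V" "y \<in> V"
  shows "conn (cls_edges - {{cls u, cls v}}) (cls x) (cls y) \<longleftrightarrow> con {u, v} x y"
proof
  have uv: "u \<in> V" "v \<in> V" using edgeD[OF goodD[OF e]] by blast+
  have cong: "con {u, v} p q" if "cls p = cls q" "p \<in> V" "q \<in> V" for p q
    using that cls_eq_iff conn_Z_imp_con[OF _ e] by metis
  assume "conn (cls_edges - {{cls u, cls v}}) (cls x) (cls y)"
  then have "\<forall>z\<in>V. cls y = cls z \<longrightarrow> con {u, v} x z"
  proof (induction rule: conn_induct)
    case refl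
    then show ?case using cong V(1) by blast
  next
    case (step C D)
    show ?case
    proof (intro ballI impI)
      fix z assume z: "z \<in> V" "D = cls z"
      obtain p q where pq: "{p, q} \<in> good" "{C, D} = {cls p, cls q}"
        using step(2) by (auto simp: cls_edges_def)
      then obtain p q where pq: "{p, q} \<in> good" "C = cls p" "D = cls q"
        by (metis doubleton_eq_iff insert_commute)
      have "{p, q} \<noteq> {u, v}" using step(2) pq by (auto simp: doubleton_eq_iff)
      then have 1: "con {u, v} p q" by (rule other_edge[OF goodD[OF pq(1)]])
      have pV: "p \<in> V" "q \<in> V" using edgeD[OF goodD[OF pq(1)]] by blast+
      have 2: "con {u, v} x p" using step(3) pq(2) pV by blast
      have 3: "con {u, v} q z" using cong[of q z] pq(3) z pV by simp
      show "con {u, v} x z" by (rule conn_trans[OF conn_trans[OF 2 1] 3])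
    qed
  qed
  then show "con {u, v} x y" using V by blast
next
  have uv: "u \<in> V" "v \<in> V" using edgeD[OF goodD[OF e]] by blast+
  assume "con {u, v} x y"
  then show "conn (cls_edges - {{cls u, cls v}}) (cls x) (cls y)"
  proof (induction rule: conn_induct)
    case (step a b)
    have ab: "{a, b} \<in> E" "{a, b} \<noteq> {u, v}" "a \<in> V" "b \<in> V" using step(2) edgeD by auto
    show ?case
    proof (cases "{a, b} \<in> good")
      case False
      then have "cls a = cls b" using conn_Z_edge_iff[OF ab(1)] cls_eq_iff ab by blast
      then show ?thesis using step(3) by simp
    next
      case True
      \<comment> \<open>Contraction does not merge two surviving edges: otherwise a walk through the
        two classes and along \<open>{a, b}\<close> would join \<open>u\<close> to \<open>v\<close>
        without \<open>{u, v}\<close>.\<close>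
      have "{cls a, cls b} \<noteq> {cls u, cls v}"
      proof
        assume eq: "{cls a, cls b} = {cls u, cls v}"
        have ncon: "\<not> con {u, v} u v" using bridge e goodD by blast
        have tab: "con {u, v} a b" using other_edge[OF ab(1,2)] .
        from eq consider "cls a = cls u" "cls b = cls v" | "cls a = cls v" "cls b = cls u"
          by (auto simp: doubleton_eq_iff)
        then show False
        proof cases
          case 1
          then have "conn Z a u" "conn Z b v" using cls_eq_iff ab uv by blast+
          then have "con {u, v} a u" "con {u, v} b v" using conn_Z_imp_con[OF _ e] by blast+
          then show False using ncon conn_trans[OF conn_trans[OF conn_sym tab]] by blast
        next
          case 2
          then have "conn Z a v" "conn Z b u" using cls_eq_iff ab uv by blast+
          then have "con {u, v} a v" "con {u, v} b u" using conn_Z_imp_con[OF _ e] by blast+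
          then show False using ncon conn_trans[OF conn_trans[OF conn_sym conn_sym[OF tab]]] by blast
        qed
      qed
      moreover have "{cls a, cls b} \<in> cls_edges" using True by (auto simp: cls_edges_def)
      ultimately show ?thesis using conn_trans[OF step(3)] by (simp add: conn_edge)
    qed
  qed simp
qed

text \<open>The right-hand side speaks only of the contracted graph, so quartets, although defined
  in the original tree, are invariant under isomorphism of underlying trees.\<close>

lemma quartet_iff_cls:
  assumes "a \<in> L" "b \<in> L" "c \<in> L" "d \<in> L"
  shows "quartet a b c d \<longleftrightarrow> (\<exists>e\<in>cls_edges. conn (cls_edges - {e}) (cls (lb a)) (cls (lb b)) \<and>
    conn (cls_edges - {e}) (cls (lb c)) (cls (lb d)) \<and> \<not> conn (cls_edges - {e}) (cls (lb a)) (cls (lb c)))"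
proof -
  have eq: "(conn (cls_edges - {{cls u, cls v}}) (cls (lb a)) (cls (lb b)) \<and>
      conn (cls_edges - {{cls u, cls v}}) (cls (lb c)) (cls (lb d)) \<and>
      \<not> conn (cls_edges - {{cls u, cls v}}) (cls (lb a)) (cls (lb c))) \<longleftrightarrow>
    con {u, v} (lb a) (lb b) \<and> con {u, v} (lb c) (lb d) \<and> \<not> con {u, v} (lb a) (lb c)"
    if "{u, v} \<in> good" for u v
    using conn_cls_edges_iff[OF that] assms lb(1) by simp
  show ?thesis
  proof
    assume "quartet a b c d"
    then obtain e where e: "e \<in> good" "con e (lb a) (lb b)" "con e (lb c) (lb d)" "\<not> con e (lb a) (lb c)"
      by (auto simp: quartet_def)
    obtain u v where uv: "e = {u, v}" using edgeE[OF goodD[OF e(1)]] by metis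
    have "{cls u, cls v} \<in> cls_edges" using e(1) uv by (auto simp: cls_edges_def)
    then show "\<exists>e\<in>cls_edges. conn (cls_edges - {e}) (cls (lb a)) (cls (lb b)) \<and>
        conn (cls_edges - {e}) (cls (lb c)) (cls (lb d)) \<and> \<not> conn (cls_edges - {e}) (cls (lb a)) (cls (lb c))"
      by (rule bexI[rotated]) (use eq[of u v] e uv in blast)
  next
    assume "\<exists>e\<in>cls_edges. conn (cls_edges - {e}) (cls (lb a)) (cls (lb b)) \<and>
        conn (cls_edges - {e}) (cls (lb c)) (cls (lb d)) \<and> \<not> conn (cls_edges - {e}) (cls (lb a)) (cls (lb c))"
    then obtain e where e: "e \<in> cls_edges" "conn (cls_edges - {e}) (cls (lb a)) (cls (lb b)) \<and>
        conn (cls_edges - {e}) (cls (lb c)) (cls (lb d)) \<and> \<not> conn (cls_edges - {e}) (cls (lb a)) (cls (lb c))"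
      by blast
    then obtain u v where uv: "e = {cls u, cls v}" "{u, v} \<in> good" by (auto simp: cls_edges_def)
    then show "quartet a b c d" using eq[OF uv(2)] e(2) unfolding uv(1) quartet_def by blast
  qed
qed

text \<open>A leaf edge cuts off a single leaf and cannot separate two labels from two others. Hence
  leaf edges are irrelevant to quartets, whatever their lengths.\<close>

lemma quartet_interior:
  assumes "e \<in> E" "a \<in> L" "b \<in> L" "c \<in> L" "d \<in> L" "a \<noteq> b" "c \<noteq> d"
    "con e (lb a) (lb b)" "con e (lb c) (lb d)" "\<not> con e (lb a) (lb c)" "x \<in> e"
  shows "deg x \<noteq> 1"
proof
  assume "deg x = 1"
  then obtain f where f: "x \<in> f" "\<And>g. g \<in> E \<Longrightarrow> x \<in> g \<Longrightarrow> g = f" "\<And>v. con f x v \<Longrightarrow> v = x"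
    by (rule leaf_edge) (rule that)
  have "e = f" using f(2) assms(1,11) by blast
  have x: "x \<in> V" using assms(1,11) edge_pairs by blast
  have ab: "con e x (lb a) \<longleftrightarrow> con e x (lb b)" "con e x (lb c) \<longleftrightarrow> con e x (lb d)"
    "\<not> (con e x (lb a) \<longleftrightarrow> con e x (lb c))"
    using same_side_iff[OF assms(1) x] assms lb(1) by blast+
  then have "lb a = lb b \<or> lb c = lb d" using f(3) \<open>e = f\<close> by metis
  then show False using lb_inj assms by blast
qed

end

definition zero_edges :: "('v, 'a) metric_graph \<Rightarrow> 'v set set" where
  "zero_edges T = {e \<in> edges T. e \<inter> leaves T = {} \<and> len T e = 0}"

lemma labeled_tree_imp_leaf_labeled_tree:
  fixes T :: "('v, 'a) metric_graph"
  assumes "labeled_tree L T" "2 \<le> card L"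
  shows "leaf_labeled_tree (verts T) (edges T) L (lab T) (zero_edges T)"
proof -
  interpret bridge_tree "verts T" "edges T"
    using assms(1) by (intro is_tree_imp_bridge_tree) (simp add: labeled_tree_def)
  have deg: "deg v = degree T v" for v by (simp add: deg_def degree_def)
  show ?thesis
  proof
    show "bij_betw (lab T) L {v \<in> verts T. deg v = 1}"
      using assms(1) by (simp add: labeled_tree_def leaves_def deg)
    show "deg v \<noteq> 2" if "v \<in> verts T" for v using assms(1) that by (simp add: labeled_tree_def deg)
    show "zero_edges T \<subseteq> edges T" by (auto simp: zero_edges_def)
    show "deg v \<noteq> 1" if "e \<in> zero_edges T" "v \<in> e" for e v
      using that edge_pairs by (auto simp: zero_edges_def leaves_def deg)
  qed (rule assms(2))
qed

lemma collapse_iff: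
  fixes T :: "('v, 'a) metric_graph"
  shows "(u, v) \<in> collapse T \<longleftrightarrow> u \<in> verts T \<and> v \<in> verts T \<and> conn (zero_edges T) u v"
proof -
  have "{(u, v). {u, v} \<in> edges T \<and> u \<notin> leaves T \<and> v \<notin> leaves T \<and> len T {u, v} = 0}
      = {(u, v). {u, v} \<in> zero_edges T}"
    by (auto simp: zero_edges_def)
  then show ?thesis unfolding collapse_def conn_def by auto
qed

definition tree_quartet :: "('v, 'a) metric_graph \<Rightarrow> 'a \<Rightarrow> 'a \<Rightarrow> 'a \<Rightarrow> 'a \<Rightarrow> bool" where
  "tree_quartet T = leaf_labeled_tree.quartet (edges T) (lab T) (zero_edges T)"

lemma underlying_tree_eq:
  fixes T :: "('v, 'a) metric_graph"
  assumes "labeled_tree L T" "2 \<le> card L"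
  defines "C \<equiv> leaf_labeled_tree.cls (verts T) (zero_edges T)"
  shows "verts (underlying_tree T) = C ` verts T"
    "edges (underlying_tree T) = leaf_labeled_tree.cls_edges (verts T) (edges T) (zero_edges T)"
    "a \<in> L \<Longrightarrow> lab (underlying_tree T) a = C (lab T a)"
proof -
  interpret leaf_labeled_tree "verts T" "edges T" L "lab T" "zero_edges T"
    by (rule labeled_tree_imp_leaf_labeled_tree[OF assms(1,2)])
  have im: "collapse T `` {u} = C u" if "u \<in> verts T" for u
    using that by (auto simp: collapse_iff C_def cls_def)
  show "verts (underlying_tree T) = C ` verts T"
    using im by (auto simp: underlying_tree_def quotient_def)
  show "lab (underlying_tree T) a = C (lab T a)" if "a \<in> L"
    using im lb(1)[OF that] by (simp add: underlying_tree_def)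
  have "{u, v} \<in> good \<longleftrightarrow> {u, v} \<in> edges T \<and> (u, v) \<notin> collapse T" for u v
    using conn_Z_edge_iff[of u v] edgeD[of u v] goodD[of "{u, v}"] by (auto simp: collapse_iff)
  then have "edges (underlying_tree T) = {{collapse T `` {u}, collapse T `` {v}} |u v. {u, v} \<in> good}"
    by (simp add: underlying_tree_def)
  also have "\<dots> = cls_edges"
    unfolding cls_edges_def using im edgeD goodD unfolding C_def by (metis (no_types, opaque_lifting))
  finally show "edges (underlying_tree T) = cls_edges" .
qed

text \<open>Two labeled trees with the same splits have the same orientations, and these determine the
  vertices and edges of the contracted tree.\<close>

lemma tree_iso_of_splits:
  fixes S :: "('v, 'a) metric_graph" and T :: "('w, 'a) metric_graph"
  assumes S: "labeled_tree L S" and T: "labeled_tree L T" and L: "2 \<le> card L"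
    and eq: "leaf_labeled_tree.splits (verts S) (edges S) L (lab S) (zero_edges S) =
      leaf_labeled_tree.splits (verts T) (edges T) L (lab T) (zero_edges T)"
  shows "tree_iso L (underlying_tree S) (underlying_tree T)"
proof -
  interpret S: leaf_labeled_tree "verts S" "edges S" L "lab S" "zero_edges S"
    by (rule labeled_tree_imp_leaf_labeled_tree[OF S L])
  interpret T: leaf_labeled_tree "verts T" "edges T" L "lab T" "zero_edges T"
    by (rule labeled_tree_imp_leaf_labeled_tree[OF T L])
  have range: "S.orient ` verts S = T.orient ` verts T"
    unfolding S.range_orient T.range_orient eq by (rule refl)
  \<comment> \<open>Vertices are matched by orientation. The choices here and in the map below are
    harmless, because vertices with equal orientation lie in the same class.\<close>
  define g where "g s = (SOME t. t \<in> verts T \<and> T.orient t = S.orient s)" for s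
  have g: "g s \<in> verts T \<and> T.orient (g s) = S.orient s" if "s \<in> verts S" for s
  proof -
    have "\<exists>t. t \<in> verts T \<and> T.orient t = S.orient s"
      using that range by (metis imageE imageI)
    then show ?thesis unfolding g_def by (rule someI_ex)
  qed
  define \<phi> where "\<phi> C = T.cls (g (SOME s. s \<in> C))" for C
  have \<phi>: "\<phi> (S.cls s) = T.cls t" if s: "s \<in> verts S" and t: "t \<in> verts T" "T.orient t = S.orient s" for s t
  proof -
    have "s \<in> S.cls s" using s by (simp add: S.cls_def)
    then have "(SOME s'. s' \<in> S.cls s) \<in> S.cls s" by (rule someI)
    then have s': "(SOME s'. s' \<in> S.cls s) \<in> verts S" "conn (zero_edges S) s (SOME s'. s' \<in> S.cls s)"
      by (auto simp: S.cls_def)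
    then have "T.orient (g (SOME s'. s' \<in> S.cls s)) = T.orient t"
      using g S.orient_cong t(2) by metis
    then have "conn (zero_edges T) (g (SOME s'. s' \<in> S.cls s)) t"
      using T.orient_eq_iff[of "g (SOME s'. s' \<in> S.cls s)" t] g[OF s'(1)] t by blast
    then show ?thesis
      unfolding \<phi>_def using T.cls_eq_iff[of "g (SOME s'. s' \<in> S.cls s)" t] g[OF s'(1)] t by blast
  qed
  have \<phi>g: "\<phi> (S.cls s) = T.cls (g s)" if "s \<in> verts S" for s
    using \<phi>[OF that] g[OF that] by blast
  have cls_orient: "S.cls s = S.cls s' \<longleftrightarrow> S.orient s = S.orient s'" if "s \<in> verts S" "s' \<in> verts S" for s s'
    using S.cls_eq_iff S.orient_eq_iff that by blast
  have cls_orient': "T.cls s = T.cls s' \<longleftrightarrow> T.orient s = T.orient s'" if "s \<in> verts T" "s' \<in> verts T" for s s'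
    using T.cls_eq_iff T.orient_eq_iff that by blast
  note U = underlying_tree_eq[OF S L] underlying_tree_eq[OF T L]
  have "bij_betw \<phi> (verts (underlying_tree S)) (verts (underlying_tree T))"
    unfolding U bij_betw_def
  proof
    show "inj_on \<phi> (S.cls ` verts S)"
    proof (rule inj_onI, clarify)
      fix s s' assume s: "s \<in> verts S" "s' \<in> verts S" and eq: "\<phi> (S.cls s) = \<phi> (S.cls s')"
      then have "T.orient (g s) = T.orient (g s')" using \<phi>g cls_orient' g by metis
      then show "S.cls s = S.cls s'" using g s cls_orient by metis
    qed
    show "\<phi> ` S.cls ` verts S = T.cls ` verts T"
    proof
      show "\<phi> ` S.cls ` verts S \<subseteq> T.cls ` verts T" using \<phi>g g by auto
      show "T.cls ` verts T \<subseteq> \<phi> ` S.cls ` verts S"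
      proof clarify
        fix t assume t: "t \<in> verts T"
        then obtain s where s: "s \<in> verts S" "T.orient t = S.orient s" using range by (metis imageE imageI)
        then show "T.cls t \<in> \<phi> ` S.cls ` verts S" using \<phi>[OF s(1) t s(2)] by (metis imageI)
      qed
    qed
  qed
  moreover have "\<forall>u\<in>verts (underlying_tree S). \<forall>v\<in>verts (underlying_tree S).
      {u, v} \<in> edges (underlying_tree S) \<longleftrightarrow> {\<phi> u, \<phi> v} \<in> edges (underlying_tree T)"
    unfolding U
  proof clarify
    fix s s' assume s: "s \<in> verts S" "s' \<in> verts S"
    show "{S.cls s, S.cls s'} \<in> S.cls_edges \<longleftrightarrow> {\<phi> (S.cls s), \<phi> (S.cls s')} \<in> T.cls_edges"
      unfolding \<phi>g[OF s(1)] \<phi>g[OF s(2)] S.cls_edges_iff[OF s]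
      using T.cls_edges_iff[of "g s" "g s'"] g[OF s(1)] g[OF s(2)] by simp
  qed
  moreover have "\<forall>a\<in>L. \<phi> (lab (underlying_tree S) a) = lab (underlying_tree T) a"
  proof
    fix a assume a: "a \<in> L"
    have "T.orient (lab T a) = S.orient (lab S a)"
      using S.orient_leaf[OF a] T.orient_leaf[OF a] eq by simp
    then show "\<phi> (lab (underlying_tree S) a) = lab (underlying_tree T) a"
      using \<phi> S.lb(1)[OF a] T.lb(1)[OF a] a by (simp add: U)
  qed
  ultimately show ?thesis unfolding tree_iso_def by blast
qed

lemma tree_iso_conn:
  assumes \<phi>: "inj_on \<phi> (verts S)"
    and edges: "\<forall>u\<in>verts S. \<forall>v\<in>verts S. {u, v} \<in> edges S \<longleftrightarrow> {\<phi> u, \<phi> v} \<in> edges T"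
    and S: "\<And>u v. {u, v} \<in> edges S \<Longrightarrow> u \<in> verts S \<and> v \<in> verts S"
    and p: "p \<in> verts S" "q \<in> verts S" and c: "conn (edges S - {{p, q}}) x y"
  shows "conn (edges T - {{\<phi> p, \<phi> q}}) (\<phi> x) (\<phi> y)"
  using c
proof (induction rule: conn_induct)
  case (step a b)
  then have ab: "{a, b} \<in> edges S" "a \<in> verts S" "b \<in> verts S" "{a, b} \<noteq> {p, q}" using S by auto
  have "{\<phi> a, \<phi> b} \<noteq> {\<phi> p, \<phi> q}"
    using ab p \<phi> by (auto simp: doubleton_eq_iff inj_on_eq_iff)
  then have "{\<phi> a, \<phi> b} \<in> edges T - {{\<phi> p, \<phi> q}}" using edges ab by blast
  then show ?case using step(3) conn_trans conn_edge by metis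
qed simp

lemma tree_iso_sym:
  assumes "tree_iso L S T" "\<And>a. a \<in> L \<Longrightarrow> lab S a \<in> verts S"
  shows "tree_iso L T S"
proof -
  obtain \<phi> where \<phi>: "bij_betw \<phi> (verts S) (verts T)"
    "\<forall>u\<in>verts S. \<forall>v\<in>verts S. {u, v} \<in> edges S \<longleftrightarrow> {\<phi> u, \<phi> v} \<in> edges T"
    "\<forall>a\<in>L. \<phi> (lab S a) = lab T a"
    using assms(1) unfolding tree_iso_def by blast
  let ?\<psi> = "inv_into (verts S) \<phi>"
  have inv: "?\<psi> v \<in> verts S \<and> \<phi> (?\<psi> v) = v" if "v \<in> verts T" for v
    using that \<phi>(1) by (metis bij_betw_def f_inv_into_f inv_into_into)
  have "bij_betw ?\<psi> (verts T) (verts S)" using \<phi>(1) by (rule bij_betw_inv_into)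
  moreover have "\<forall>u\<in>verts T. \<forall>v\<in>verts T. {u, v} \<in> edges T \<longleftrightarrow> {?\<psi> u, ?\<psi> v} \<in> edges S"
    using \<phi>(2) inv by metis
  moreover have "\<forall>a\<in>L. ?\<psi> (lab T a) = lab S a"
    using \<phi>(1,3) assms(2) by (metis bij_betw_def inv_into_f_f)
  ultimately show ?thesis unfolding tree_iso_def by blast
qed

lemma tree_quartet_of_iso:
  fixes S :: "('v, 'a) metric_graph" and T :: "('w, 'a) metric_graph"
  assumes S: "labeled_tree L S" and T: "labeled_tree L T" and L: "2 \<le> card L"
    and iso: "tree_iso L (underlying_tree S) (underlying_tree T)"
    and abcd: "a \<in> L" "b \<in> L" "c \<in> L" "d \<in> L"
    and q: "tree_quartet S a b c d"
  shows "tree_quartet T a b c d"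
proof -
  interpret S: leaf_labeled_tree "verts S" "edges S" L "lab S" "zero_edges S"
    by (rule labeled_tree_imp_leaf_labeled_tree[OF S L])
  interpret T: leaf_labeled_tree "verts T" "edges T" L "lab T" "zero_edges T"
    by (rule labeled_tree_imp_leaf_labeled_tree[OF T L])
  note U = underlying_tree_eq[OF S L] underlying_tree_eq[OF T L]
  let ?S = "underlying_tree S" and ?T = "underlying_tree T"
  obtain \<phi> where \<phi>: "bij_betw \<phi> (verts ?S) (verts ?T)"
    "\<forall>u\<in>verts ?S. \<forall>v\<in>verts ?S. {u, v} \<in> edges ?S \<longleftrightarrow> {\<phi> u, \<phi> v} \<in> edges ?T"
    "\<forall>a\<in>L. \<phi> (lab ?S a) = lab ?T a"
    using iso unfolding tree_iso_def by blast
  let ?\<psi> = "inv_into (verts ?S) \<phi>"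
  have inj: "inj_on \<phi> (verts ?S)" "inj_on ?\<psi> (verts ?T)"
    using \<phi>(1) bij_betw_inv_into[OF \<phi>(1)] by (auto simp: bij_betw_def)
  have inv: "?\<psi> v \<in> verts ?S \<and> \<phi> (?\<psi> v) = v" if "v \<in> verts ?T" for v
    using that \<phi>(1) by (metis bij_betw_def f_inv_into_f inv_into_into)
  have inv': "?\<psi> (\<phi> u) = u" if "u \<in> verts ?S" for u
    using inj(1) that by simp
  have edges': "\<forall>u\<in>verts ?T. \<forall>v\<in>verts ?T. {u, v} \<in> edges ?T \<longleftrightarrow> {?\<psi> u, ?\<psi> v} \<in> edges ?S"
    using \<phi>(2) inv by metis
  have edge_verts: "u \<in> verts ?S \<and> v \<in> verts ?S" if uv: "{u, v} \<in> edges ?S" for u v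
  proof -
    obtain p q where "{p, q} \<in> S.good" "{u, v} = {S.cls p, S.cls q}"
      using uv unfolding U S.cls_edges_def by blast
    then show ?thesis using S.edgeD[OF S.goodD] unfolding U by (auto simp: doubleton_eq_iff)
  qed
  have edge_verts': "u \<in> verts ?T \<and> v \<in> verts ?T" if uv: "{u, v} \<in> edges ?T" for u v
  proof -
    obtain p q where "{p, q} \<in> T.good" "{u, v} = {T.cls p, T.cls q}"
      using uv unfolding U T.cls_edges_def by blast
    then show ?thesis using T.edgeD[OF T.goodD] unfolding U by (auto simp: doubleton_eq_iff)
  qed
  have labV: "lab ?S x \<in> verts ?S" if "x \<in> L" for x using U S.lb(1)[OF that] that by auto
  obtain e where e: "e \<in> edges ?S" "conn (edges ?S - {e}) (lab ?S a) (lab ?S b)"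
    "conn (edges ?S - {e}) (lab ?S c) (lab ?S d)" "\<not> conn (edges ?S - {e}) (lab ?S a) (lab ?S c)"
    using q unfolding tree_quartet_def S.quartet_iff_cls[OF abcd] U(1,2) U(3)[OF abcd(1)]
      U(3)[OF abcd(2)] U(3)[OF abcd(3)] U(3)[OF abcd(4)] by blast
  obtain u v where uv: "e = {u, v}" using e(1) unfolding U S.cls_edges_def by blast
  have V: "u \<in> verts ?S" "v \<in> verts ?S" using edge_verts e(1) uv by auto
  have V': "\<phi> u \<in> verts ?T" "\<phi> v \<in> verts ?T" using \<phi>(1) V by (auto simp: bij_betw_def)
  let ?f = "{\<phi> u, \<phi> v}"
  have to: "conn (edges ?T - {?f}) (\<phi> x) (\<phi> y)" if "conn (edges ?S - {e}) x y" for x y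
    using tree_iso_conn[OF inj(1) \<phi>(2) edge_verts V] that uv by simp
  have from': "conn (edges ?S - {e}) x y"
    if "conn (edges ?T - {?f}) (\<phi> x) (\<phi> y)" "x \<in> verts ?S" "y \<in> verts ?S" for x y
    using tree_iso_conn[OF inj(2) edges' edge_verts' V' that(1)] inv' V that(2,3) uv by simp
  have "?f \<in> edges ?T" using \<phi>(2) V e(1) uv by blast
  moreover have "conn (edges ?T - {?f}) (lab ?T a) (lab ?T b)" "conn (edges ?T - {?f}) (lab ?T c) (lab ?T d)"
    using to[OF e(2)] to[OF e(3)] \<phi>(3) abcd by auto
  moreover have "\<not> conn (edges ?T - {?f}) (lab ?T a) (lab ?T c)"
    using from'[of "lab ?S a" "lab ?S c"] e(4) labV \<phi>(3) abcd by auto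
  ultimately show ?thesis
    unfolding tree_quartet_def T.quartet_iff_cls[OF abcd] U(4,5) U(6)[OF abcd(1)]
      U(6)[OF abcd(2)] U(6)[OF abcd(3)] U(6)[OF abcd(4)] by blast
qed

lemma tree_iso_underlying_iff:
  fixes S :: "('v, 'a) metric_graph" and T :: "('w, 'a) metric_graph"
  assumes S: "labeled_tree L S" and T: "labeled_tree L T" and L: "2 \<le> card L"
  shows "tree_iso L (underlying_tree S) (underlying_tree T) \<longleftrightarrow>
    (\<forall>a\<in>L. \<forall>b\<in>L. \<forall>c\<in>L. \<forall>d\<in>L. distinct [a, b, c, d] \<longrightarrow> tree_quartet S a b c d = tree_quartet T a b c d)"
    (is "?iso \<longleftrightarrow> ?q")
proof
  interpret S: leaf_labeled_tree "verts S" "edges S" L "lab S" "zero_edges S"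
    by (rule labeled_tree_imp_leaf_labeled_tree[OF S L])
  assume iso: ?iso
  have "lab (underlying_tree S) a \<in> verts (underlying_tree S)" if "a \<in> L" for a
    using underlying_tree_eq[OF S L] S.lb(1)[OF that] that by auto
  then have "tree_iso L (underlying_tree T) (underlying_tree S)" using iso by (rule tree_iso_sym[rotated])
  then show ?q
    using tree_quartet_of_iso[OF S T L iso] tree_quartet_of_iso[OF T S L] by blast
next
  assume q: ?q
  show ?iso
  proof (rule tree_iso_of_splits[OF S T L], rule subset_antisym)
    show "leaf_labeled_tree.splits (verts S) (edges S) L (lab S) (zero_edges S) \<subseteq>
        leaf_labeled_tree.splits (verts T) (edges T) L (lab T) (zero_edges T)"
      using q by (intro splits_eq_of_quartets labeled_tree_imp_leaf_labeled_tree S T L)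
        (auto simp: tree_quartet_def)
    show "leaf_labeled_tree.splits (verts T) (edges T) L (lab T) (zero_edges T) \<subseteq>
        leaf_labeled_tree.splits (verts S) (edges S) L (lab S) (zero_edges S)"
      using q by (intro splits_eq_of_quartets labeled_tree_imp_leaf_labeled_tree S T L)
        (auto simp: tree_quartet_def)
  qed
qed

section \<open>Tree metrics\<close>

context leaf_labeled_tree
begin

definition dist_sum :: "('v set \<Rightarrow> real) \<Rightarrow> 'a \<Rightarrow> 'a \<Rightarrow> real" where
  "dist_sum l a b = (\<Sum>e\<in>E. if con e (lb a) (lb b) then 0 else l e)"

definition quartet_weight :: "('v set \<Rightarrow> real) \<Rightarrow> 'a \<Rightarrow> 'a \<Rightarrow> 'a \<Rightarrow> 'a \<Rightarrow> real" where
  "quartet_weight l a b c d =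
     (\<Sum>e\<in>E. if con e (lb a) (lb b) \<and> con e (lb c) (lb d) \<and> \<not> con e (lb a) (lb c) then l e else 0)"

text \<open>Edge by edge: one that splits the labels as \<open>a\<close>, \<open>d\<close> against
  \<open>b\<close>, \<open>c\<close> occurs in all four distances and cancels, and so does one that
  isolates a single label. Only the two other quartet splits contribute, twice each.\<close>

lemma dist_sum_quartet:
  assumes "a \<in> L" "b \<in> L" "c \<in> L" "d \<in> L"
  shows "dist_sum l a c + dist_sum l b d - dist_sum l a b - dist_sum l c d =
    2 * (quartet_weight l a b c d - quartet_weight l a c b d)"
proof -
  have "(if con e (lb a) (lb c) then 0 else l e) + (if con e (lb b) (lb d) then 0 else l e)
      - (if con e (lb a) (lb b) then 0 else l e) - (if con e (lb c) (lb d) then 0 else l e) =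
    2 * ((if con e (lb a) (lb b) \<and> con e (lb c) (lb d) \<and> \<not> con e (lb a) (lb c) then l e else 0) -
      (if con e (lb a) (lb c) \<and> con e (lb b) (lb d) \<and> \<not> con e (lb a) (lb b) then l e else 0))"
    if e: "e \<in> E" for e
  proof -
    have "con e (lb b) (lb d) = (con e (lb a) (lb b) \<longleftrightarrow> con e (lb a) (lb d))"
      "con e (lb c) (lb d) = (con e (lb a) (lb c) \<longleftrightarrow> con e (lb a) (lb d))"
      using same_side_iff[OF e] lb(1) assms by blast+
    then show ?thesis by simp
  qed
  then have "(\<Sum>e\<in>E. (if con e (lb a) (lb c) then 0 else l e) + (if con e (lb b) (lb d) then 0 else l e)
      - (if con e (lb a) (lb b) then 0 else l e) - (if con e (lb c) (lb d) then 0 else l e)) =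
    (\<Sum>e\<in>E. 2 * ((if con e (lb a) (lb b) \<and> con e (lb c) (lb d) \<and> \<not> con e (lb a) (lb c) then l e else 0) -
      (if con e (lb a) (lb c) \<and> con e (lb b) (lb d) \<and> \<not> con e (lb a) (lb b) then l e else 0)))"
    by (rule sum.cong[OF refl])
  then show ?thesis
    unfolding dist_sum_def quartet_weight_def
    by (simp only: sum.distrib sum_subtractf sum_distrib_left[symmetric])
qed

lemma dist_sum_commute: "dist_sum l a b = dist_sum l b a"
  unfolding dist_sum_def by (rule sum.cong[OF refl]) (simp add: conn_commute)

text \<open>The two splits would have four nonempty intersections of sides, contrary to
  compatibility.\<close>

lemma quartet_exclusive:
  assumes "e \<in> E" "f \<in> E" "a \<in> L" "b \<in> L" "c \<in> L" "d \<in> L"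
    "con e (lb a) (lb b) \<and> con e (lb c) (lb d) \<and> \<not> con e (lb a) (lb c)"
    "con f (lb a) (lb c) \<and> con f (lb b) (lb d) \<and> \<not> con f (lb a) (lb b)"
  shows False
proof -
  have ne: "e \<noteq> f" using assms by auto
  obtain x where x: "x \<in> f" "x \<in> V" using edgeE[OF assms(2)] by (metis insertI1)
  note s = same_side_iff[OF assms(1) lb(1)[OF assms(3)]] and t = same_side_iff[OF assms(2) lb(1)[OF assms(3)]]
  note V = lb(1)[OF assms(3)] lb(1)[OF assms(4)] lb(1)[OF assms(5)] lb(1)[OF assms(6)]
  note c = compat[OF assms(1,2) ne x(1)]
  show False
  proof (cases "con e (lb a) x")
    case True
    have "\<not> con e (lb c) x" "\<not> con e (lb d) x"
      using s[OF V(3) x(2)] s[OF V(4) x(2)] s[OF V(3,4)] assms(7) True by blast+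
    then have "con f (lb c) (lb d)" using c[OF V(3,4)] by blast
    then show False using t[OF V(3,4)] t[OF V(2,4)] assms(8) by blast
  next
    case False
    have "\<not> con e (lb b) x" using s[OF V(2) x(2)] assms(7) False by blast
    then have "con f (lb a) (lb b)" using c[OF V(1,2)] False by blast
    then show False using assms(8) by blast
  qed
qed

lemma quartet_weight_exclusive:
  assumes "a \<in> L" "b \<in> L" "c \<in> L" "d \<in> L"
  shows "quartet_weight l a b c d = 0 \<or> quartet_weight l a c b d = 0"
proof (rule ccontr)
  assume neg: "\<not> ?thesis"
  have ex: "\<exists>e\<in>E. con e (lb a) (lb b) \<and> con e (lb c) (lb d) \<and> \<not> con e (lb a) (lb c)"
    if "quartet_weight l a b c d \<noteq> 0" for a b c d
  proof (rule ccontr)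
    assume "\<not> ?thesis"
    then have "quartet_weight l a b c d = 0"
      unfolding quartet_weight_def by (intro sum.neutral) auto
    then show False using that by simp
  qed
  show False using ex[of a b c d] ex[of a c b d] neg quartet_exclusive[OF _ _ assms] by blast
qed

lemma quartet_weight_swap:
  assumes "a \<in> L" "b \<in> L" "c \<in> L" "d \<in> L"
  shows "quartet_weight l a b d c = quartet_weight l a b c d"
  unfolding quartet_weight_def
proof (rule sum.cong[OF refl])
  fix e assume e: "e \<in> E"
  have "con e (lb c) (lb d) = (con e (lb a) (lb c) \<longleftrightarrow> con e (lb a) (lb d))"
    using same_side_iff[OF e] lb(1) assms by blast
  moreover have "con e (lb d) (lb c) = con e (lb c) (lb d)" by (rule conn_commute)
  ultimately show "(if con e (lb a) (lb b) \<and> con e (lb d) (lb c) \<and> \<not> con e (lb a) (lb d) then l e else 0) =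
      (if con e (lb a) (lb b) \<and> con e (lb c) (lb d) \<and> \<not> con e (lb a) (lb c) then l e else 0)" by auto
qed

end

lemma leaf_metric_eq_dist_sum:
  fixes T :: "('v, 'a) metric_graph"
  assumes "labeled_tree L T" "2 \<le> card L" "a \<in> L" "b \<in> L"
  shows "leaf_metric T a b = leaf_labeled_tree.dist_sum (edges T) (lab T) (len T) a b"
proof -
  interpret leaf_labeled_tree "verts T" "edges T" L "lab T" "zero_edges T"
    by (rule labeled_tree_imp_leaf_labeled_tree[OF assms(1,2)])
  have V: "lab T a \<in> verts T" "lab T b \<in> verts T" using lb(1) assms by auto
  obtain p where p: "joins (edges T) (lab T a) p (lab T b)" using conn_imp_joins connected V by metis
  then have "(THE p. joins (edges T) (lab T a) p (lab T b)) = p"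
    using joins_unique V(1) by (intro the_equality) blast+
  then show ?thesis
    unfolding leaf_metric_def dist_sum_def using path_length[OF p V(1)] by simp
qed

text \<open>Edges displaying a quartet are interior, so for them positive length and surviving
  contraction coincide. As lengths are nonnegative, nothing cancels in the sum.\<close>

lemma quartet_weight_metric:
  fixes T :: "('v, 'a) metric_graph"
  assumes T: "metric_tree L T" and L: "2 \<le> card L"
    and abcd: "a \<in> L" "b \<in> L" "c \<in> L" "d \<in> L" "a \<noteq> b" "c \<noteq> d"
  shows "0 \<le> leaf_labeled_tree.quartet_weight (edges T) (lab T) (len T) a b c d"
    "leaf_labeled_tree.quartet_weight (edges T) (lab T) (len T) a b c d = 0 \<longleftrightarrow> \<not> tree_quartet T a b c d"
proof -
  have lt: "labeled_tree L T" and nonneg: "\<And>e. e \<in> edges T \<Longrightarrow> 0 \<le> len T e"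
    using T by (auto simp: metric_tree_def)
  interpret leaf_labeled_tree "verts T" "edges T" L "lab T" "zero_edges T"
    by (rule labeled_tree_imp_leaf_labeled_tree[OF lt L])
  let ?q = "\<lambda>e. con e (lab T a) (lab T b) \<and> con e (lab T c) (lab T d) \<and> \<not> con e (lab T a) (lab T c)"
  show "0 \<le> quartet_weight (len T) a b c d"
    unfolding quartet_weight_def using nonneg by (intro sum_nonneg) auto
  have "quartet_weight (len T) a b c d = 0 \<longleftrightarrow> (\<forall>e\<in>edges T. ?q e \<longrightarrow> len T e = 0)"
    unfolding quartet_weight_def using nonneg
    by (subst sum_nonneg_eq_0_iff[OF finite_edges]) (auto split: if_splits)
  also have "\<dots> \<longleftrightarrow> \<not> (\<exists>e\<in>good. ?q e)"
  proof -
    have "e \<in> good \<longleftrightarrow> len T e \<noteq> 0" if e: "e \<in> edges T" "?q e" for e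
    proof -
      have "e \<inter> leaves T = {}"
        using quartet_interior[OF e(1) abcd] e(2) by (auto simp: leaves_def deg_def degree_def)
      moreover have "e \<in> good \<longleftrightarrow> e \<notin> zero_edges T" using e(1) by (simp add: good_def)
      ultimately show ?thesis using e(1) by (simp add: zero_edges_def)
    qed
    then show ?thesis using goodD by blast
  qed
  also have "\<dots> \<longleftrightarrow> \<not> tree_quartet T a b c d" by (simp add: tree_quartet_def quartet_def)
  finally show "quartet_weight (len T) a b c d = 0 \<longleftrightarrow> \<not> tree_quartet T a b c d" .
qed

lemma leaf_metric_commute:
  fixes T :: "('v, 'a) metric_graph"
  assumes "metric_tree L T" "2 \<le> card L" "a \<in> L" "b \<in> L"
  shows "leaf_metric T a b = leaf_metric T b a"
proof -
  have lt: "labeled_tree L T" using assms(1) by (simp add: metric_tree_def)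
  interpret leaf_labeled_tree "verts T" "edges T" L "lab T" "zero_edges T"
    by (rule labeled_tree_imp_leaf_labeled_tree[OF lt assms(2)])
  show ?thesis using leaf_metric_eq_dist_sum[OF lt assms(2)] assms(3,4) dist_sum_commute by simp
qed

text \<open>At most one of the three quartet weights is nonzero, and the sums of distances differ by
  twice the difference of two such weights. So a displayed quartet has the strictly smallest sum,
  and the other two sums agree.\<close>

lemma leaf_metric_four_points:
  fixes T :: "('v, 'a) metric_graph"
  assumes T: "metric_tree L T" and L: "2 \<le> card L"
    and abcd: "a \<in> L" "b \<in> L" "c \<in> L" "d \<in> L" "distinct [a, b, c, d]"
  shows "leaf_metric T a b + leaf_metric T c d \<le>
      max (leaf_metric T a c + leaf_metric T b d) (leaf_metric T a d + leaf_metric T b c)"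
    "max (leaf_metric T a c + leaf_metric T b d) (leaf_metric T a d + leaf_metric T b c) \<le>
      leaf_metric T a b + leaf_metric T c d \<longleftrightarrow> \<not> tree_quartet T a b c d"
proof -
  have lt: "labeled_tree L T" using T by (simp add: metric_tree_def)
  interpret leaf_labeled_tree "verts T" "edges T" L "lab T" "zero_edges T"
    by (rule labeled_tree_imp_leaf_labeled_tree[OF lt L])
  let ?Q = "quartet_weight (len T)"
  note V = abcd(1-4)
  have m: "leaf_metric T x y = dist_sum (len T) x y" if "x \<in> L" "y \<in> L" for x y
    using leaf_metric_eq_dist_sum[OF lt L that] .
  have 1: "leaf_metric T a c + leaf_metric T b d - leaf_metric T a b - leaf_metric T c d =
      2 * (?Q a b c d - ?Q a c b d)"
    using dist_sum_quartet[OF V] m V by simp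
  have "leaf_metric T a d + leaf_metric T b c - leaf_metric T a b - leaf_metric T d c =
      2 * (?Q a b d c - ?Q a d b c)"
    using dist_sum_quartet[OF V(1,2,4,3)] m V by simp
  then have 2: "leaf_metric T a d + leaf_metric T b c - leaf_metric T a b - leaf_metric T c d =
      2 * (?Q a b c d - ?Q a d b c)"
    using quartet_weight_swap[OF V] leaf_metric_commute[OF T L V(3,4)] by simp
  have nn: "0 \<le> ?Q a b c d" "0 \<le> ?Q a c b d" "0 \<le> ?Q a d b c"
    using quartet_weight_metric(1)[OF T L] V abcd(5) by auto
  have ex: "?Q a b c d = 0 \<or> ?Q a c b d = 0" "?Q a b c d = 0 \<or> ?Q a d b c = 0"
    "?Q a c b d = 0 \<or> ?Q a d b c = 0"
    using quartet_weight_exclusive[OF V] quartet_weight_exclusive[OF V(1,2,4,3)]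
      quartet_weight_exclusive[OF V(1,3,4,2)] quartet_weight_swap[OF V] quartet_weight_swap[OF V(1,4,2,3)]
      quartet_weight_swap[OF V(1,3,2,4)] by metis+
  have q: "?Q a b c d = 0 \<longleftrightarrow> \<not> tree_quartet T a b c d"
    using quartet_weight_metric(2)[OF T L V] abcd(5) by auto
  have le: "u \<le> v" if "v - u = 2 * (x - y)" "y = 0" "0 \<le> x" for u v x y :: real
    using that by simp
  have iff: "v \<le> u \<and> v' \<le> u \<longleftrightarrow> x = 0"
    if "v - u = 2 * (x - y)" "v' - u = 2 * (x - z)" "0 \<le> x" "0 \<le> y" "0 \<le> z" "x = 0 \<or> y = 0"
    for u v v' x y z :: real
    using that by auto
  let ?ab = "leaf_metric T a b + leaf_metric T c d"
  have 3: "leaf_metric T a c + leaf_metric T b d - ?ab = 2 * (?Q a b c d - ?Q a c b d)"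
    "leaf_metric T a d + leaf_metric T b c - ?ab = 2 * (?Q a b c d - ?Q a d b c)"
    using 1 2 by simp_all
  show "?ab \<le> max (leaf_metric T a c + leaf_metric T b d) (leaf_metric T a d + leaf_metric T b c)"
    using le[OF 3(1) _ nn(1)] le[OF 3(2) _ nn(1)] ex(3) by (auto simp: le_max_iff_disj)
  show "max (leaf_metric T a c + leaf_metric T b d) (leaf_metric T a d + leaf_metric T b c) \<le> ?ab \<longleftrightarrow>
      \<not> tree_quartet T a b c d"
    unfolding q[symmetric] max.bounded_iff by (rule iff[OF 3 nn ex(1)])
qed

section \<open>Distances between vertices and points on a path\<close>

context bridge_tree
begin

definition vdist :: "('v set \<Rightarrow> real) \<Rightarrow> 'v \<Rightarrow> 'v \<Rightarrow> real" where
  "vdist l u v = (\<Sum>e\<in>E. if con e u v then 0 else l e)"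

lemma vdist_commute: "vdist l u v = vdist l v u"
  unfolding vdist_def by (rule sum.cong[OF refl]) (simp add: conn_commute)

lemma vdist_refl [simp]: "vdist l u u = 0"
  by (simp add: vdist_def)

lemma vdist_between:
  assumes V: "m \<in> V" "a \<in> V" "b \<in> V" and on: "\<And>f. f \<in> E \<Longrightarrow> con f m a \<or> con f m b"
  shows "vdist l a m + vdist l b m = vdist l a b"
  unfolding vdist_def sum.distrib[symmetric]
proof (rule sum.cong[OF refl])
  fix f assume f: "f \<in> E"
  have "con f a b = (con f m a \<longleftrightarrow> con f m b)" "con f a m = con f m a" "con f b m = con f m b"
    using same_side_iff[OF f V] by (simp_all add: conn_commute[of _ _ m])
  then show "(if con f a m then 0 else l f) + (if con f b m then 0 else l f) = (if con f a b then 0 else l f)"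
    using on[OF f] by auto
qed

text \<open>An edge cutting \<open>m\<close> off from \<open>a\<close> and \<open>c\<close> and one cutting it off from \<open>b\<close> and \<open>c\<close> cannot coexist
  when \<open>m\<close> lies between \<open>a\<close> and \<open>b\<close>, so one of the two lower bounds for the distance is sharp.\<close>

lemma vdist_from_path:
  assumes V: "m \<in> V" "a \<in> V" "b \<in> V" "c \<in> V" and on: "\<And>f. f \<in> E \<Longrightarrow> con f m a \<or> con f m b"
    and l: "\<And>f. f \<in> E \<Longrightarrow> 0 \<le> l f"
  shows "vdist l c m = max (vdist l a c - vdist l a m) (vdist l b c - vdist l b m)"
proof -
  define X where "X z = (\<Sum>f\<in>E. if \<not> con f m z \<and> \<not> con f m c then l f else 0)" for z
  have eq: "vdist l c m = vdist l z c - vdist l z m + 2 * X z" if z: "z \<in> V" for z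
  proof -
    have "(if con f c m then 0 else l f) = (if con f z c then 0 else l f) - (if con f z m then 0 else l f)
        + 2 * (if \<not> con f m z \<and> \<not> con f m c then l f else 0)" if f: "f \<in> E" for f
    proof -
      have "con f z c = (con f m z \<longleftrightarrow> con f m c)" "con f c m = con f m c" "con f z m = con f m z"
        using same_side_iff[OF f V(1) z V(4)] by (simp_all add: conn_commute[of _ _ m])
      then show ?thesis by auto
    qed
    then have "vdist l c m = (\<Sum>f\<in>E. (if con f z c then 0 else l f) - (if con f z m then 0 else l f)
        + 2 * (if \<not> con f m z \<and> \<not> con f m c then l f else 0))"
      unfolding vdist_def by (rule sum.cong[OF refl])
    then show ?thesis
      unfolding vdist_def X_def by (simp only: sum.distrib sum_subtractf sum_distrib_left[symmetric])
  qed
  have nn: "0 \<le> X z" for z unfolding X_def using l by (intro sum_nonneg) auto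
  have "X a = 0 \<or> X b = 0"
  proof (rule ccontr)
    assume neg: "\<not> ?thesis"
    have ex: "\<exists>f\<in>E. \<not> con f m z \<and> \<not> con f m c" if "X z \<noteq> 0" for z
    proof (rule ccontr)
      assume "\<not> ?thesis"
      then have "X z = 0" unfolding X_def by (intro sum.neutral) auto
      then show False using that by simp
    qed
    obtain f where f: "f \<in> E" "\<not> con f m a" "\<not> con f m c" using ex neg by blast
    obtain g where g: "g \<in> E" "\<not> con g m b" "\<not> con g m c" using ex neg by blast
    have ga: "con g m a" and fb: "con f m b" using on[OF g(1)] on[OF f(1)] f g by auto
    have ne: "f \<noteq> g" using f ga by auto
    obtain x where x: "x \<in> g" "x \<in> V" using edgeE[OF g(1)] by (metis insertI1)
    show False
    proof (cases "con f m x")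
      case True
      then have "\<not> con f a x" "\<not> con f c x"
        using same_side_iff[OF f(1) V(1)] V x f by blast+
      then have "con g a c" using compat[OF f(1) g(1) ne x(1) V(2,4)] by blast
      then show False using ga g(3) conn_trans by metis
    next
      case False
      then have "\<not> con f b x" using same_side_iff[OF f(1) V(1)] V x fb by blast
      then have "con g m b" using compat[OF f(1) g(1) ne x(1) V(1,3)] False by blast
      then show False using g(2) by blast
    qed
  qed
  then show ?thesis using eq[OF V(2)] eq[OF V(3)] nn[of a] nn[of b] by (auto simp: max_def)
qed

lemma edge_con_iff: "{u, v} \<in> E \<Longrightarrow> g \<in> E \<Longrightarrow> con g u v \<longleftrightarrow> {u, v} \<noteq> g"
  using bridge[of u v] other_edge[of u v g] by auto

end

lemma simple_path_prefix: "simple_path E (p @ q) \<Longrightarrow> p \<noteq> [] \<Longrightarrow> simple_path E p"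
  unfolding simple_path_def
proof (elim conjE, intro conjI allI impI)
  fix i
  assume "\<forall>i. Suc i < length (p @ q) \<longrightarrow> {(p @ q) ! i, (p @ q) ! Suc i} \<in> E" "Suc i < length p"
  then show "{p ! i, p ! Suc i} \<in> E"
    by (metis Suc_lessD length_append nth_append trans_less_add1)
qed simp_all

text \<open>A discrete intermediate value argument: the cumulative length runs from 0 to the full
  length, so some edge of the path carries \<open>s\<close>. That edge is where a new leaf will be
  attached.\<close>

lemma path_split_at:
  fixes l :: "'v set \<Rightarrow> real"
  defines "plen \<equiv> \<lambda>p. sum_list (map2 (\<lambda>u v. l {u, v}) p (tl p))"
  assumes "2 \<le> length p" "0 \<le> s" "s \<le> plen p"
  shows "\<exists>xs u v ys. p = xs @ u # v # ys \<and> plen (xs @ [u]) \<le> s \<and> s \<le> plen (xs @ [u]) + l {u, v}"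
  using assms(2-)
proof (induction p arbitrary: s rule: induct_list012)
  case (3 a x p)
  show ?case
  proof (cases "s \<le> l {a, x}")
    case True
    then show ?thesis using 3 by (intro exI[of _ "[]"] exI[of _ a] exI[of _ x] exI[of _ p]) (simp add: plen_def)
  next
    case False
    have "plen (a # x # p) = l {a, x} + plen (x # p)" by (simp add: plen_def)
    then have s: "0 \<le> s - l {a, x}" "s - l {a, x} \<le> plen (x # p)" using False 3(5) by auto
    have "2 \<le> length (x # p)"
    proof (rule ccontr)
      assume "\<not> 2 \<le> length (x # p)"
      then have "p = []" by (cases p) auto
      then show False using s False by (simp add: plen_def)
    qed
    then obtain xs u v ys where IH: "x # p = xs @ u # v # ys" "plen (xs @ [u]) \<le> s - l {a, x}"
      "s - l {a, x} \<le> plen (xs @ [u]) + l {u, v}"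
      using 3(2) s by blast
    have "plen (a # xs @ [u]) = l {a, x} + plen (xs @ [u])"
      using IH(1) by (cases xs) (auto simp: plen_def)
    then show ?thesis using IH by (intro exI[of _ "a # xs"] exI[of _ u] exI[of _ v] exI[of _ ys]) auto
  qed
qed auto

context bridge_tree
begin

lemma locate_edge:
  assumes V: "a \<in> V" "b \<in> V" "a \<noteq> b" and s: "0 \<le> s" "s \<le> vdist l a b"
  obtains p q where "{p, q} \<in> E" "con {p, q} a p" "\<not> con {p, q} a b"
    "vdist l a p \<le> s" "s \<le> vdist l a p + l {p, q}"
proof -
  obtain P where P: "joins E a P b" using conn_imp_joins connected V by metis
  have "P \<noteq> []" using P by (simp add: joins_def simple_path_def)
  moreover have "P \<noteq> [a]"
  proof
    assume "P = [a]"
    then show False using P V(3) by (simp add: joins_def)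
  qed
  moreover have "hd P = a" using P by (simp add: joins_def)
  ultimately have "2 \<le> length P" by (cases P rule: remdups_adj.cases) auto
  then obtain xs u v ys where x: "P = xs @ u # v # ys"
    "sum_list (map2 (\<lambda>u v. l {u, v}) (xs @ [u]) (tl (xs @ [u]))) \<le> s"
    "s \<le> sum_list (map2 (\<lambda>u v. l {u, v}) (xs @ [u]) (tl (xs @ [u]))) + l {u, v}"
    using path_split_at[of P s l] s path_length[OF P V(1), of l] by (auto simp: vdist_def)
  have sp: "simple_path E P" "last P = b" using P by (auto simp: joins_def)
  have suf: "simple_path E (u # v # ys)" using sp x(1) simple_path_suffix[of E xs] by simp
  have pre: "simple_path E (xs @ [u])" using sp(1) x(1) simple_path_prefix[of E "xs @ [u]" "v # ys"] by simp
  have hd: "hd (xs @ [u]) = a" using \<open>hd P = a\<close> x(1) by (cases xs) auto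
  then have j: "joins E a (xs @ [u]) u" using pre by (simp add: joins_def)
  have e: "{u, v} \<in> E" using suf by (simp add: simple_path_Cons)
  have "v \<notin> set (xs @ [u])" using sp(1) x(1) by (auto simp: simple_path_def)
  have "simple_path (E - {{u, v}}) (xs @ [u])"
    unfolding simple_path_def
  proof (intro conjI allI impI)
    fix i assume i: "Suc i < length (xs @ [u])"
    then have "(xs @ [u]) ! i \<in> set (xs @ [u])" "(xs @ [u]) ! Suc i \<in> set (xs @ [u])"
      by (intro nth_mem; simp)+
    then have "{(xs @ [u]) ! i, (xs @ [u]) ! Suc i} \<noteq> {u, v}"
      using \<open>v \<notin> set (xs @ [u])\<close> by (metis doubleton_eq_iff)
    then show "{(xs @ [u]) ! i, (xs @ [u]) ! Suc i} \<in> E - {{u, v}}"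
      using i pre unfolding simple_path_def by blast
  qed (use pre in \<open>simp_all add: simple_path_def\<close>)
  then have au: "con {u, v} a u" using simple_path_imp_conn[of _ "xs @ [u]"] hd by simp
  have "last (v # ys) = b" using sp(2) x(1) by simp
  then have "\<not> con {u, v} u b" using simple_path_avoids(2)[OF suf] by simp
  then have "\<not> con {u, v} a b" using conn_trans[OF conn_sym[OF au]] by blast
  moreover have "vdist l a u = sum_list (map2 (\<lambda>u v. l {u, v}) (xs @ [u]) (tl (xs @ [u])))"
    using path_length[OF j V(1), of l] by (simp add: vdist_def)
  ultimately show thesis using that[OF e au] x(2,3) by simp
qed

end

text \<open>\<open>side\<close> is a certificate: for each edge \<open>g\<close> a two-colouring
  that changes across \<open>g\<close> and across no other edge. Walks avoiding \<open>g\<close>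
  keep their colour, so \<open>g\<close> is a bridge and the colour classes are its sides.\<close>

lemma bridge_tree_of_sides:
  fixes side :: "'v set \<Rightarrow> 'v \<Rightarrow> bool"
  assumes "finite V" "V \<noteq> {}" "E \<subseteq> {{u, v} |u v. u \<in> V \<and> v \<in> V \<and> u \<noteq> v}"
    and conn: "\<And>u v. u \<in> V \<Longrightarrow> v \<in> V \<Longrightarrow> conn E u v"
    and side: "\<And>g u v. g \<in> E \<Longrightarrow> {u, v} \<in> E \<Longrightarrow> side g u = side g v \<longleftrightarrow> {u, v} \<noteq> g"
  shows "bridge_tree V E"
    "\<And>g u v. g \<in> E \<Longrightarrow> u \<in> V \<Longrightarrow> v \<in> V \<Longrightarrow> conn (E - {g}) u v \<longleftrightarrow> side g u = side g v"
proof -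
  have same: "side g u = side g v" if "g \<in> E" "conn (E - {g}) u v" for g u v
    using that(2)
  proof (induction rule: conn_induct)
    case (step a b)
    then show ?case using side[OF that(1), of a b] by auto
  qed simp
  show tree: "bridge_tree V E"
  proof
    show "\<not> conn (E - {{p, q}}) p q" if "{p, q} \<in> E" for p q
      using same[OF that, of p q] side[OF that that] by blast
  qed (use assms in auto)
  interpret bridge_tree V E by (rule tree)
  fix g u v assume g: "g \<in> E" and V: "u \<in> V" "v \<in> V"
  show "con g u v \<longleftrightarrow> side g u = side g v"
  proof
    assume eq: "side g u = side g v"
    show "con g u v"
    proof (rule ccontr)
      assume "\<not> con g u v"
      obtain p q where pq: "g = {p, q}" "p \<in> V" "q \<in> V" using edgeE[OF g] by metis
      have E: "{p, q} \<in> E" using g pq by simp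
      have tr: "con g u v" if "con g u x" "con g v x" for x
        by (rule conn_trans[OF that(1) conn_sym[OF that(2)]])
      have "con g u p \<or> con g u q" "con g v p \<or> con g v q"
        using two_sides[OF E V(1)] two_sides[OF E V(2)] pq(1) by simp_all
      moreover have "\<not> (con g u p \<and> con g v p)" "\<not> (con g u q \<and> con g v q)"
        using \<open>\<not> con g u v\<close> tr by blast+
      ultimately have "side g u = side g p \<and> side g v = side g q \<or> side g u = side g q \<and> side g v = side g p"
        using same[OF g] by blast
      then show False using eq side[OF g E] pq(1) by auto
    qed
  qed (rule same[OF g])
qed

text \<open>Subdividing the edge \<open>{p, q}\<close> by a new vertex \<open>m\<close> and attaching a new leaf \<open>y\<close> to it.\<close>

locale edge_insertion = bridge_tree V E
  for V :: "'v set" and E :: "'v set set" +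
  fixes p q m y :: 'v
  assumes pq: "{p, q} \<in> E" and fresh: "m \<notin> V" "y \<notin> V" "m \<noteq> y"
begin

definition newV :: "'v set" where "newV = insert m (insert y V)"

definition newE :: "'v set set" where
  "newE = insert {p, m} (insert {m, q} (insert {m, y} (E - {{p, q}})))"

text \<open>One side of each edge of the new tree, written out explicitly: that of \<open>y\<close>,
  the one away from \<open>p\<close>, that of \<open>q\<close>, and for the remaining old edges that
  of \<open>p\<close>. Removing such an old edge leaves \<open>p\<close>, \<open>m\<close>,
  \<open>y\<close> and \<open>q\<close> together.\<close>

definition side :: "'v set \<Rightarrow> 'v \<Rightarrow> bool" where
  "side g u \<longleftrightarrow> (if g = {m, y} then u = y
     else if g = {p, m} then u = m \<or> u = y \<or> con {p, q} q u
     else if g = {m, q} then u \<noteq> m \<and> u \<noteq> y \<and> con {p, q} q u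
     else u = m \<or> u = y \<or> con g p u)"

lemma V: "p \<in> V" "q \<in> V" "p \<noteq> q"
  using edgeD[OF pq] by auto

lemma distinct_new: "p \<noteq> m" "q \<noteq> m" "p \<noteq> y" "q \<noteq> y" "{p, m} \<noteq> {m, q}" "{p, m} \<noteq> {m, y}" "{m, q} \<noteq> {m, y}"
  using V fresh by (auto simp: doubleton_eq_iff)

lemma old_edge: "f \<in> E \<Longrightarrow> f \<noteq> {p, m} \<and> f \<noteq> {m, q} \<and> f \<noteq> {m, y}"
  using edge_pairs fresh by (auto simp: doubleton_eq_iff)

lemma side_simps:
  "side {m, y} u \<longleftrightarrow> u = y"
  "side {p, m} u \<longleftrightarrow> u = m \<or> u = y \<or> con {p, q} q u"
  "side {m, q} u \<longleftrightarrow> u \<noteq> m \<and> u \<noteq> y \<and> con {p, q} q u"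
  "f \<in> E \<Longrightarrow> side f u \<longleftrightarrow> u = m \<or> u = y \<or> con f p u"
  unfolding side_def using distinct_new old_edge[of f] by simp_all

lemma newE_cases:
  assumes "g \<in> newE"
  obtains "g = {p, m}" | "g = {m, q}" | "g = {m, y}" | "g \<in> E" "g \<noteq> {p, q}"
  using assms unfolding newE_def by blast

lemma side_adjacent_old:
  assumes g: "g \<in> newE" and uv: "{u, v} \<in> E" "{u, v} \<noteq> {p, q}"
  shows "side g u = side g v \<longleftrightarrow> {u, v} \<noteq> g"
proof -
  have UV: "u \<in> V" "v \<in> V" using edgeD uv by auto
  have new: "u \<noteq> m" "u \<noteq> y" "v \<noteq> m" "v \<noteq> y" using UV fresh by auto
  have e: "con {p, q} q u = con {p, q} q v"
    using same_side_iff[OF pq V(2) UV] edge_con_iff[OF uv(1) pq] uv(2) by blast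
  from g show ?thesis
  proof (cases rule: newE_cases)
    case 4
    then show ?thesis
      using same_side_iff[OF 4(1) V(1) UV] edge_con_iff[OF uv(1) 4(1)] new by (simp add: side_simps)
  qed (use old_edge[OF uv(1)] new e in \<open>simp_all add: side_simps\<close>)
qed

lemma side_adjacent_new:
  assumes g: "g \<in> newE"
  shows "side g p = side g m \<longleftrightarrow> {p, m} \<noteq> g" "side g m = side g q \<longleftrightarrow> {m, q} \<noteq> g"
    "side g m = side g y \<longleftrightarrow> {m, y} \<noteq> g"
proof -
  note d = distinct_new V(3) fresh(3) distinct_new(5-7)[symmetric]
  have npq: "\<not> con {p, q} q p" using bridge[OF pq] conn_sym by metis
  have *: "(side g p = side g m \<longleftrightarrow> {p, m} \<noteq> g) \<and> (side g m = side g q \<longleftrightarrow> {m, q} \<noteq> g) \<and>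
      (side g m = side g y \<longleftrightarrow> {m, y} \<noteq> g)"
    using g
  proof (cases rule: newE_cases)
    case 1
    show ?thesis unfolding 1 using d npq by (simp add: side_simps)
  next
    case 2
    show ?thesis unfolding 2 using d npq by (simp add: side_simps)
  next
    case 3
    show ?thesis unfolding 3 using d by (simp add: side_simps)
  next
    case 4
    have "con g p q" using edge_con_iff[OF pq 4(1)] 4(2) by auto
    moreover have "{p, m} \<noteq> g" "{m, q} \<noteq> g" "{m, y} \<noteq> g" using old_edge[OF 4(1)] by auto
    ultimately show ?thesis by (simp add: side_simps(4)[OF 4(1)])
  qed
  then show "side g p = side g m \<longleftrightarrow> {p, m} \<noteq> g" "side g m = side g q \<longleftrightarrow> {m, q} \<noteq> g"
    "side g m = side g y \<longleftrightarrow> {m, y} \<noteq> g" by blast+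
qed

lemma side_adjacent:
  assumes g: "g \<in> newE" and uv: "{u, v} \<in> newE"
  shows "side g u = side g v \<longleftrightarrow> {u, v} \<noteq> g"
  using uv
proof (cases rule: newE_cases)
  case 1
  then have "u = p \<and> v = m \<or> u = m \<and> v = p" by (auto simp: doubleton_eq_iff)
  then show ?thesis using side_adjacent_new(1)[OF g] by (auto simp: insert_commute)
next
  case 2
  then have "u = m \<and> v = q \<or> u = q \<and> v = m" by (auto simp: doubleton_eq_iff)
  then show ?thesis using side_adjacent_new(2)[OF g] by (auto simp: insert_commute)
next
  case 3
  then have "u = m \<and> v = y \<or> u = y \<and> v = m" by (auto simp: doubleton_eq_iff)
  then show ?thesis using side_adjacent_new(3)[OF g] by (auto simp: insert_commute)
next
  case 4
  then show ?thesis using side_adjacent_old[OF g] by blast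
qed

lemma conn_new: "u \<in> newV \<Longrightarrow> conn newE p u"
proof -
  have pm: "conn newE p m" and mq: "conn newE m q" and my: "conn newE m y"
    by (auto intro!: conn_edge simp: newE_def)
  have old: "conn newE p u" if "u \<in> V" for u
    using connected[OF V(1) that]
  proof (induction rule: conn_induct)
    case (step a b)
    show ?case
    proof (cases "{a, b} = {p, q}")
      case True
      then have "b = p \<or> b = q" by (auto simp: doubleton_eq_iff)
      then show ?thesis using conn_trans[OF pm mq] by auto
    next
      case False
      then have "{a, b} \<in> newE" using step(2) by (simp add: newE_def)
      then show ?thesis by (rule conn_trans[OF step(3) conn_edge])
    qed
  qed simp
  show "u \<in> newV \<Longrightarrow> conn newE p u"
    using old pm conn_trans[OF pm my] by (auto simp: newV_def)
qed

lemma new_bridge_tree: "bridge_tree newV newE"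
  and new_con_iff: "g \<in> newE \<Longrightarrow> u \<in> newV \<Longrightarrow> v \<in> newV \<Longrightarrow> conn (newE - {g}) u v \<longleftrightarrow> side g u = side g v"
proof -
  have 1: "finite newV" "newV \<noteq> {}" by (auto simp: newV_def fin)
  have 2: "newE \<subseteq> {{u, v} |u v. u \<in> newV \<and> v \<in> newV \<and> u \<noteq> v}"
  proof
    have pair: "{u, v} \<in> {{u, v} |u v. u \<in> newV \<and> v \<in> newV \<and> u \<noteq> v}"
      if "u \<in> newV" "v \<in> newV" "u \<noteq> v" for u v
      using that by blast
    have N: "p \<in> newV" "q \<in> newV" "m \<in> newV" "y \<in> newV" using V by (auto simp: newV_def)
    fix g assume "g \<in> newE"
    then show "g \<in> {{u, v} |u v. u \<in> newV \<and> v \<in> newV \<and> u \<noteq> v}"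
    proof (cases rule: newE_cases)
      case 1
      show ?thesis unfolding 1 by (rule pair[OF N(1,3) distinct_new(1)])
    next
      case 2
      show ?thesis unfolding 2 by (rule pair[OF N(3,2) distinct_new(2)[symmetric]])
    next
      case 3
      show ?thesis unfolding 3 by (rule pair[OF N(3,4) fresh(3)])
    next
      case 4
      obtain a b where ab: "g = {a, b}" "a \<in> V" "b \<in> V" "a \<noteq> b" using edgeE[OF 4(1)] by metis
      then show ?thesis unfolding ab(1) by (intro pair) (auto simp: newV_def)
    qed
  qed
  have 3: "conn newE u v" if "u \<in> newV" "v \<in> newV" for u v
    using conn_trans[OF conn_sym[OF conn_new[OF that(1)]] conn_new[OF that(2)]] .
  note bt = bridge_tree_of_sides[of newV newE side, OF 1 2 3 side_adjacent]
  show "bridge_tree newV newE" by (rule bt(1))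
  show "g \<in> newE \<Longrightarrow> u \<in> newV \<Longrightarrow> v \<in> newV \<Longrightarrow> conn (newE - {g}) u v \<longleftrightarrow> side g u = side g v"
    by (rule bt(2))
qed

sublocale new: bridge_tree newV newE
  by (rule new_bridge_tree)

text \<open>At \<open>p\<close> and \<open>q\<close> the old edge is traded for a new one, and
  \<open>m\<close> has degree 3. So no vertex of degree 2 arises and \<open>y\<close> is the only
  new leaf.\<close>

lemma new_deg:
  "v \<in> V \<Longrightarrow> new.deg v = deg v" "new.deg m = 3" "new.deg y = 1"
proof -
  have finE: "finite {e \<in> E. v \<in> e}" for v using finite_edges by simp
  have VE: "f \<in> E \<Longrightarrow> f \<subseteq> V" for f using edge_pairs by auto
  have swap: "card (insert x (A - {d})) = card A" if "finite A" "d \<in> A" "x \<notin> A" for A :: "'v set set" and d x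
    using that card.remove[OF that(1,2)] by simp
  have gen1: "{g \<in> insert a (insert b (insert c (S - {d}))). v \<in> g} = insert a ({e \<in> S. v \<in> e} - {d})"
    if "v \<in> a" "v \<notin> b" "v \<notin> c" for a b c d :: "'v set" and S v
    using that by blast
  have gen2: "{g \<in> insert a (insert b (insert c (S - {d}))). v \<in> g} = insert b ({e \<in> S. v \<in> e} - {d})"
    if "v \<notin> a" "v \<in> b" "v \<notin> c" for a b c d :: "'v set" and S v
    using that by blast
  have gen3: "{g \<in> insert a (insert b (insert c (S - {d}))). v \<in> g} = {e \<in> S. v \<in> e}"
    if "v \<notin> a" "v \<notin> b" "v \<notin> c" "v \<notin> d" for a b c d :: "'v set" and S v
    using that by blast
  have gen4: "{g \<in> insert a (insert b (insert c (S - {d}))). v \<in> g} = {a, b, c}"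
    if "v \<in> a" "v \<in> b" "v \<in> c" "\<And>e. e \<in> S \<Longrightarrow> v \<notin> e" for a b c d :: "'v set" and S v
    using that by blast
  have gen5: "{g \<in> insert a (insert b (insert c (S - {d}))). v \<in> g} = {c}"
    if "v \<notin> a" "v \<notin> b" "v \<in> c" "\<And>e. e \<in> S \<Longrightarrow> v \<notin> e" for a b c d :: "'v set" and S v
    using that by blast
  show "new.deg v = deg v" if v: "v \<in> V"
  proof -
    have vm: "v \<noteq> m" "v \<noteq> y" using v fresh by auto
    consider "v = p" | "v = q" | "v \<noteq> p" "v \<noteq> q" by blast
    then show ?thesis
    proof cases
      case 1
      have "{g \<in> newE. v \<in> g} = insert {p, m} ({e \<in> E. v \<in> e} - {{p, q}})"
        unfolding newE_def by (rule gen1) (use 1 distinct_new V in auto)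
      moreover have "{p, m} \<notin> E" using old_edge by blast
      moreover have "{p, q} \<in> {e \<in> E. v \<in> e}" using pq 1 by simp
      ultimately show ?thesis
        unfolding new.deg_def deg_def using swap[OF finE[of v]] by simp
    next
      case 2
      have "{g \<in> newE. v \<in> g} = insert {m, q} ({e \<in> E. v \<in> e} - {{p, q}})"
        unfolding newE_def by (rule gen2) (use 2 distinct_new V in auto)
      moreover have "{m, q} \<notin> E" using old_edge by blast
      moreover have "{p, q} \<in> {e \<in> E. v \<in> e}" using pq 2 by simp
      ultimately show ?thesis
        unfolding new.deg_def deg_def using swap[OF finE[of v]] by simp
    next
      case 3
      have "{g \<in> newE. v \<in> g} = {e \<in> E. v \<in> e}"
        unfolding newE_def by (rule gen3) (use 3 vm in auto)
      then show ?thesis by (simp add: new.deg_def deg_def)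
    qed
  qed
  have "{g \<in> newE. m \<in> g} = {{p, m}, {m, q}, {m, y}}"
    unfolding newE_def by (rule gen4) (use VE fresh in auto)
  then show "new.deg m = 3" using distinct_new by (simp add: new.deg_def)
  have "{g \<in> newE. y \<in> g} = {{m, y}}"
    unfolding newE_def by (rule gen5) (use VE fresh distinct_new in auto)
  then show "new.deg y = 1" by (simp add: new.deg_def)
qed

text \<open>\<open>r\<close> locates \<open>m\<close> on the old edge as seen from \<open>p\<close>,
  and \<open>t\<close> is the length of the new leaf edge. Attachment at an existing vertex is
  covered by a part of length zero.\<close>

definition new_len :: "('v set \<Rightarrow> real) \<Rightarrow> real \<Rightarrow> real \<Rightarrow> 'v set \<Rightarrow> real" where
  "new_len l r t f = (if f = {p, m} then r else if f = {m, q} then l {p, q} - r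
     else if f = {m, y} then t else l f)"

lemma new_len_simps:
  "new_len l r t {p, m} = r" "new_len l r t {m, q} = l {p, q} - r" "new_len l r t {m, y} = t"
  "f \<in> E \<Longrightarrow> new_len l r t f = l f"
  unfolding new_len_def using distinct_new old_edge[of f] by simp_all

lemma new_vdist:
  assumes "u \<in> newV" "v \<in> newV"
  shows "new.vdist (new_len l r t) u v =
    (if side {p, m} u = side {p, m} v then 0 else r) + (if side {m, q} u = side {m, q} v then 0 else l {p, q} - r)
    + (if (u = y) = (v = y) then 0 else t) + (\<Sum>f\<in>E - {{p, q}}. if side f u = side f v then 0 else l f)"
proof -
  have notin: "{m, y} \<notin> E - {{p, q}}" "{m, q} \<notin> insert {m, y} (E - {{p, q}})"
    "{p, m} \<notin> insert {m, q} (insert {m, y} (E - {{p, q}}))"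
    using old_edge distinct_new by auto
  have "new.vdist (new_len l r t) u v = (\<Sum>g\<in>newE. if side g u = side g v then 0 else new_len l r t g)"
    unfolding new.vdist_def using new_con_iff assms by (intro sum.cong) auto
  also have "\<dots> = (if side {p, m} u = side {p, m} v then 0 else r)
    + (if side {m, q} u = side {m, q} v then 0 else l {p, q} - r)
    + (if side {m, y} u = side {m, y} v then 0 else t)
    + (\<Sum>f\<in>E - {{p, q}}. if side f u = side f v then 0 else new_len l r t f)"
    unfolding newE_def using notin finite_edges by (simp add: new_len_simps)
  also have "(\<Sum>f\<in>E - {{p, q}}. if side f u = side f v then 0 else new_len l r t f)
      = (\<Sum>f\<in>E - {{p, q}}. if side f u = side f v then 0 else l f)"
    by (rule sum.cong) (auto simp: new_len_simps)
  finally show ?thesis by (simp add: side_simps(1))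
qed

lemma vdist_split:
  "vdist l u v = (if con {p, q} u v then 0 else l {p, q}) + (\<Sum>f\<in>E - {{p, q}}. if con f u v then 0 else l f)"
  unfolding vdist_def by (rule sum.remove[OF finite_edges pq])

lemma new_vdist_old:
  assumes "u \<in> V" "v \<in> V"
  shows "new.vdist (new_len l r t) u v = vdist l u v"
proof -
  have n: "u \<noteq> m" "u \<noteq> y" "v \<noteq> m" "v \<noteq> y" using assms fresh by auto
  have s: "(side f u = side f v) = con f u v" if "f \<in> E" for f
    using same_side_iff[OF that V(1) assms] n by (simp add: side_simps that)
  have e: "(side {p, m} u = side {p, m} v) = con {p, q} u v" "(side {m, q} u = side {m, q} v) = con {p, q} u v"
    using same_side_iff[OF pq V(2) assms] n by (simp_all add: side_simps)
  have "(\<Sum>f\<in>E - {{p, q}}. if side f u = side f v then 0 else l f)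
      = (\<Sum>f\<in>E - {{p, q}}. if con f u v then 0 else l f)"
    using s by (intro sum.cong) auto
  moreover have "u \<in> newV" "v \<in> newV" using assms by (auto simp: newV_def)
  ultimately show ?thesis unfolding new_vdist[OF \<open>u \<in> newV\<close> \<open>v \<in> newV\<close>] vdist_split e using n by simp
qed

lemma new_vdist_leaf:
  assumes "u \<in> V"
  shows "new.vdist (new_len l r t) u y = new.vdist (new_len l r t) u m + t"
proof -
  have n: "u \<noteq> m" "u \<noteq> y" using assms fresh by auto
  have N: "u \<in> newV" "m \<in> newV" "y \<in> newV" using assms by (auto simp: newV_def)
  have "(\<Sum>f\<in>E - {{p, q}}. if side f u = side f y then 0 else l f)
      = (\<Sum>f\<in>E - {{p, q}}. if side f u = side f m then 0 else l f)"
    by (rule sum.cong) (auto simp: side_simps(4))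
  then show ?thesis
    unfolding new_vdist[OF N(1,3)] new_vdist[OF N(1,2)] using n fresh(3) by (simp add: side_simps)
qed

lemma new_vdist_near:
  assumes "u \<in> V" "con {p, q} u p"
  shows "new.vdist (new_len l r t) u m = vdist l u p + r"
proof -
  have n: "u \<noteq> m" "u \<noteq> y" using assms fresh by auto
  have N: "u \<in> newV" "m \<in> newV" using assms by (auto simp: newV_def)
  have "\<not> con {p, q} q u" using bridge[OF pq] assms(2) conn_sym conn_trans by metis
  then have s: "\<not> side {p, m} u" "\<not> side {m, q} u" "side {p, m} m" "\<not> side {m, q} m"
    using n by (auto simp: side_simps)
  have "(\<Sum>f\<in>E - {{p, q}}. if side f u = side f m then 0 else l f)
      = (\<Sum>f\<in>E - {{p, q}}. if con f u p then 0 else l f)"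
    by (rule sum.cong) (auto simp: side_simps(4) n conn_commute[of _ p])
  then show ?thesis
    unfolding new_vdist[OF N] vdist_split using s n fresh(3) assms(2) by simp
qed

lemma new_between:
  assumes ab: "a \<in> V" "b \<in> V" "con {p, q} a p" "\<not> con {p, q} a b" and g: "g \<in> newE"
  shows "new.con g m a \<or> new.con g m b"
proof -
  have n: "a \<noteq> m" "a \<noteq> y" "b \<noteq> m" "b \<noteq> y" using ab fresh by auto
  have N: "a \<in> newV" "b \<in> newV" "m \<in> newV" using ab by (auto simp: newV_def)
  have bp: "\<not> con {p, q} b p" using ab(3,4) conn_sym conn_trans by metis
  then have qb: "con {p, q} q b" using two_sides[OF pq ab(2)] conn_sym by metis
  have qa: "\<not> con {p, q} q a" using bridge[OF pq] ab(3) conn_sym conn_trans by metis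
  from g have "side g m = side g a \<or> side g m = side g b"
  proof (cases rule: newE_cases)
    case 4
    have "con g p a \<or> con g p b"
    proof (rule ccontr)
      assume "\<not> ?thesis"
      then have "con {p, q} a b"
        using compat[OF 4(1) pq 4(2) _ ab(1,2), of p] conn_commute[of _ p] by auto
      then show False using ab(4) by simp
    qed
    then show ?thesis using side_simps(4)[OF 4(1)] by blast
  qed (use n qa qb fresh(3) in \<open>simp_all add: side_simps\<close>)
  then show ?thesis using new_con_iff g N by blast
qed

end

text \<open>Distinct labels may have distance zero. The four-point condition is required only for
  distinct labels, so the triangle inequality, usually its degenerate case, is a separate
  clause.\<close>

definition tree_metric_on :: "'a set \<Rightarrow> ('a \<Rightarrow> 'a \<Rightarrow> real) \<Rightarrow> bool" where
  "tree_metric_on L \<delta> \<longleftrightarrow>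
     (\<forall>a\<in>L. \<forall>b\<in>L. \<delta> a b = \<delta> b a \<and> 0 \<le> \<delta> a b) \<and>
     (\<forall>a\<in>L. \<forall>b\<in>L. \<forall>c\<in>L. distinct [a, b, c] \<longrightarrow> \<delta> a b \<le> \<delta> a c + \<delta> c b) \<and>
     (\<forall>a\<in>L. \<forall>b\<in>L. \<forall>c\<in>L. \<forall>d\<in>L. distinct [a, b, c, d] \<longrightarrow>
        \<delta> a b + \<delta> c d \<le> max (\<delta> a c + \<delta> b d) (\<delta> a d + \<delta> b c))"

lemma tree_metric_onD:
  assumes "tree_metric_on L \<delta>"
  shows "a \<in> L \<Longrightarrow> b \<in> L \<Longrightarrow> \<delta> a b = \<delta> b a" "a \<in> L \<Longrightarrow> b \<in> L \<Longrightarrow> 0 \<le> \<delta> a b"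
    "a \<in> L \<Longrightarrow> b \<in> L \<Longrightarrow> c \<in> L \<Longrightarrow> distinct [a, b, c] \<Longrightarrow> \<delta> a b \<le> \<delta> a c + \<delta> c b"
    "a \<in> L \<Longrightarrow> b \<in> L \<Longrightarrow> c \<in> L \<Longrightarrow> d \<in> L \<Longrightarrow> distinct [a, b, c, d] \<Longrightarrow>
      \<delta> a b + \<delta> c d \<le> max (\<delta> a c + \<delta> b d) (\<delta> a d + \<delta> b c)"
  using assms unfolding tree_metric_on_def by blast+

lemma tree_metric_on_subset: "tree_metric_on L \<delta> \<Longrightarrow> L' \<subseteq> L \<Longrightarrow> tree_metric_on L' \<delta>"
  unfolding tree_metric_on_def by (meson subsetD)

lemma leaf_metric_eq_vdist:
  fixes T :: "('v, 'a) metric_graph"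
  assumes "labeled_tree L T" "2 \<le> card L" "a \<in> L" "b \<in> L"
  shows "leaf_metric T a b = bridge_tree.vdist (edges T) (len T) (lab T a) (lab T b)"
proof -
  interpret leaf_labeled_tree "verts T" "edges T" L "lab T" "zero_edges T"
    by (rule labeled_tree_imp_leaf_labeled_tree[OF assms(1,2)])
  show ?thesis
    using leaf_metric_eq_dist_sum[OF assms] by (simp add: dist_sum_def vdist_def)
qed

text \<open>The point at distance \<open>s\<close> from \<open>a\<close> on the path to
  \<open>b\<close> becomes the vertex \<open>m\<close>, from which \<open>x\<close> hangs by an edge
  of length \<open>t\<close>. The maximum is the distance from \<open>m\<close> to \<open>c\<close>
  given by \<open>vdist_from_path\<close>.\<close>

lemma insert_leaf:
  fixes T :: "(nat, 'a) metric_graph"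
  assumes T: "metric_tree L T" and L: "2 \<le> card L" and x: "x \<notin> L"
    and ab: "a \<in> L" "b \<in> L" "a \<noteq> b" and s: "0 \<le> s" "s \<le> leaf_metric T a b" and t: "0 \<le> t"
  shows "\<exists>T' :: (nat, 'a) metric_graph. metric_tree (insert x L) T' \<and>
    (\<forall>c\<in>L. \<forall>d\<in>L. leaf_metric T' c d = leaf_metric T c d) \<and>
    (\<forall>c\<in>L. leaf_metric T' c x = t + max (leaf_metric T a c - s) (leaf_metric T b c - (leaf_metric T a b - s)) \<and>
      leaf_metric T' x c = leaf_metric T' c x)"
proof -
  have lt: "labeled_tree L T" and nonneg: "\<And>e. e \<in> edges T \<Longrightarrow> 0 \<le> len T e"
    using T by (auto simp: metric_tree_def)
  interpret T: leaf_labeled_tree "verts T" "edges T" L "lab T" "zero_edges T"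
    by (rule labeled_tree_imp_leaf_labeled_tree[OF lt L])
  have lmT: "leaf_metric T c d = T.vdist (len T) (lab T c) (lab T d)" if "c \<in> L" "d \<in> L" for c d
    by (rule leaf_metric_eq_vdist[OF lt L that])
  have V: "lab T a \<in> verts T" "lab T b \<in> verts T" "lab T a \<noteq> lab T b" using T.lb T.lb_inj ab by auto
  obtain p q where pq: "{p, q} \<in> edges T" "T.con {p, q} (lab T a) p" "\<not> T.con {p, q} (lab T a) (lab T b)"
    "T.vdist (len T) (lab T a) p \<le> s" "s \<le> T.vdist (len T) (lab T a) p + len T {p, q}"
    using T.locate_edge[OF V s(1)] s(2) lmT[OF ab(1,2)] by metis
  define m where "m = Suc (Max (verts T))"
  have m: "v < m" if "v \<in> verts T" for v
    using that T.fin by (simp add: m_def le_imp_less_Suc)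
  define y where "y = Suc m"
  have fresh: "m \<notin> verts T" "y \<notin> verts T" "m \<noteq> y"
    using m by (auto simp: y_def dest: less_not_refl2 Suc_lessD)
  interpret I: edge_insertion "verts T" "edges T" p q m y
    by standard (use pq(1) fresh in auto)
  define r where "r = s - T.vdist (len T) (lab T a) p"
  have r: "0 \<le> r" "r \<le> len T {p, q}" using pq(4,5) by (auto simp: r_def)
  define l where "l = I.new_len (len T) r t"
  define T' :: "(nat, 'a) metric_graph" where
    "T' = \<lparr>verts = I.newV, edges = I.newE, lab = (lab T)(x := y), len = l\<rparr>"
  have sel: "verts T' = I.newV" "edges T' = I.newE" "lab T' = (lab T)(x := y)" "len T' = l"
    by (simp_all add: T'_def)
  have labT': "lab T' c = lab T c" if "c \<in> L" for c using that x by (auto simp: sel)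
  have labx: "lab T' x = y" by (simp add: sel)
  have deg': "degree T' v = I.new.deg v" for v by (simp add: degree_def I.new.deg_def sel)
  have deg: "degree T v = T.deg v" for v by (simp add: degree_def T.deg_def)
  have leaves': "leaves T' = insert y (leaves T)"
    using I.new_deg fresh by (auto simp: leaves_def deg' deg sel I.newV_def)
  have lt': "labeled_tree (insert x L) T'"
    unfolding labeled_tree_def
  proof (intro conjI ballI)
    show "is_tree T'" by (rule bridge_tree_imp_is_tree) (simp add: sel I.new_bridge_tree)
    show "degree T' v \<noteq> 2" if "v \<in> verts T'" for v
      using that I.new_deg T.deg2 by (auto simp: deg' sel I.newV_def)
    have "bij_betw (lab T) L (leaves T)" using lt by (simp add: labeled_tree_def)
    then have "bij_betw (lab T') L (leaves T)" using labT' by (simp cong: bij_betw_cong)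
    moreover have "y \<notin> leaves T" using fresh by (simp add: leaves_def)
    ultimately have "bij_betw (lab T') (L \<union> {x}) (leaves T \<union> {lab T' x})"
      using x labx by (intro notIn_Un_bij_betw) auto
    then show "bij_betw (lab T') (insert x L) (leaves T')" by (simp add: leaves' labx)
  qed
  have lnn: "0 \<le> l f" if "f \<in> I.newE" for f
    using that r t nonneg by (cases rule: I.newE_cases) (auto simp: l_def I.new_len_simps)
  have "2 \<le> card (insert x L)" using L x T.finite_L by simp
  then have lm: "leaf_metric T' c d = I.new.vdist l (lab T' c) (lab T' d)"
    if "c \<in> insert x L" "d \<in> insert x L" for c d
    using leaf_metric_eq_vdist[OF lt' _ that] by (simp add: sel)
  have old: "leaf_metric T' c d = leaf_metric T c d" if "c \<in> L" "d \<in> L" for c d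
    using lm lmT that labT' I.new_vdist_old[OF T.lb(1)[OF that(1)] T.lb(1)[OF that(2)]] by (simp add: l_def)
  have N: "m \<in> I.newV" "v \<in> verts T \<Longrightarrow> v \<in> I.newV" for v by (auto simp: I.newV_def)
  have btw: "I.new.con f m (lab T a) \<or> I.new.con f m (lab T b)" if "f \<in> I.newE" for f
    by (rule I.new_between[OF V(1,2) pq(2,3) that])
  have am: "I.new.vdist l (lab T a) m = s"
    using I.new_vdist_near[OF V(1) pq(2), of "len T" r t] by (simp add: l_def r_def)
  have oldv: "I.new.vdist l (lab T c) (lab T d) = leaf_metric T c d" if "c \<in> L" "d \<in> L" for c d
    using I.new_vdist_old[OF T.lb(1)[OF that(1)] T.lb(1)[OF that(2)]] lmT[OF that] by (simp add: l_def)
  have bm: "I.new.vdist l (lab T b) m = leaf_metric T a b - s"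
    using I.new.vdist_between[OF N(1) N(2)[OF V(1)] N(2)[OF V(2)] btw, of l] am oldv[OF ab(1,2)] by simp
  have new: "leaf_metric T' c x = t + max (leaf_metric T a c - s) (leaf_metric T b c - (leaf_metric T a b - s))"
    if c: "c \<in> L" for c
  proof -
    have "leaf_metric T' c x = I.new.vdist l (lab T c) y" using lm[of c x] c labT' labx by simp
    also have "\<dots> = I.new.vdist l (lab T c) m + t"
      using I.new_vdist_leaf[OF T.lb(1)[OF c]] by (simp add: l_def)
    also have "I.new.vdist l (lab T c) m = max (I.new.vdist l (lab T a) (lab T c) - I.new.vdist l (lab T a) m)
        (I.new.vdist l (lab T b) (lab T c) - I.new.vdist l (lab T b) m)"
      by (rule I.new.vdist_from_path[OF N(1) N(2)[OF V(1)] N(2)[OF V(2)] N(2)[OF T.lb(1)[OF c]] btw lnn])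
    finally show ?thesis using am bm oldv ab c by simp
  qed
  have "metric_tree (insert x L) T'"
    using lt' lnn by (simp add: metric_tree_def sel)
  moreover have "leaf_metric T' x c = leaf_metric T' c x" if "c \<in> L" for c
    using lm[of x c] lm[of c x] that I.new.vdist_commute by simp
  ultimately show ?thesis using old new by (intro exI[of _ T']) blast
qed

lemma two_leaf_tree:
  assumes "a \<noteq> b" "0 \<le> d"
  shows "\<exists>T :: (nat, 'a) metric_graph. metric_tree {a, b} T \<and> leaf_metric T a b = d \<and> leaf_metric T b a = d"
proof -
  define T :: "(nat, 'a) metric_graph" where
    "T = \<lparr>verts = {0, 1}, edges = {{0, 1}}, lab = (\<lambda>x. if x = a then 0 else 1), len = (\<lambda>_. d)\<rparr>"
  have sel: "verts T = {0, 1}" "edges T = {{0, 1}}" "lab T a = 0" "lab T b = 1" "len T e = d" for e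
    using assms(1) by (simp_all add: T_def)
  have pairs: "{u, v} = {0, 1} \<longleftrightarrow> u = 0 \<and> v = 1 \<or> u = 1 \<and> v = 0" for u v :: nat
    by (simp add: doubleton_eq_iff)
  have e: "conn {{0, 1}} u v" if "u \<in> {0, 1}" "v \<in> {0, 1 :: nat}" for u v
  proof (cases "u = v")
    case False
    then have "{u, v} = {0, 1}" using that by auto
    then show ?thesis by (intro conn_edge) simp
  qed simp
  have bt: "bridge_tree (verts T) (edges T)"
    by (rule bridge_tree_of_sides(1)[where side = "\<lambda>_ u. u = 0"]) (use e pairs in \<open>auto simp: sel\<close>)
  interpret bridge_tree "verts T" "edges T" by (rule bt)
  have "{e \<in> edges T. v \<in> e} = {{0, 1}}" if "v \<in> {0, 1}" for v using that by (auto simp: sel)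
  then have deg: "degree T v = 1" if "v \<in> {0, 1}" for v using that by (simp add: degree_def)
  then have leaves: "leaves T = {0, 1}" by (auto simp: leaves_def sel)
  have "bij_betw (lab T) {a, b} (leaves T)"
    using assms(1) by (auto simp: bij_betw_def inj_on_def sel leaves)
  then have lt: "labeled_tree {a, b} T"
    using deg bridge_tree_imp_is_tree[OF bt] by (auto simp: labeled_tree_def sel)
  have c2: "2 \<le> card {a, b}" using assms(1) by simp
  have "\<not> con {0, 1} 0 1" using bridge[of 0 1] by (simp add: sel)
  then have "vdist (len T) 0 1 = d" unfolding vdist_def by (simp add: sel)
  moreover from this have "vdist (len T) 1 0 = d" using vdist_commute by metis
  ultimately have "leaf_metric T a b = d" "leaf_metric T b a = d"
    using leaf_metric_eq_vdist[OF lt c2, of a b] leaf_metric_eq_vdist[OF lt c2, of b a] by (simp_all add: sel)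
  then show ?thesis using lt assms(2) by (intro exI[of _ T]) (simp add: metric_tree_def sel)
qed

text \<open>Buneman's theorem. The new leaf \<open>x\<close> is attached to a path between two old leaves that minimises the
  distance from \<open>x\<close>; minimality is needed when the four-point condition leaves the third sum undetermined.\<close>

lemma tree_exists:
  assumes "2 \<le> n" "card L = n" "tree_metric_on L \<delta>"
  shows "\<exists>T :: (nat, 'a) metric_graph. metric_tree L T \<and> (\<forall>a\<in>L. \<forall>b\<in>L. a \<noteq> b \<longrightarrow> leaf_metric T a b = \<delta> a b)"
  using assms
proof (induction n arbitrary: L rule: nat_induct_at_least)
  case base
  then obtain a b where ab: "L = {a, b}" "a \<noteq> b" by (metis card_2_iff)
  then have d: "0 \<le> \<delta> a b" "\<delta> b a = \<delta> a b"
    using tree_metric_onD(1,2)[OF base(2)] by auto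
  obtain T :: "(nat, 'a) metric_graph" where "metric_tree {a, b} T" "leaf_metric T a b = \<delta> a b" "leaf_metric T b a = \<delta> a b"
    using two_leaf_tree[OF ab(2) d(1)] by blast
  then show ?case using ab d by (intro exI[of _ T]) auto
next
  case (Suc n)
  obtain x L' where L: "L = insert x L'" "x \<notin> L'" "card L' = n"
    using Suc(3) by (metis card_Suc_eq)
  have finL: "finite L'" using L(3) Suc(1) by (metis card.infinite not_numeral_le_zero)
  have m: "tree_metric_on L' \<delta>" using tree_metric_on_subset[OF Suc(4)] L by auto
  have c2: "2 \<le> card L'" using L Suc(1) by simp
  obtain T :: "(nat, 'a) metric_graph" where T: "metric_tree L' T"
    "\<forall>a\<in>L'. \<forall>b\<in>L'. a \<noteq> b \<longrightarrow> leaf_metric T a b = \<delta> a b"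
    using Suc(2)[OF L(3) m] by blast
  note M = tree_metric_onD[OF Suc(4)]
  \<comment> \<open>The Gromov product: in a tree, the distance from \<open>x\<close> to the path
    between \<open>a\<close> and \<open>b\<close>.\<close>
  define \<tau> where "\<tau> = (\<lambda>(a, b). (\<delta> x a + \<delta> x b - \<delta> a b) / 2)"
  define P where "P = {(a, b). a \<in> L' \<and> b \<in> L' \<and> a \<noteq> b}"
  have "finite P" by (rule finite_subset[of _ "L' \<times> L'"]) (auto simp: P_def finL)
  obtain a0 b0 where "a0 \<in> L'" "b0 \<in> L'" "a0 \<noteq> b0"
    using c2 card_le_Suc0_iff_eq[OF finL] by fastforce
  then have "P \<noteq> {}" by (auto simp: P_def)
  then obtain z where z: "z \<in> P" "\<And>z'. z' \<in> P \<Longrightarrow> \<tau> z \<le> \<tau> z'"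
    using arg_min_if_finite(1)[OF \<open>finite P\<close>, of \<tau>] arg_min_least[OF \<open>finite P\<close>, of _ \<tau>] by blast
  obtain a b where zab: "z = (a, b)" by (cases z)
  have ab: "a \<in> L'" "b \<in> L'" "a \<noteq> b" using z(1) zab by (auto simp: P_def)
  have min: "\<delta> x a + \<delta> x b - \<delta> a b \<le> \<delta> x c + \<delta> x d - \<delta> c d" if "c \<in> L'" "d \<in> L'" "c \<noteq> d" for c d
    using z(2)[of "(c, d)"] that zab by (simp add: P_def \<tau>_def divide_right_mono)
  \<comment> \<open>\<open>t\<close> and \<open>s\<close> solve \<open>t + s = \<delta> x a\<close>
    and \<open>t + (\<delta> a b - s) = \<delta> x b\<close>, as a leaf hanging at distance
    \<open>s\<close> from \<open>a\<close> must.\<close>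
  define t where "t = (\<delta> x a + \<delta> x b - \<delta> a b) / 2"
  define s where "s = (\<delta> a b + \<delta> x a - \<delta> x b) / 2"
  have inL: "x \<in> L" "a \<in> L" "b \<in> L" "c \<in> L' \<Longrightarrow> c \<in> L" for c using L ab by auto
  have nx: "x \<noteq> a" "x \<noteq> b" "c \<in> L' \<Longrightarrow> c \<noteq> x" for c using L ab by auto
  have tri: "\<delta> a b \<le> \<delta> x a + \<delta> x b" "\<delta> x b \<le> \<delta> a b + \<delta> x a" "\<delta> x a \<le> \<delta> a b + \<delta> x b"
    using M(3)[of a b x] M(3)[of x b a] M(3)[of x a b] M(1) inL nx ab(3) by auto
  have Tab: "leaf_metric T a b = \<delta> a b" using T(2) ab by blast
  have st: "0 \<le> t" "0 \<le> s" "s \<le> leaf_metric T a b"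
    using tri unfolding t_def s_def Tab by auto
  obtain T' :: "(nat, 'a) metric_graph" where T': "metric_tree (insert x L') T'"
    "\<forall>c\<in>L'. \<forall>d\<in>L'. leaf_metric T' c d = leaf_metric T c d"
    "\<forall>c\<in>L'. leaf_metric T' c x = t + max (leaf_metric T a c - s) (leaf_metric T b c - (leaf_metric T a b - s)) \<and>
      leaf_metric T' x c = leaf_metric T' c x"
    using insert_leaf[OF T(1) c2 L(2) ab st(2,3,1)] by blast
  have lt: "labeled_tree L' T" using T(1) by (simp add: metric_tree_def)
  interpret leaf_labeled_tree "verts T" "edges T" L' "lab T" "zero_edges T"
    by (rule labeled_tree_imp_leaf_labeled_tree[OF lt c2])
  have diag: "leaf_metric T c c = 0" if "c \<in> L'" for c
    using leaf_metric_eq_vdist[OF lt c2 that that] by simp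
  have new: "leaf_metric T' c x = \<delta> x c" if c: "c \<in> L'" for c
  proof -
    have eq: "leaf_metric T' c x = t + max (leaf_metric T a c - s) (leaf_metric T b c - (\<delta> a b - s))"
      using T'(3) c Tab by simp
    consider "c = a" | "c = b" | "c \<noteq> a" "c \<noteq> b" by blast
    then show ?thesis
    proof cases
      case 1
      have ba: "leaf_metric T b a = \<delta> a b" using T(2) ab M(1) inL by metis
      have "max (0 - s) (\<delta> a b - (\<delta> a b - s)) = s" using st(2) by (simp add: max_def)
      moreover have "t + s = \<delta> x a" unfolding t_def s_def by argo
      ultimately show ?thesis unfolding eq unfolding 1 diag[OF ab(1)] ba by simp
    next
      case 2
      have "max (\<delta> a b - s) (0 - (\<delta> a b - s)) = \<delta> a b - s" using st(3) Tab by (simp add: max_def)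
      moreover have "t + (\<delta> a b - s) = \<delta> x b" unfolding t_def s_def by argo
      ultimately show ?thesis unfolding eq unfolding 2 diag[OF ab(2)] Tab by simp
    next
      case 3
      have d: "leaf_metric T a c = \<delta> a c" "leaf_metric T b c = \<delta> b c" using T(2) ab c 3 by auto
      have sym: "\<delta> c x = \<delta> x c" "\<delta> b x = \<delta> x b" "\<delta> a x = \<delta> x a" "\<delta> b a = \<delta> a b" "\<delta> c a = \<delta> a c" "\<delta> c b = \<delta> b c"
        using M(1) inL c by blast+
      have D: "distinct [x, c, a, b]" "distinct [x, a, c, b]" "distinct [x, b, c, a]"
        using nx c 3 ab(3) by auto
      have 4: "\<delta> x c + \<delta> a b \<le> max (\<delta> x a + \<delta> b c) (\<delta> x b + \<delta> a c)"
        "\<delta> x a + \<delta> b c \<le> max (\<delta> x c + \<delta> a b) (\<delta> x b + \<delta> a c)"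
        "\<delta> x b + \<delta> a c \<le> max (\<delta> x c + \<delta> a b) (\<delta> x a + \<delta> b c)"
        using M(4)[OF inL(1) inL(4)[OF c] inL(2,3) D(1)] M(4)[OF inL(1,2) inL(4)[OF c] inL(3) D(2)]
          M(4)[OF inL(1,3) inL(4)[OF c] inL(2) D(3)] by (simp_all add: sym)
      \<comment> \<open>Minimality against the pairs with \<open>c\<close> makes
        \<open>\<delta> x c + \<delta> a b\<close> at least as large as the other two sums. The
        four-point condition bounds it by their maximum, so it equals that maximum, as the
        attachment formula requires.\<close>
      have 5: "\<delta> x a + \<delta> x b - \<delta> a b \<le> \<delta> x a + \<delta> x c - \<delta> a c" "\<delta> x a + \<delta> x b - \<delta> a b \<le> \<delta> x b + \<delta> x c - \<delta> b c"
        using min[of a c] min[of b c] ab c 3 by auto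
      have "\<delta> x c + \<delta> a b = max (\<delta> x a + \<delta> b c) (\<delta> x b + \<delta> a c)"
        using 4 5 by (simp add: max_def split: if_splits)
      moreover have "t + (\<delta> a c - s) = \<delta> x b + \<delta> a c - \<delta> a b" "t + (\<delta> b c - (\<delta> a b - s)) = \<delta> x a + \<delta> b c - \<delta> a b"
        unfolding t_def s_def by argo+
      ultimately show ?thesis unfolding eq d by (simp add: max_def split: if_splits)
    qed
  qed
  have "leaf_metric T' c d = \<delta> c d" if cd: "c \<in> L" "d \<in> L" "c \<noteq> d" for c d
  proof -
    consider "c \<in> L'" "d \<in> L'" | "c = x" "d \<in> L'" | "d = x" "c \<in> L'" using cd L(1) by blast
    then show ?thesis
    proof cases
      case 1
      then show ?thesis using T'(2) T(2) cd(3) by simp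
    next
      case 2
      then show ?thesis using T'(3) new by simp
    next
      case 3
      then show ?thesis using new M(1)[of c x] inL by simp
    qed
  qed
  then show ?case using T'(1) L(1) by (intro exI[of _ T']) simp
qed

section \<open>Arrangements and subdivisions\<close>

lemma card_compl_singleton: "card (UNIV - {i :: 'n::finite}) = CARD('n) - 1"
  by (simp add: card_Diff_singleton)

text \<open>The orderings of a triple read the value from different trees. For arrangements they all
  agree, which makes the description definite.\<close>

definition tree_weight :: "('n::finite \<Rightarrow> (nat, 'n) metric_graph) \<Rightarrow> 'n set \<Rightarrow> real" where
  "tree_weight T = (\<lambda>X\<in>triples. THE r. \<exists>i j k. distinct [i, j, k] \<and> X = {i, j, k} \<and> r = - leaf_metric (T i) j k)"

context
  assumes card_UNIV: "CARD('n::finite) \<ge> 3"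
begin

lemma two_le_card_labels: "2 \<le> card (UNIV - {i :: 'n})"
  using card_UNIV by (simp add: card_compl_singleton)

text \<open>The compatibility of an arrangement is cyclic in the three labels; together with
  symmetry of each leaf metric it covers all six orderings.\<close>

lemma arrangement_symmetric:
  fixes T :: "'n \<Rightarrow> (nat, 'n) metric_graph"
  assumes T: "T \<in> arrangements" and d: "distinct [i, j, k]" and d': "distinct [i', j', k']"
    and eq: "{i, j, k} = {i', j', k'}"
  shows "leaf_metric (T i) j k = leaf_metric (T i') j' k'"
proof -
  have c: "leaf_metric (T i) j k = leaf_metric (T i) k j" if "distinct [i, j, k]" for i j k
    by (rule leaf_metric_commute[OF _ two_le_card_labels]) (use T that in \<open>auto simp: arrangements_def\<close>)
  have r: "leaf_metric (T i) j k = leaf_metric (T j) k i" "leaf_metric (T j) k i = leaf_metric (T k) i j"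
    if "distinct [i, j, k]" for i j k
    using T that unfolding arrangements_def by blast+
  have "i' = i \<and> j' = j \<and> k' = k \<or> i' = i \<and> j' = k \<and> k' = j \<or> i' = j \<and> j' = k \<and> k' = i \<or>
      i' = j \<and> j' = i \<and> k' = k \<or> i' = k \<and> j' = i \<and> k' = j \<or> i' = k \<and> j' = j \<and> k' = i"
  proof -
    have "i' \<in> {i, j, k}" "j' \<in> {i, j, k}" "k' \<in> {i, j, k}" unfolding eq by simp_all
    then have "i' = i \<or> i' = j \<or> i' = k" "j' = i \<or> j' = j \<or> j' = k" "k' = i \<or> k' = j \<or> k' = k"
      by blast+
    then show ?thesis using d' by (elim disjE) simp_all
  qed
  moreover have "distinct [j, k, i]" "distinct [k, i, j]" using d by auto
  ultimately show ?thesis using c[OF d] c[of j k i] c[of k i j] r[OF d] by (elim disjE conjE) simp_all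
qed

lemma tree_weight_triple:
  fixes T :: "'n \<Rightarrow> (nat, 'n) metric_graph"
  assumes T: "T \<in> arrangements" and d: "distinct [i, j, k]"
  shows "tree_weight T {i, j, k} = - leaf_metric (T i) j k"
proof -
  have "(THE r. \<exists>i' j' k'. distinct [i', j', k'] \<and> {i, j, k} = {i', j', k'} \<and> r = - leaf_metric (T i') j' k')
      = - leaf_metric (T i) j k"
  proof (rule the_equality)
    show "\<exists>i' j' k'. distinct [i', j', k'] \<and> {i, j, k} = {i', j', k'} \<and>
        - leaf_metric (T i) j k = - leaf_metric (T i') j' k'"
      using d by blast
    fix r assume "\<exists>i' j' k'. distinct [i', j', k'] \<and> {i, j, k} = {i', j', k'} \<and> r = - leaf_metric (T i') j' k'"
    then show "r = - leaf_metric (T i) j k" using arrangement_symmetric[OF T d] by metis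
  qed
  then show ?thesis using triple_mem[OF d] by (simp add: tree_weight_def)
qed

lemma tree_weight_weights: "tree_weight T \<in> weights"
  by (simp add: tree_weight_def weights_def)

lemma tree_weight_unique:
  fixes T :: "'n \<Rightarrow> (nat, 'n) metric_graph"
  assumes "T \<in> arrangements" "w \<in> weights"
    "\<And>i j k. distinct [i, j, k] \<Longrightarrow> w {i, j, k} = - leaf_metric (T i) j k"
  shows "w = tree_weight T"
proof
  fix X :: "'n set"
  show "w X = tree_weight T X"
  proof (cases "X \<in> triples")
    case True
    then obtain i j k where "distinct [i, j, k]" "X = {i, j, k}" using triple_cases by metis
    then show ?thesis using assms(3) tree_weight_triple[OF assms(1)] by simp
  next
    case False
    then show ?thesis
      using assms(2) tree_weight_weights[of T] by (simp add: weights_def PiE_def extensional_def)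
  qed
qed

lemma arrangement_metric_tree: "T \<in> arrangements \<Longrightarrow> metric_tree (UNIV - {i}) (T i)"
  by (simp add: arrangements_def)

lemma tree_weight_dressian:
  fixes T :: "'n \<Rightarrow> (nat, 'n) metric_graph"
  assumes T: "T \<in> arrangements"
  shows "tree_weight T \<in> dressian"
proof -
  have "three_term (tree_weight T)"
    unfolding three_term_def
  proof (intro allI impI)
    fix h i j k l :: 'n assume d: "distinct [h, i, j, k, l]"
    have "leaf_metric (T h) i j + leaf_metric (T h) k l \<le>
        max (leaf_metric (T h) i k + leaf_metric (T h) j l) (leaf_metric (T h) i l + leaf_metric (T h) j k)"
      by (rule leaf_metric_four_points(1)[OF arrangement_metric_tree[OF T] two_le_card_labels]) (use d in auto)
    moreover have "tree_weight T {h, x, y} = - leaf_metric (T h) x y" if "distinct [h, x, y]" for x y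
      by (rule tree_weight_triple[OF T that])
    ultimately show "min (tree_weight T {h, i, k} + tree_weight T {h, j, l}) (tree_weight T {h, i, l} + tree_weight T {h, j, k})
        \<le> tree_weight T {h, i, j} + tree_weight T {h, k, l}"
      using d by (auto simp: min_le_iff_disj le_max_iff_disj)
  qed
  then show ?thesis by (simp add: dressian_iff tree_weight_weights)
qed

lemma term_minimal_tree_weight:
  fixes T :: "'n \<Rightarrow> (nat, 'n) metric_graph"
  assumes T: "T \<in> arrangements" and d: "distinct [h, i, j, k, l]"
  shows "term_minimal (tree_weight T) h i j k l \<longleftrightarrow> \<not> tree_quartet (T h) i j k l"
proof -
  have "max (leaf_metric (T h) i k + leaf_metric (T h) j l) (leaf_metric (T h) i l + leaf_metric (T h) j k)
      \<le> leaf_metric (T h) i j + leaf_metric (T h) k l \<longleftrightarrow> \<not> tree_quartet (T h) i j k l"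
    by (rule leaf_metric_four_points(2)[OF arrangement_metric_tree[OF T] two_le_card_labels]) (use d in auto)
  moreover have "tree_weight T {h, x, y} = - leaf_metric (T h) x y" if "distinct [h, x, y]" for x y
    by (rule tree_weight_triple[OF T that])
  ultimately show ?thesis using d unfolding term_minimal_def by auto
qed

text \<open>Both sides say that the trees at every \<open>h\<close> display the same quartets. The
  relation is thus pulled back from equality of subdivisions, so it is an equivalence and the
  induced map on classes is injective.\<close>

lemma arrangement_equiv_iff:
  fixes S T :: "'n \<Rightarrow> (nat, 'n) metric_graph"
  assumes S: "S \<in> arrangements" and T: "T \<in> arrangements"
  shows "(S, T) \<in> arrangement_equiv \<longleftrightarrow> induced_subdivision (tree_weight S) = induced_subdivision (tree_weight T)"
proof -
  have lt: "labeled_tree (UNIV - {h}) (S h)" "labeled_tree (UNIV - {h}) (T h)" for h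
    using arrangement_metric_tree[OF S] arrangement_metric_tree[OF T] by (auto simp: metric_tree_def)
  have "induced_subdivision (tree_weight S) = induced_subdivision (tree_weight T) \<longleftrightarrow>
      same_minimal (tree_weight S) (tree_weight T)"
    by (rule induced_subdivision_eq_iff_minimal_terms)
      (use tree_weight_dressian S T in \<open>auto simp: dressian_iff\<close>)
  also have "\<dots> \<longleftrightarrow> (\<forall>h i j k l. distinct [h, i, j, k, l] \<longrightarrow> tree_quartet (S h) i j k l = tree_quartet (T h) i j k l)"
    unfolding same_minimal_def using term_minimal_tree_weight[OF S] term_minimal_tree_weight[OF T] by metis
  also have "\<dots> \<longleftrightarrow> (\<forall>h. \<forall>i\<in>UNIV - {h}. \<forall>j\<in>UNIV - {h}. \<forall>k\<in>UNIV - {h}. \<forall>l\<in>UNIV - {h}.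
      distinct [i, j, k, l] \<longrightarrow> tree_quartet (S h) i j k l = tree_quartet (T h) i j k l)"
    by auto
  also have "\<dots> \<longleftrightarrow> (\<forall>h. tree_iso (UNIV - {h}) (underlying_tree (S h)) (underlying_tree (T h)))"
    using tree_iso_underlying_iff[OF lt two_le_card_labels] by simp
  finally show ?thesis using S T by (simp add: arrangement_equiv_def)
qed

text \<open>Adding a large constant to the negated weights makes all of them tree metrics at once.\<close>

lemma dressian_realised:
  assumes w: "w \<in> dressian"
  shows "\<exists>T :: 'n \<Rightarrow> (nat, 'n) metric_graph. T \<in> arrangements \<and> induced_subdivision (tree_weight T) = induced_subdivision w"
proof -
  \<comment> \<open>The factor 3 pays for the three weights in a triangle inequality, which needs
    \<open>w {h, a, c} + w {h, c, b} - w {h, a, b} \<le> C\<close>. Nonnegativity follows from the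
    same bound.\<close>
  define C where "C = 3 * (\<Sum>X\<in>triples. \<bar>w X\<bar>)"
  have C: "3 * \<bar>w X\<bar> \<le> C" if "X \<in> triples" for X
    unfolding C_def using member_le_sum[of X triples "\<lambda>X. \<bar>w X\<bar>"] that by simp
  define \<delta> where "\<delta> h i j = (if i = j then 0 else C - w {h, i, j})" for h i j :: 'n
  have "tree_metric_on (UNIV - {h}) (\<delta> h)" for h
    unfolding tree_metric_on_def
  proof (intro conjI ballI impI)
    fix a b assume ab: "a \<in> UNIV - {h}" "b \<in> UNIV - {h}"
    have "{h, a, b} = {h, b, a}" by blast
    then show "\<delta> h a b = \<delta> h b a" by (simp add: \<delta>_def)
    show "0 \<le> \<delta> h a b"
      using ab C[of "{h, a, b}"] triple_mem[of h a b] by (auto simp: \<delta>_def)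
    fix c assume c: "c \<in> UNIV - {h}"
    show "\<delta> h a b \<le> \<delta> h a c + \<delta> h c b" if d: "distinct [a, b, c]"
    proof -
      have "distinct [h, a, b]" "distinct [h, a, c]" "distinct [h, c, b]" using ab c d by auto
      then have "3 * \<bar>w {h, a, b}\<bar> \<le> C" "3 * \<bar>w {h, a, c}\<bar> \<le> C" "3 * \<bar>w {h, c, b}\<bar> \<le> C"
        using C triple_mem by blast+
      then have "C - w {h, a, b} \<le> (C - w {h, a, c}) + (C - w {h, c, b})" by linarith
      then show ?thesis using d by (auto simp: \<delta>_def)
    qed
    fix e assume e: "e \<in> UNIV - {h}" and d: "distinct [a, b, c, e]"
    then have "distinct [h, a, b, c, e]" using ab c by auto
    then have "min (w {h, a, c} + w {h, b, e}) (w {h, a, e} + w {h, b, c}) \<le> w {h, a, b} + w {h, c, e}"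
      using w unfolding dressian_iff three_term_def by blast
    then show "\<delta> h a b + \<delta> h c e \<le> max (\<delta> h a c + \<delta> h b e) (\<delta> h a e + \<delta> h b c)"
      using d by (auto simp: \<delta>_def min_le_iff_disj le_max_iff_disj)
  qed
  then have "\<exists>T :: (nat, 'n) metric_graph. metric_tree (UNIV - {h}) T \<and>
      (\<forall>a\<in>UNIV - {h}. \<forall>b\<in>UNIV - {h}. a \<noteq> b \<longrightarrow> leaf_metric T a b = \<delta> h a b)" for h
    using tree_exists[OF two_le_card_labels refl] by blast
  then obtain T :: "'n \<Rightarrow> (nat, 'n) metric_graph" where
    T: "\<And>h. metric_tree (UNIV - {h}) (T h)"
      "\<And>h a b. a \<noteq> h \<Longrightarrow> b \<noteq> h \<Longrightarrow> a \<noteq> b \<Longrightarrow> leaf_metric (T h) a b = \<delta> h a b"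
    by (metis DiffI UNIV_I singletonD)
  have lm: "leaf_metric (T h) a b = C - w {h, a, b}" if "distinct [h, a, b]" for h a b
    using T(2)[of a h b] that by (auto simp: \<delta>_def)
  have "T \<in> arrangements"
    unfolding arrangements_def
  proof (intro CollectI conjI allI impI)
    show "metric_tree (UNIV - {h}) (T h)" for h by (rule T(1))
    fix i j k :: 'n assume d: "distinct [i, j, k]"
    have "{j, k, i} = {i, j, k}" "{k, i, j} = {i, j, k}" by blast+
    moreover have "distinct [j, k, i]" "distinct [k, i, j]" using d by auto
    ultimately show "leaf_metric (T i) j k = leaf_metric (T j) k i" "leaf_metric (T j) k i = leaf_metric (T k) i j"
      using lm d by simp_all
  qed
  moreover have "induced_subdivision (tree_weight T) = induced_subdivision w"
  proof -
    have tw: "tree_weight T {h, a, b} = w {h, a, b} - C" if "distinct [h, a, b]" for h a b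
      using tree_weight_triple[OF \<open>T \<in> arrangements\<close> that] lm[OF that] by simp
    \<comment> \<open>Each term adds two weights, so all terms are shifted by the same
      \<open>2 * C\<close>.\<close>
    have "same_minimal (tree_weight T) w"
      unfolding same_minimal_def term_minimal_def using tw by auto
    then show ?thesis
      using induced_subdivision_eq_iff_minimal_terms tree_weight_dressian[OF \<open>T \<in> arrangements\<close>] w
      by (auto simp: dressian_iff)
  qed
  ultimately show ?thesis by blast
qed

lemma equiv_arrangement_equiv:
  "equiv (arrangements :: ('n \<Rightarrow> (nat, 'n) metric_graph) set) arrangement_equiv"
proof (rule equivI)
  show "arrangement_equiv \<subseteq> arrangements \<times> (arrangements :: ('n \<Rightarrow> (nat, 'n) metric_graph) set)"
    by (auto simp: arrangement_equiv_def)
  show "refl_on (arrangements :: ('n \<Rightarrow> (nat, 'n) metric_graph) set) arrangement_equiv"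
    by (auto simp: refl_on_def arrangement_equiv_iff)
  have mem: "S \<in> arrangements \<and> T \<in> arrangements" if "(S, T) \<in> arrangement_equiv" for S T :: "'n \<Rightarrow> (nat, 'n) metric_graph"
    using that by (auto simp: arrangement_equiv_def)
  show "sym (arrangement_equiv :: (('n \<Rightarrow> (nat, 'n) metric_graph) \<times> _) set)"
    by (rule symI) (metis mem arrangement_equiv_iff)
  show "trans (arrangement_equiv :: (('n \<Rightarrow> (nat, 'n) metric_graph) \<times> _) set)"
    by (rule transI) (metis mem arrangement_equiv_iff)
qed

lemma arrangements_bij_subdivisions:
  "\<exists>f. bij_betw f
         ((arrangements :: ('n \<Rightarrow> (nat, 'n) metric_graph) set) // arrangement_equiv)
         (regular_matroid_subdivisions :: (real ^ 'n) set set set) \<and>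
       (\<forall>T\<in>arrangements. \<forall>w\<in>weights.
          (\<forall>i j k. distinct [i, j, k] \<longrightarrow> w {i, j, k} = - leaf_metric (T i) j k) \<longrightarrow>
          f (arrangement_equiv `` {T}) = induced_subdivision w)"
proof -
  define g where "g T = induced_subdivision (tree_weight T)" for T :: "'n \<Rightarrow> (nat, 'n) metric_graph"
  \<comment> \<open>The chosen representative does not matter, because \<open>g\<close> is constant
    on equivalence classes.\<close>
  define f where "f Q = g (SOME T. T \<in> Q)" for Q
  note eqv = equiv_arrangement_equiv
  have f: "f (arrangement_equiv `` {T}) = g T" if T: "T \<in> arrangements" for T
  proof -
    have "T \<in> arrangement_equiv `` {T}" using T arrangement_equiv_iff by blast
    then have "(SOME S. S \<in> arrangement_equiv `` {T}) \<in> arrangement_equiv `` {T}"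
      by (rule someI[where P = "\<lambda>S. S \<in> arrangement_equiv `` {T}"])
    then have S: "(T, SOME S. S \<in> arrangement_equiv `` {T}) \<in> arrangement_equiv" by simp
    then have "(SOME S. S \<in> arrangement_equiv `` {T}) \<in> arrangements" by (auto simp: arrangement_equiv_def)
    then show ?thesis using S arrangement_equiv_iff[OF T] by (simp add: f_def g_def)
  qed
  have "inj_on f (arrangements // arrangement_equiv)"
  proof (rule inj_onI)
    fix P Q assume PQ: "P \<in> arrangements // arrangement_equiv" "Q \<in> arrangements // arrangement_equiv" "f P = f Q"
    obtain S where S: "S \<in> arrangements" "P = arrangement_equiv `` {S}" using PQ(1) by (rule quotientE)
    obtain T where T: "T \<in> arrangements" "Q = arrangement_equiv `` {T}" using PQ(2) by (rule quotientE)
    have "(S, T) \<in> arrangement_equiv"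
      using PQ(3) f S T arrangement_equiv_iff by (simp add: g_def)
    then show "P = Q" unfolding S(2) T(2) by (rule equiv_class_eq[OF eqv])
  qed
  moreover have "f ` (arrangements // arrangement_equiv) = (regular_matroid_subdivisions :: (real ^ 'n) set set set)"
  proof
    show "f ` (arrangements // arrangement_equiv) \<subseteq> regular_matroid_subdivisions"
      using f tree_weight_dressian by (auto simp: regular_matroid_subdivisions_eq g_def elim!: quotientE)
    show "regular_matroid_subdivisions \<subseteq> f ` (arrangements // arrangement_equiv)"
      unfolding regular_matroid_subdivisions_eq
    proof (rule image_subsetI)
      fix w :: "'n set \<Rightarrow> real" assume "w \<in> dressian"
      then obtain T :: "'n \<Rightarrow> (nat, 'n) metric_graph" where T: "T \<in> arrangements" "g T = induced_subdivision w"
        using dressian_realised unfolding g_def by blast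
      then have "induced_subdivision w = f (arrangement_equiv `` {T})" using f by simp
      then show "induced_subdivision w \<in> f ` (arrangements // arrangement_equiv)"
        using quotientI[OF T(1)] by (rule image_eqI)
    qed
  qed
  moreover have "f (arrangement_equiv `` {T}) = induced_subdivision w"
    if "T \<in> arrangements" "w \<in> weights" "\<forall>i j k. distinct [i, j, k] \<longrightarrow> w {i, j, k} = - leaf_metric (T i) j k" for T w
    using f[OF that(1)] tree_weight_unique[OF that(1,2)] that(3) by (simp add: g_def)
  ultimately show ?thesis by (intro exI[of _ f] conjI ballI impI) (simp_all add: bij_betw_def)
qed

end

lemma secondary_fan_eq_pluecker_fan:
  "(secondary_fan :: ('n::finite set \<Rightarrow> real) set set) = pluecker_fan"
proof -
  have "(induced_subdivision w = induced_subdivision w') \<longleftrightarrow>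
      (\<forall>h i j k l. distinct [h, i, j, k, l] \<longrightarrow> minimal_terms w h i j k l = minimal_terms w' h i j k l)"
    if "w \<in> dressian" "w' \<in> dressian" for w w' :: "'n set \<Rightarrow> real"
    unfolding minimal_terms_eq_iff same_minimal_def[symmetric]
    by (rule induced_subdivision_eq_iff_minimal_terms) (use that in \<open>auto simp: dressian_iff\<close>)
  then have "{(w, w'). w \<in> dressian \<and> w' \<in> dressian \<and> induced_subdivision w = induced_subdivision w'} =
      {(w, w' :: 'n set \<Rightarrow> real). w \<in> dressian \<and> w' \<in> dressian \<and>
        (\<forall>h i j k l. distinct [h, i, j, k, l] \<longrightarrow> minimal_terms w h i j k l = minimal_terms w' h i j k l)}"
    by (intro Collect_cong) blast
  then show ?thesis unfolding secondary_fan_def pluecker_fan_def by simp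
qed

theorem theorem4p4:
  assumes "CARD('n::finite) \<ge> 3"
  shows "(\<exists>f. bij_betw f
              ((arrangements :: ('n \<Rightarrow> (nat, 'n) metric_graph) set) // arrangement_equiv)
              (regular_matroid_subdivisions :: (real ^ 'n) set set set) \<and>
            (\<forall>T\<in>arrangements. \<forall>w\<in>weights.
               (\<forall>i j k. distinct [i, j, k] \<longrightarrow> w {i, j, k} = - leaf_metric (T i) j k) \<longrightarrow>
               f (arrangement_equiv `` {T}) = induced_subdivision w)) \<and>
         (secondary_fan :: ('n set \<Rightarrow> real) set set) = pluecker_fan"
  using arrangements_bij_subdivisions[OF assms] secondary_fan_eq_pluecker_fan by (rule conjI)

end
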